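(* Let $d\in\{2,3\}$. Assume that the data on $\mathcal T_h$ are locally divergence-free polynomials, that the cell and face quadratures have the properties listed in the context, and that all quadrature states and exterior boundary traces belong to $\mathcal G$. Suppose that the wave speeds satisfy $a^-\le a^{-,0}$ and $a^+\ge a^{+,0}$ at every interface point, and that for every $K\in\mathcal T_h$, $\nu\in\mathcal I_K^\partial$ and $1\le r\le M$ $$d_{K,\nu,r}>0\quad\text{or}\quad(\mathbf G_{K,\nu},\widehat q_{K,\nu,r})=(\mathbf F_{\mathbf n_{K,\nu}}(\mathbf U_{K,\nu}),q_{r,\mathbf n_{K,\nu}}(\mathbf U_{K,\nu})).$$ Then for every $0<\tau\le\tau_*^{\rm rel}$, where $$\tau_*^{\rm rel}:=\min_{K\in\mathcal T_h}\Big\{\tau_K^0,\ \min_{\nu\in\mathcal I_K^\partial}\frac{|K|\,\omega_{K,\nu}}{c_{K,\nu}\,\mathfrak c_{K,\nu}}\Big\}$$ (division by zero interpreted as $+\infty$), the forward Euler cell-average update $\overline{\mathbf U}_K^{n+1}=\overline{\mathbf U}_K^n-\lambda_K\sum_\nu c_{K,\nu}\mathbf G_{K,\nu}$, $\lambda_K=\tau/|K|$, is weakly multi-entropy stable: for every $K\in\mathcal T_h$ and $1\le r\le M$, $$\overline{\mathbf U}_K^{n+1}\in\mathcal G,\qquad\eta_r(\overline{\mathbf U}_K^{n+1})\le\mathcal B_{K,r}^n .$$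
   Context: **States, flux, entropies.** Fix $\gamma>1$. A state is $\mathbf U=(\rho,\mathbf m^\top,\mathbf B^\top,E)^\top\in\mathbb R^8$ with $\mathbf m,\mathbf B\in\mathbb R^3$; $\mathbf v=\mathbf m/\rho$, $p=(\gamma-1)(E-\frac{|\mathbf m|^2}{2\rho}-\frac{|\mathbf B|^2}{2})$, $p_{\rm tot}=p+\frac{|\mathbf B|^2}2$. Admissible set $\mathcal G=\{\mathbf U:\rho>0,\ E-\frac{|\mathbf m|^2}{2\rho}-\frac{|\mathbf B|^2}{2}>0\}$. $\mathbf F_i(\mathbf U)=(\rho v_i,(v_i\mathbf m-B_i\mathbf B+p_{\rm tot}\mathbf e_i)^\top,(v_i\mathbf B-B_i\mathbf v)^\top,v_i(E+p_{\rm tot})-B_i(\mathbf v\cdot\mathbf B))^\top$; $\mathbf S(\mathbf U)=(0,\mathbf B^\top,\mathbf v^\top,\mathbf v\cdot\mathbf B)^\top$. Let $f_1,\dots,f_M\in C^2(\mathbb R)$ satisfy $f_r'>0$, $f_r'-\gamma f_r''>0$ on $\mathbb R$; with $s=\log p-\gamma\log\rho$, $\eta_r(\mathbf U)=-\rho f_r(s)$ on $\mathcal G$. For a unit vector $\mathbf n\in\mathbb R^d$ (identified with $(n_1,n_2,0)^\top$ when $d=2$): $\mathbf F_{\mathbf n}=\sum_{i=1}^dn_i\mathbf F_i$, $B_{\mathbf n}(\mathbf U)=\mathbf B\cdot\mathbf n$, $q_{r,\mathbf n}(\mathbf U)=\eta_r(\mathbf U)\,\mathbf v\cdot\mathbf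 n$. $[z]_+=\max\{z,0\}$. **Splitting speeds.** For $\mathbf U,\widetilde{\mathbf U}\in\mathcal G$ and a unit vector $\xi$: $\mathcal C(\mathbf U;\xi)=\frac1{\sqrt2}\Big[\mathcal C_s^2+\frac{|\mathbf B|^2}\rho+\sqrt{(\mathcal C_s^2+\frac{|\mathbf B|^2}\rho)^2-4\frac{\mathcal C_s^2(\xi\cdot\mathbf B)^2}{\rho}}\Big]^{1/2}$, $\mathcal C_s^2=\frac{(\gamma-1)p}{2\rho}$. With $\widehat{\mathbf v}=\frac{\sqrt\rho\mathbf v+\sqrt{\tilde\rho}\tilde{\mathbf v}}{\sqrt\rho+\sqrt{\tilde\rho}}$ and $\mathfrak b=\frac{|\mathbf B-\widetilde{\mathbf B}|}{\sqrt\rho+\sqrt{\tilde\rho}}$, $\alpha_r(\mathbf U,\widetilde{\mathbf U};\xi)=\max\{\mathbf v\cdot\xi,\widehat{\mathbf v}\cdot\xi\}+\mathcal C(\mathbf U;\xi)+\mathfrak b$, $\alpha_l(\mathbf U,\widetilde{\mathbf U};\xi)=\min\{\mathbf v\cdot\xi,\widehat{\mathbf v}\cdot\xi\}-\mathcal C(\mathbf U;\xi)-\mathfrak b$. **Mesh, data, quadrature.** $\mathcal T_h$ is a finite conforming mesh of bounded polytopal cells $K\subset\mathbb R^d$ with nonempty interiors and planar faces. On each $K$, $\mathbf U_K^n\in[\mathbb P^k(K)]^8$ (total degree $\le k$), locally divergence-free (LDF): $\sum_{i=1}^d\partial_{x_i}B_{i,K}^n=0$ in $K$. For a face $e\subset\partial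 K$, $\mathbf n_{K,e}$ is the outward unit normal; a face quadrature $\{(\mathbf x_{e,q},\varpi_{e,q})\}_{q=1}^{Q_e}$, exact for face averages of $\mathbb P^k(e)$, with $\varpi_{e,q}>0$, $\sum_q\varpi_{e,q}=1$, is used, the same for both cells sharing $e$. $\mathcal I_K^\partial=\{(e,q):e\subset\partial K,1\le q\le Q_e\}$. For $\nu=(e,q)$: $c_{K,\nu}=|e|\varpi_{e,q}$, $\mathbf n_{K,\nu}=\mathbf n_{K,e}$, $\mathbf U_{K,\nu}=\mathbf U_K^n(\mathbf x_{e,q})$ (with components $\rho_{K,\nu},\mathbf v_{K,\nu},\mathbf B_{K,\nu}$), and $\mathbf U_{K,\nu}^{\rm ext}$ is the value at $\mathbf x_{e,q}$ of the polynomial of the neighboring cell across $e$ (a prescribed exterior boundary trace on the domain boundary). Each cell has a volume quadrature, exact for cell averages of $\mathbb P^k(K)$, with strictly positive weights summing to $1$, whose nodes include all face quadrature points: $\overline{\mathbf U}_K^n=\frac1{|K|}\int_K\mathbf U_K^n\,d\mathbf x=\sum_{\alpha\in\mathcal I_K^\circ}\omega_{K,\alpha}^\circ\widehat{\mathbf U}_K^{[\alpha]}+\sum_{\nu\in\mathcal I_K^\partial}\omega_{K,\nu}\mathbf U_{K,\nu}$, where $\widehat{\mathbf U}_K^{[\alpha]}$ are values of $\mathbf U_K^n$ at the remaining (interior) nodes ($\mathcal I_K^\circ$ may be empty). **Interface wave speeds and fluxes.** At each interface quadrature point, with traces $\mathbf U^\mp$ and unit normal $\mathbf n$ pointing from the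 minus to the plus side, let $\delta B_{\mathbf n}=B_{\mathbf n}(\mathbf U^+)-B_{\mathbf n}(\mathbf U^-)$, $\rho^\pm=\rho(\mathbf U^\pm)$, $s_F=\max_{\varsigma=\pm}\sqrt{(\gamma p(\mathbf U^\varsigma)+|\mathbf B(\mathbf U^\varsigma)|^2)/\rho(\mathbf U^\varsigma)}$, $a^{-,0}=\min\{0,\alpha_l(\mathbf U^-,\mathbf U^+;\mathbf n)\}-\frac{|\delta B_{\mathbf n}|}{\sqrt{\rho^-}}-s_F$, $a^{+,0}=\max\{0,\alpha_r(\mathbf U^+,\mathbf U^-;\mathbf n)\}+\frac{|\delta B_{\mathbf n}|}{\sqrt{\rho^+}}+s_F$. Wave speeds $a^-<0<a^+$ (independent of $\tau$) are chosen, $C_F=a^+-a^-$; reversing the orientation swaps the traces and maps $\mathbf n\mapsto-\mathbf n$, $(a^-,a^+)\mapsto(-a^+,-a^-)$, so both adjacent cells share one pair. Set $\widehat{\mathbf F}_{\mathbf n}=\frac{a^+\mathbf F_{\mathbf n}(\mathbf U^-)-a^-\mathbf F_{\mathbf n}(\mathbf U^+)+a^+a^-(\mathbf U^+-\mathbf U^-)}{C_F}$, $\widehat q_r=\frac{a^+q_{r,\mathbf n}(\mathbf U^-)-a^-q_{r,\mathbf n}(\mathbf U^+)+a^+a^-[\eta_r(\mathbf U^+)-\eta_r(\mathbf U^-)]}{C_F}$. Subscript $K,\nu$ denotes evaluation with $(\mathbf U^-,\mathbf U^+,\mathbf n)=(\mathbf U_{K,\nu},\mathbf U_{K,\nu}^{\rm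 ext},\mathbf n_{K,\nu})$, and $\mathbf G_{K,\nu}=\widehat{\mathbf F}_{K,\nu}-\frac{a_{K,\nu}^-}{a_{K,\nu}^+-a_{K,\nu}^-}\,\delta B_{K,\nu}\,\mathbf S(\mathbf U_{K,\nu})$. **Entropy budget.** $\mathcal B_{K,r}^n=\sum_\alpha\omega_{K,\alpha}^\circ\eta_r(\widehat{\mathbf U}_K^{[\alpha]})+\sum_\nu\omega_{K,\nu}\eta_r(\mathbf U_{K,\nu})-\lambda_K\sum_\nu c_{K,\nu}\widehat q_{K,\nu,r}$. **Cell coefficients, reference step, path.** $|\partial K|=\sum_\nu c_{K,\nu}$, $\widetilde{\mathbf v}_{K,\nu\mu}=\frac{\sqrt{\rho_{K,\nu}}\mathbf v_{K,\nu}+\sqrt{\rho_{K,\mu}}\mathbf v_{K,\mu}}{\sqrt{\rho_{K,\nu}}+\sqrt{\rho_{K,\mu}}}$, $\alpha_{K,\nu}^{\rm PP}=\max\Big\{\mathbf v_{K,\nu}\cdot\mathbf n_{K,\nu},\ \frac1{|\partial K|}\sum_{\mu}c_{K,\mu}(\mathbf n_{K,\nu}-\mathbf n_{K,\mu})\cdot\widetilde{\mathbf v}_{K,\nu\mu}\Big\}+\mathcal C(\mathbf U_{K,\nu};\mathbf n_{K,\nu})+\frac2{|\partial K|}\sum_\mu c_{K,\mu}\frac{|\mathbf B_{K,\nu}-\mathbf B_{K,\mu}|}{\sqrt{\rho_{K,\nu}}+\sqrt{\rho_{K,\mu}}}$ (sums over $\mu\in\mathcal I_K^\partial$). Fix $\sigma\in(0,1)$;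 $\tau_K^0=\sigma|K|\min_\nu\frac{\omega_{K,\nu}}{c_{K,\nu}(\alpha_{K,\nu}^{\rm PP}-a_{K,\nu}^-)}>0$; $\mathscr W_K=\{\overline{\mathbf U}_K^n-\frac\vartheta{|K|}\sum_\nu c_{K,\nu}\mathbf G_{K,\nu}:0\le\vartheta\le\tau_K^0\}\subset\mathcal G$. **Relative-entropy quantities.** $\mathbf V_r=\nabla\eta_r$, $\mathcal H_r(\mathbf U\mid\mathbf W)=\eta_r(\mathbf U)-\eta_r(\mathbf W)-\mathbf V_r(\mathbf W)^\top(\mathbf U-\mathbf W)$, $\psi_{r,\mathbf n}(\mathbf U)=\mathbf V_r(\mathbf U)^\top\mathbf F_{\mathbf n}(\mathbf U)-q_{r,\mathbf n}(\mathbf U)$, $\phi_r(\mathbf U)=\mathbf V_r(\mathbf U)^\top\mathbf S(\mathbf U)=\frac{(\gamma-1)\rho f_r'(s)}p(\mathbf v\cdot\mathbf B)$, $P_{K,\nu,r}(\mathbf W)=\psi_{r,\mathbf n_{K,\nu}}(\mathbf W)-\mathbf V_r(\mathbf W)^\top\mathbf G_{K,\nu}+\widehat q_{K,\nu,r}+\phi_r(\mathbf W)[B_{\mathbf n_{K,\nu}}(\mathbf W)-B_{\mathbf n_{K,\nu}}(\mathbf U_{K,\nu})]$, $d_{K,\nu,r}=\mathbf V_r(\mathbf U_{K,\nu})^\top\mathbf G_{K,\nu}-\widehat q_{K,\nu,r}-\psi_{r,\mathbf n_{K,\nu}}(\mathbf U_{K,\nu})$, $\mathfrak c_{K,\nu,r}=\sup_{\mathbf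 W\in\mathscr W_K,\ \mathbf W\neq\mathbf U_{K,\nu}}\frac{[P_{K,\nu,r}(\mathbf W)]_+}{\mathcal H_r(\mathbf U_{K,\nu}\mid\mathbf W)}$ (empty supremum $=0$), $\mathfrak c_{K,\nu}=\max_{1\le r\le M}\mathfrak c_{K,\nu,r}$. *)

theory Defs
  imports "HOL-Analysis.Analysis"
begin

section \<open>States, fluxes and entropies of ideal MHD\<close>

text \<open>The state space \<open>\<real>\<^sup>8\<close> is the Euclidean product space of density, momentum, magnetic field
  and total energy, so that \<open>\<bullet>\<close> and the gradient are those of \<open>\<real>\<^sup>8\<close>.\<close>

type_synonym state = "real \<times> (real^3) \<times> (real^3) \<times> real"

definition dens :: "state \<Rightarrow> real" where "dens U = fst U"
definition mom :: "state \<Rightarrow> real^3" where "mom U = fst (snd U)"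
definition mag :: "state \<Rightarrow> real^3" where "mag U = fst (snd (snd U))"
definition ener :: "state \<Rightarrow> real" where "ener U = snd (snd (snd U))"

definition vel :: "state \<Rightarrow> real^3" where
  "vel U = (1 / dens U) *\<^sub>R mom U"

definition press :: "real \<Rightarrow> state \<Rightarrow> real" where
  "press \<gamma> U = (\<gamma> - 1) * (ener U - (norm (mom U))\<^sup>2 / (2 * dens U) - (norm (mag U))\<^sup>2 / 2)"

definition ptot :: "real \<Rightarrow> state \<Rightarrow> real" where
  "ptot \<gamma> U = press \<gamma> U + (norm (mag U))\<^sup>2 / 2"

definition admissible :: "state set" where
  "admissible = {U. dens U > 0 \<and>
     ener U - (norm (mom U))\<^sup>2 / (2 * dens U) - (norm (mag U))\<^sup>2 / 2 > 0}"

definition flux :: "real \<Rightarrow> 3 \<Rightarrow> state \<Rightarrow> state" where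
  "flux \<gamma> i U =
    (dens U * vel U $ i,
     (vel U $ i) *\<^sub>R mom U - (mag U $ i) *\<^sub>R mag U + ptot \<gamma> U *\<^sub>R axis i 1,
     (vel U $ i) *\<^sub>R mag U - (mag U $ i) *\<^sub>R vel U,
     vel U $ i * (ener U + ptot \<gamma> U) - mag U $ i * (vel U \<bullet> mag U))"

text \<open>Normals are always taken in \<open>\<real>\<^sup>3\<close>; for \<open>d = 2\<close> their third component is \<open>0\<close>, so the
  sum below has only the terms \<open>i = 1, 2\<close>.\<close>

definition flux_n :: "real \<Rightarrow> real^3 \<Rightarrow> state \<Rightarrow> state" where
  "flux_n \<gamma> n U = (\<Sum>i\<in>UNIV. (n $ i) *\<^sub>R flux \<gamma> i U)"

definition source :: "state \<Rightarrow> state" where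
  "source U = (0, mag U, vel U, vel U \<bullet> mag U)"

definition mag_n :: "real^3 \<Rightarrow> state \<Rightarrow> real" where
  "mag_n n U = mag U \<bullet> n"

definition C2_real :: "(real \<Rightarrow> real) \<Rightarrow> bool" where
  "C2_real f \<longleftrightarrow> (\<forall>x. f differentiable at x) \<and> (\<forall>x. deriv f differentiable at x)
     \<and> continuous_on UNIV (deriv (deriv f))"

definition entropy_generator :: "real \<Rightarrow> (real \<Rightarrow> real) \<Rightarrow> bool" where
  "entropy_generator \<gamma> f \<longleftrightarrow> C2_real f \<and>
     (\<forall>s. deriv f s > 0 \<and> deriv f s - \<gamma> * deriv (deriv f) s > 0)"

definition spec_entropy :: "real \<Rightarrow> state \<Rightarrow> real" where
  "spec_entropy \<gamma> U = ln (press \<gamma> U) - \<gamma> * ln (dens U)"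

definition eta :: "real \<Rightarrow> (real \<Rightarrow> real) \<Rightarrow> state \<Rightarrow> real" where
  "eta \<gamma> f U = - dens U * f (spec_entropy \<gamma> U)"

definition entropy_flux :: "real \<Rightarrow> (real \<Rightarrow> real) \<Rightarrow> real^3 \<Rightarrow> state \<Rightarrow> real" where
  "entropy_flux \<gamma> f n U = eta \<gamma> f U * (vel U \<bullet> n)"

definition entropy_vars :: "real \<Rightarrow> (real \<Rightarrow> real) \<Rightarrow> state \<Rightarrow> state" where
  "entropy_vars \<gamma> f U = (THE D. GDERIV (eta \<gamma> f) U :> D)"

definition rel_entropy :: "real \<Rightarrow> (real \<Rightarrow> real) \<Rightarrow> state \<Rightarrow> state \<Rightarrow> real" where
  "rel_entropy \<gamma> f U W = eta \<gamma> f U - eta \<gamma> f W - entropy_vars \<gamma> f W \<bullet> (U - W)"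

definition entropy_potential :: "real \<Rightarrow> (real \<Rightarrow> real) \<Rightarrow> real^3 \<Rightarrow> state \<Rightarrow> real" where
  "entropy_potential \<gamma> f n U = entropy_vars \<gamma> f U \<bullet> flux_n \<gamma> n U - entropy_flux \<gamma> f n U"

definition source_potential :: "real \<Rightarrow> (real \<Rightarrow> real) \<Rightarrow> state \<Rightarrow> real" where
  "source_potential \<gamma> f U = entropy_vars \<gamma> f U \<bullet> source U"


section \<open>Splitting speeds and interface fluxes\<close>

definition Cs2 :: "real \<Rightarrow> state \<Rightarrow> real" where
  "Cs2 \<gamma> U = (\<gamma> - 1) * press \<gamma> U / (2 * dens U)"

definition split_speed :: "real \<Rightarrow> state \<Rightarrow> real^3 \<Rightarrow> real" where
  "split_speed \<gamma> U \<xi> = 1 / sqrt 2 *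
     sqrt (Cs2 \<gamma> U + (norm (mag U))\<^sup>2 / dens U +
       sqrt ((Cs2 \<gamma> U + (norm (mag U))\<^sup>2 / dens U)\<^sup>2 - 4 * (Cs2 \<gamma> U * (\<xi> \<bullet> mag U)\<^sup>2 / dens U)))"

definition roe_vel :: "state \<Rightarrow> state \<Rightarrow> real^3" where
  "roe_vel U V = (1 / (sqrt (dens U) + sqrt (dens V))) *\<^sub>R
     (sqrt (dens U) *\<^sub>R vel U + sqrt (dens V) *\<^sub>R vel V)"

definition mag_jump :: "state \<Rightarrow> state \<Rightarrow> real" where
  "mag_jump U V = norm (mag U - mag V) / (sqrt (dens U) + sqrt (dens V))"

definition alpha_r :: "real \<Rightarrow> state \<Rightarrow> state \<Rightarrow> real^3 \<Rightarrow> real" where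
  "alpha_r \<gamma> U V \<xi> = max (vel U \<bullet> \<xi>) (roe_vel U V \<bullet> \<xi>) + split_speed \<gamma> U \<xi> + mag_jump U V"

definition alpha_l :: "real \<Rightarrow> state \<Rightarrow> state \<Rightarrow> real^3 \<Rightarrow> real" where
  "alpha_l \<gamma> U V \<xi> = min (vel U \<bullet> \<xi>) (roe_vel U V \<bullet> \<xi>) - split_speed \<gamma> U \<xi> - mag_jump U V"

text \<open>In the following, \<open>Um\<close> and \<open>Up\<close> are the traces on the minus and plus side and \<open>n\<close> points from
  minus to plus.\<close>

definition delta_B :: "state \<Rightarrow> state \<Rightarrow> real^3 \<Rightarrow> real" where
  "delta_B Um Up n = mag_n n Up - mag_n n Um"

definition fast_bound :: "real \<Rightarrow> state \<Rightarrow> state \<Rightarrow> real" where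
  "fast_bound \<gamma> Um Up =
     max (sqrt ((\<gamma> * press \<gamma> Um + (norm (mag Um))\<^sup>2) / dens Um))
         (sqrt ((\<gamma> * press \<gamma> Up + (norm (mag Up))\<^sup>2) / dens Up))"

definition am0 :: "real \<Rightarrow> state \<Rightarrow> state \<Rightarrow> real^3 \<Rightarrow> real" where
  "am0 \<gamma> Um Up n = min 0 (alpha_l \<gamma> Um Up n) - \<bar>delta_B Um Up n\<bar> / sqrt (dens Um)
     - fast_bound \<gamma> Um Up"

definition ap0 :: "real \<Rightarrow> state \<Rightarrow> state \<Rightarrow> real^3 \<Rightarrow> real" where
  "ap0 \<gamma> Um Up n = max 0 (alpha_r \<gamma> Up Um n) + \<bar>delta_B Um Up n\<bar> / sqrt (dens Up)
     + fast_bound \<gamma> Um Up"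

definition hll_flux :: "real \<Rightarrow> real \<Rightarrow> real \<Rightarrow> state \<Rightarrow> state \<Rightarrow> real^3 \<Rightarrow> state" where
  "hll_flux \<gamma> am ap Um Up n = (1 / (ap - am)) *\<^sub>R
     (ap *\<^sub>R flux_n \<gamma> n Um - am *\<^sub>R flux_n \<gamma> n Up + (ap * am) *\<^sub>R (Up - Um))"

definition hll_entropy_flux ::
  "real \<Rightarrow> (real \<Rightarrow> real) \<Rightarrow> real \<Rightarrow> real \<Rightarrow> state \<Rightarrow> state \<Rightarrow> real^3 \<Rightarrow> real" where
  "hll_entropy_flux \<gamma> f am ap Um Up n =
     (ap * entropy_flux \<gamma> f n Um - am * entropy_flux \<gamma> f n Up
        + ap * am * (eta \<gamma> f Up - eta \<gamma> f Um)) / (ap - am)"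


section \<open>Polynomials, polytopal cells and faces\<close>

definition poly_le :: "nat \<Rightarrow> (real^'d \<Rightarrow> real) set" where
  "poly_le k = {p. \<exists>c. \<forall>x. p x =
     (\<Sum>\<alpha>\<in>{\<alpha> :: 'd \<Rightarrow> nat. (\<Sum>i\<in>UNIV. \<alpha> i) \<le> k}. c \<alpha> * (\<Prod>i\<in>UNIV. (x $ i) ^ \<alpha> i))}"

text \<open>Cells need not be convex. The library's \<^const>\<open>polytope\<close> is a convex polytope; a polytopal set
  of dimension \<open>m\<close> is a finite union of \<open>m\<close>-dimensional convex polytopes. For
  \<open>m = DIM('a)\<close> this forces a nonempty interior.\<close>

definition polytopal :: "int \<Rightarrow> 'a::euclidean_space set \<Rightarrow> bool" where
  "polytopal m A \<longleftrightarrow>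
     (\<exists>P. finite P \<and> P \<noteq> {} \<and> (\<forall>p\<in>P. polytope p \<and> aff_dim p = m) \<and> A = \<Union>P)"

text \<open>The first two conjuncts say that \<open>e\<close> is planar with unit normal \<open>n\<close>.\<close>

definition is_outward_normal ::
  "'a::euclidean_space set \<Rightarrow> 'a set \<Rightarrow> 'a \<Rightarrow> bool" where
  "is_outward_normal K e n \<longleftrightarrow> norm n = 1 \<and> (\<exists>b. e \<subseteq> {x. n \<bullet> x = b}) \<and>
     (\<forall>x\<in>rel_interior e. \<exists>\<epsilon>>0. \<forall>t. 0 < t \<and> t < \<epsilon> \<longrightarrow>
        x - t *\<^sub>R n \<in> interior K \<and> x + t *\<^sub>R n \<notin> K)"

definition outward_normal :: "'a::euclidean_space set \<Rightarrow> 'a set \<Rightarrow> 'a" where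
  "outward_normal K e = (THE n. is_outward_normal K e n)"

definition face_family :: "'a::euclidean_space set \<Rightarrow> 'a set set \<Rightarrow> bool" where
  "face_family K F \<longleftrightarrow> finite F \<and> \<Union>F = frontier K \<and>
     (\<forall>e\<in>F. polytopal (int DIM('a) - 1) e \<and> (\<exists>n. is_outward_normal K e n))"

text \<open>The last clause says both that the faces of one cell do not overlap and that the mesh is
  conforming: faces of different cells that overlap coincide.\<close>

definition conforming_mesh ::
  "'a::euclidean_space set set \<Rightarrow> ('a set \<Rightarrow> 'a set set) \<Rightarrow> bool" where
  "conforming_mesh T faces \<longleftrightarrow> finite T \<and>
     (\<forall>K\<in>T. polytopal (int DIM('a)) K \<and> face_family K (faces K)) \<and>
     (\<forall>K\<in>T. \<forall>L\<in>T. K \<noteq> L \<longrightarrow> interior K \<inter> interior L = {}) \<and>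
     (\<forall>K\<in>T. \<forall>L\<in>T. \<forall>e\<in>faces K. \<forall>e'\<in>faces L.
        e \<noteq> e' \<longrightarrow> rel_interior e \<inter> rel_interior e' = {})"

text \<open>The \<open>(d-1)\<close>-dimensional Lebesgue measure of the hyperplane \<open>{x. n \<bullet> x = b}\<close>, \<open>norm n = 1\<close>: the
  image of \<^const>\<open>lborel\<close> on the adjacent slab of thickness \<open>1\<close> under orthogonal projection.\<close>

definition hyperplane_measure :: "'a::euclidean_space \<Rightarrow> real \<Rightarrow> 'a measure" where
  "hyperplane_measure n b =
     distr (restrict_space lborel {x. b \<le> n \<bullet> x \<and> n \<bullet> x \<le> b + 1}) borel
       (\<lambda>x. x - (n \<bullet> x - b) *\<^sub>R n)"

text \<open>A \<open>(d-1)\<close>-dimensional planar set determines \<open>(n, b)\<close> up to a common sign, which does not affect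
  the measure.\<close>

definition face_measure :: "'a::euclidean_space set \<Rightarrow> 'a measure" where
  "face_measure e =
     (case (SOME (n, b). norm n = 1 \<and> e \<subseteq> {x. n \<bullet> x = b}) of (n, b) \<Rightarrow> hyperplane_measure n b)"

definition face_area :: "'a::euclidean_space set \<Rightarrow> real" where
  "face_area e = measure (face_measure e) e"

definition face_average :: "'a::euclidean_space set \<Rightarrow> ('a \<Rightarrow> real) \<Rightarrow> real" where
  "face_average e p = (1 / face_area e) * (LINT x:e|face_measure e. p x)"

definition cell_volume :: "'a::euclidean_space set \<Rightarrow> real" where
  "cell_volume K = measure lborel K"

definition cell_average ::
  "'a::euclidean_space set \<Rightarrow> ('a \<Rightarrow> 'b::{banach, second_countable_topology}) \<Rightarrow> 'b" where
  "cell_average K p = (1 / cell_volume K) *\<^sub>R (LINT x:K|lborel. p x)"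


section \<open>The discrete data\<close>

text \<open>Faces are identified with point sets, so that two cells share a face \<open>e\<close> iff \<open>e\<close> belongs to the
  face sets of both; data attached to \<open>e\<close> alone are then common to both cells. A boundary
  quadrature index is a pair \<open>\<nu> = (e, q)\<close>. The record components are: \<open>\<gamma>\<close>; \<open>M\<close> and \<open>f\<^sub>1, \<dots>, f\<^sub>M\<close>;
  \<open>k\<close>; the labelling of the coordinates of \<open>\<real>\<^sup>d\<close> by coordinates of \<open>\<real>\<^sup>3\<close>; the mesh and the
  faces of its cells; \<open>Q\<^sub>e\<close>, \<open>x\<^bsub>e,q\<^esub>\<close> and \<open>\<varpi>\<^bsub>e,q\<^esub>\<close>; the number, the points and the weights of the
  remaining nodes of the cell quadrature, and its weights \<open>\<omega>\<^bsub>K,\<nu>\<^esub>\<close> at the face nodes; the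
  polynomials \<open>U\<^sub>K\<close>; the exterior boundary traces; the wave speeds \<open>a\<^sup>-\<close> and \<open>a\<^sup>+\<close> seen from \<open>K\<close>,
  that is, for the normal pointing out of \<open>K\<close>; and \<open>\<sigma>\<close>.\<close>

record 'd mhd_data =
  gam :: real
  num_ent :: nat
  ent :: "nat \<Rightarrow> real \<Rightarrow> real"
  pdeg :: nat
  coord :: "'d \<Rightarrow> 3"
  cells :: "(real^'d) set set"
  faces :: "(real^'d) set \<Rightarrow> (real^'d) set set"
  num_fnodes :: "(real^'d) set \<Rightarrow> nat"
  fnode :: "(real^'d) set \<times> nat \<Rightarrow> real^'d"
  fweight :: "(real^'d) set \<times> nat \<Rightarrow> real"
  num_inodes :: "(real^'d) set \<Rightarrow> nat"
  inode :: "(real^'d) set \<Rightarrow> nat \<Rightarrow> real^'d"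
  iweight :: "(real^'d) set \<Rightarrow> nat \<Rightarrow> real"
  bweight :: "(real^'d) set \<Rightarrow> (real^'d) set \<times> nat \<Rightarrow> real"
  sol :: "(real^'d) set \<Rightarrow> real^'d \<Rightarrow> state"
  bdry_trace :: "(real^'d) set \<times> nat \<Rightarrow> state"
  amin :: "(real^'d) set \<Rightarrow> (real^'d) set \<times> nat \<Rightarrow> real"
  aplus :: "(real^'d) set \<Rightarrow> (real^'d) set \<times> nat \<Rightarrow> real"
  sig :: real

text \<open>Identification of \<open>\<real>\<^sup>d\<close> with the first \<open>d\<close> coordinates of \<open>\<real>\<^sup>3\<close>.\<close>

definition coordinate_labels :: "('d::finite \<Rightarrow> 3) \<Rightarrow> bool" where
  "coordinate_labels \<iota> \<longleftrightarrow> inj \<iota> \<and> range \<iota> = (if CARD('d) = 2 then {1, 2} else UNIV)"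

definition embed3 :: "('d::finite \<Rightarrow> 3) \<Rightarrow> real^'d \<Rightarrow> real^3" where
  "embed3 \<iota> x = (\<Sum>i\<in>UNIV. (x $ i) *\<^sub>R axis (\<iota> i) 1)"

definition bidx :: "'d::finite mhd_data \<Rightarrow> (real^'d) set \<Rightarrow> ((real^'d) set \<times> nat) set" where
  "bidx D K = Sigma (faces D K) (\<lambda>e. {1..num_fnodes D e})"

definition iidx :: "'d::finite mhd_data \<Rightarrow> (real^'d) set \<Rightarrow> nat set" where
  "iidx D K = {1..num_inodes D K}"

definition face_quadratures :: "'d::finite mhd_data \<Rightarrow> bool" where
  "face_quadratures D \<longleftrightarrow> (\<forall>e\<in>(\<Union>K\<in>cells D. faces D K).
     (\<forall>q\<in>{1..num_fnodes D e}. fnode D (e, q) \<in> e \<and> fweight D (e, q) > 0) \<and>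
     (\<Sum>q\<in>{1..num_fnodes D e}. fweight D (e, q)) = 1 \<and>
     (\<forall>p\<in>poly_le (pdeg D).
        face_average e p = (\<Sum>q\<in>{1..num_fnodes D e}. fweight D (e, q) * p (fnode D (e, q)))))"

definition cell_quadratures :: "'d::finite mhd_data \<Rightarrow> bool" where
  "cell_quadratures D \<longleftrightarrow> (\<forall>K\<in>cells D.
     (\<forall>\<alpha>\<in>iidx D K. inode D K \<alpha> \<in> K \<and> iweight D K \<alpha> > 0) \<and>
     (\<forall>\<nu>\<in>bidx D K. bweight D K \<nu> > 0) \<and>
     (\<Sum>\<alpha>\<in>iidx D K. iweight D K \<alpha>) + (\<Sum>\<nu>\<in>bidx D K. bweight D K \<nu>) = 1 \<and>
     (\<forall>p\<in>poly_le (pdeg D). cell_average K p =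
        (\<Sum>\<alpha>\<in>iidx D K. iweight D K \<alpha> * p (inode D K \<alpha>)) +
        (\<Sum>\<nu>\<in>bidx D K. bweight D K \<nu> * p (fnode D \<nu>))))"

definition divergence_B :: "('d::finite \<Rightarrow> 3) \<Rightarrow> (real^'d \<Rightarrow> state) \<Rightarrow> real^'d \<Rightarrow> real" where
  "divergence_B \<iota> u x = (\<Sum>i\<in>UNIV. deriv (\<lambda>t. mag (u (x + t *\<^sub>R axis i 1)) $ \<iota> i) 0)"

definition ldf_polynomials :: "'d::finite mhd_data \<Rightarrow> bool" where
  "ldf_polynomials D \<longleftrightarrow> (\<forall>K\<in>cells D.
     (\<forall>b\<in>Basis. (\<lambda>x. sol D K x \<bullet> b) \<in> poly_le (pdeg D)) \<and>
     (\<forall>x\<in>K. divergence_B (coord D) (sol D K) x = 0))"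

definition is_neighbor ::
  "'d::finite mhd_data \<Rightarrow> (real^'d) set \<Rightarrow> (real^'d) set \<Rightarrow> (real^'d) set \<Rightarrow> bool" where
  "is_neighbor D K e L \<longleftrightarrow> L \<in> cells D \<and> L \<noteq> K \<and> e \<in> faces D L"

definition int_state :: "'d::finite mhd_data \<Rightarrow> (real^'d) set \<Rightarrow> nat \<Rightarrow> state" where
  "int_state D K \<alpha> = sol D K (inode D K \<alpha>)"

definition face_trace :: "'d::finite mhd_data \<Rightarrow> (real^'d) set \<Rightarrow> (real^'d) set \<times> nat \<Rightarrow> state" where
  "face_trace D K \<nu> = sol D K (fnode D \<nu>)"

definition ext_trace :: "'d::finite mhd_data \<Rightarrow> (real^'d) set \<Rightarrow> (real^'d) set \<times> nat \<Rightarrow> state" where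
  "ext_trace D K \<nu> = (if \<exists>L. is_neighbor D K (fst \<nu>) L
     then sol D (THE L. is_neighbor D K (fst \<nu>) L) (fnode D \<nu>) else bdry_trace D \<nu>)"

definition normal3 :: "'d::finite mhd_data \<Rightarrow> (real^'d) set \<Rightarrow> (real^'d) set \<times> nat \<Rightarrow> real^3" where
  "normal3 D K \<nu> = embed3 (coord D) (outward_normal K (fst \<nu>))"

definition states_admissible :: "'d::finite mhd_data \<Rightarrow> bool" where
  "states_admissible D \<longleftrightarrow> (\<forall>K\<in>cells D.
     (\<forall>\<alpha>\<in>iidx D K. int_state D K \<alpha> \<in> admissible) \<and>
     (\<forall>\<nu>\<in>bidx D K. face_trace D K \<nu> \<in> admissible \<and> ext_trace D K \<nu> \<in> admissible))"

text \<open>The second clause: both adjacent cells use one pair of speeds, up to reversal of the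
  orientation.\<close>

definition wave_speeds :: "'d::finite mhd_data \<Rightarrow> bool" where
  "wave_speeds D \<longleftrightarrow>
     (\<forall>K\<in>cells D. \<forall>\<nu>\<in>bidx D K. amin D K \<nu> < 0 \<and> 0 < aplus D K \<nu>) \<and>
     (\<forall>K\<in>cells D. \<forall>L\<in>cells D. \<forall>\<nu>\<in>bidx D K \<inter> bidx D L.
        K \<noteq> L \<longrightarrow> amin D L \<nu> = - aplus D K \<nu> \<and> aplus D L \<nu> = - amin D K \<nu>)"

definition speed_bounds :: "'d::finite mhd_data \<Rightarrow> bool" where
  "speed_bounds D \<longleftrightarrow> (\<forall>K\<in>cells D. \<forall>\<nu>\<in>bidx D K.
     amin D K \<nu> \<le> am0 (gam D) (face_trace D K \<nu>) (ext_trace D K \<nu>) (normal3 D K \<nu>) \<and>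
     aplus D K \<nu> \<ge> ap0 (gam D) (face_trace D K \<nu>) (ext_trace D K \<nu>) (normal3 D K \<nu>))"


section \<open>Scheme, entropy budget and time-step bound\<close>

definition cK :: "'d::finite mhd_data \<Rightarrow> (real^'d) set \<times> nat \<Rightarrow> real" where
  "cK D \<nu> = face_area (fst \<nu>) * fweight D \<nu>"

definition Fhat :: "'d::finite mhd_data \<Rightarrow> (real^'d) set \<Rightarrow> (real^'d) set \<times> nat \<Rightarrow> state" where
  "Fhat D K \<nu> = hll_flux (gam D) (amin D K \<nu>) (aplus D K \<nu>)
     (face_trace D K \<nu>) (ext_trace D K \<nu>) (normal3 D K \<nu>)"

definition qhat :: "'d::finite mhd_data \<Rightarrow> (real^'d) set \<Rightarrow> (real^'d) set \<times> nat \<Rightarrow> nat \<Rightarrow> real" where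
  "qhat D K \<nu> r = hll_entropy_flux (gam D) (ent D r) (amin D K \<nu>) (aplus D K \<nu>)
     (face_trace D K \<nu>) (ext_trace D K \<nu>) (normal3 D K \<nu>)"

definition GK :: "'d::finite mhd_data \<Rightarrow> (real^'d) set \<Rightarrow> (real^'d) set \<times> nat \<Rightarrow> state" where
  "GK D K \<nu> = Fhat D K \<nu> -
     (amin D K \<nu> / (aplus D K \<nu> - amin D K \<nu>) *
        delta_B (face_trace D K \<nu>) (ext_trace D K \<nu>) (normal3 D K \<nu>)) *\<^sub>R source (face_trace D K \<nu>)"

definition forward_state :: "'d::finite mhd_data \<Rightarrow> real \<Rightarrow> (real^'d) set \<Rightarrow> state" where
  "forward_state D \<tau> K = cell_average K (sol D K) -
     (\<tau> / cell_volume K) *\<^sub>R (\<Sum>\<nu>\<in>bidx D K. cK D \<nu> *\<^sub>R GK D K \<nu>)"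

definition entropy_budget :: "'d::finite mhd_data \<Rightarrow> real \<Rightarrow> (real^'d) set \<Rightarrow> nat \<Rightarrow> real" where
  "entropy_budget D \<tau> K r =
     (\<Sum>\<alpha>\<in>iidx D K. iweight D K \<alpha> * eta (gam D) (ent D r) (int_state D K \<alpha>)) +
     (\<Sum>\<nu>\<in>bidx D K. bweight D K \<nu> * eta (gam D) (ent D r) (face_trace D K \<nu>)) -
     \<tau> / cell_volume K * (\<Sum>\<nu>\<in>bidx D K. cK D \<nu> * qhat D K \<nu> r)"

definition perimeter :: "'d::finite mhd_data \<Rightarrow> (real^'d) set \<Rightarrow> real" where
  "perimeter D K = (\<Sum>\<nu>\<in>bidx D K. cK D \<nu>)"

definition alpha_PP :: "'d::finite mhd_data \<Rightarrow> (real^'d) set \<Rightarrow> (real^'d) set \<times> nat \<Rightarrow> real" where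
  "alpha_PP D K \<nu> =
     max (vel (face_trace D K \<nu>) \<bullet> normal3 D K \<nu>)
         (1 / perimeter D K * (\<Sum>\<mu>\<in>bidx D K. cK D \<mu> *
            ((normal3 D K \<nu> - normal3 D K \<mu>) \<bullet> roe_vel (face_trace D K \<nu>) (face_trace D K \<mu>))))
     + split_speed (gam D) (face_trace D K \<nu>) (normal3 D K \<nu>)
     + 2 / perimeter D K * (\<Sum>\<mu>\<in>bidx D K. cK D \<mu> * mag_jump (face_trace D K \<nu>) (face_trace D K \<mu>))"

definition tau0 :: "'d::finite mhd_data \<Rightarrow> (real^'d) set \<Rightarrow> real" where
  "tau0 D K = sig D * cell_volume K *
     (MIN \<nu>\<in>bidx D K. bweight D K \<nu> / (cK D \<nu> * (alpha_PP D K \<nu> - amin D K \<nu>)))"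

definition path_states :: "'d::finite mhd_data \<Rightarrow> (real^'d) set \<Rightarrow> state set" where
  "path_states D K = (\<lambda>\<theta>. forward_state D \<theta> K) ` {0..tau0 D K}"

definition P_rel ::
  "'d::finite mhd_data \<Rightarrow> (real^'d) set \<Rightarrow> (real^'d) set \<times> nat \<Rightarrow> nat \<Rightarrow> state \<Rightarrow> real" where
  "P_rel D K \<nu> r W =
     entropy_potential (gam D) (ent D r) (normal3 D K \<nu>) W
     - entropy_vars (gam D) (ent D r) W \<bullet> GK D K \<nu> + qhat D K \<nu> r
     + source_potential (gam D) (ent D r) W *
         (mag_n (normal3 D K \<nu>) W - mag_n (normal3 D K \<nu>) (face_trace D K \<nu>))"

definition d_rel :: "'d::finite mhd_data \<Rightarrow> (real^'d) set \<Rightarrow> (real^'d) set \<times> nat \<Rightarrow> nat \<Rightarrow> real" where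
  "d_rel D K \<nu> r = entropy_vars (gam D) (ent D r) (face_trace D K \<nu>) \<bullet> GK D K \<nu> - qhat D K \<nu> r
     - entropy_potential (gam D) (ent D r) (normal3 D K \<nu>) (face_trace D K \<nu>)"

text \<open>The suprema are taken in \<^typ>\<open>ennreal\<close>: they may be infinite a priori, the empty supremum
  is \<open>0\<close>, and a positive number divided by \<open>0\<close> is \<open>\<infinity>\<close>. Over the finite index sets of
  \<open>c_rel\<close> and \<open>tau_rel\<close>, \<open>SUP\<close> and \<open>INF\<close> are maximum and minimum.\<close>

definition c_rel_r :: "'d::finite mhd_data \<Rightarrow> (real^'d) set \<Rightarrow> (real^'d) set \<times> nat \<Rightarrow> nat \<Rightarrow> ennreal" where
  "c_rel_r D K \<nu> r = (SUP W\<in>{W \<in> path_states D K. W \<noteq> face_trace D K \<nu>}.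
     ennreal (max (P_rel D K \<nu> r W) 0 / rel_entropy (gam D) (ent D r) (face_trace D K \<nu>) W))"

definition c_rel :: "'d::finite mhd_data \<Rightarrow> (real^'d) set \<Rightarrow> (real^'d) set \<times> nat \<Rightarrow> ennreal" where
  "c_rel D K \<nu> = (SUP r\<in>{1..num_ent D}. c_rel_r D K \<nu> r)"

definition tau_rel :: "'d::finite mhd_data \<Rightarrow> ennreal" where
  "tau_rel D = (INF K\<in>cells D. min (ennreal (tau0 D K))
     (INF \<nu>\<in>bidx D K. ennreal (cell_volume K * bweight D K \<nu>) / (ennreal (cK D \<nu>) * c_rel D K \<nu>)))"

end

theory Submission
  imports Defs
begin

text \<open>Let \<open>W\<close> be the updated cell average. Expanding \<open>\<eta>(U) = \<eta>(W) + V(W) \<bullet> (U - W) + \<H>(U | W)\<close> at every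
  quadrature node turns the entropy budget into \<open>\<eta>(W)\<close> plus nonnegative relative entropies plus the sum
  over the face nodes of \<open>\<omega> \<H>(U\<^sub>\<nu> | W) - \<lambda> c P\<^sub>\<nu>(W)\<close>, each of which is nonnegative by the choice of the
  time step. The terms \<open>\<psi>\<close> and \<open>\<phi>\<close> in \<open>P\<^sub>\<nu>\<close> cancel in the sum because the weighted normals of a cell sum
  to zero and the normal magnetic fluxes are balanced; both facts are instances of the divergence
  theorem on the cell, combined with the exactness of the face quadrature. Strict convexity of \<open>\<eta>\<close>
  makes the quotients in the supremum meaningful. Admissibility of \<open>W\<close> is proved by geometric
  quasilinearization: the Godunov-Powell source term in \<open>G\<close> cancels the jump of the normal magnetic
  field in the functional \<open>v \<bullet> B\<close>, and the remaining cubic terms are absorbed by the wave speeds.\<close>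

section \<open>Hyperplane measure and oblique projections\<close>

text \<open>The step bound must not refer to the update it is meant to control, so
  \<open>c_rel\<close> takes its supremum over all of \<open>path_states\<close>; the bound by
  \<open>tau0\<close> makes every update both admissible and a member of that set. In the geometric
  part the obstacle is that a cell is only a finite union of polytopes and that
  \<open>face_measure\<close> is the projection of a slab of unit thickness. The divergence theorem
  is therefore obtained for one fixed direction \<open>v\<close> at a time, along lines parallel to
  \<open>v\<close>, and the factor \<open>n \<bullet> v\<close> arises as the signed thickness of
  the slab that a face sweeps out when it is moved by \<open>v\<close>. In the algebraic part the
  obstacle is that the velocity \<open>v\<close> and the field \<open>B\<close> of the quasilinear
  functionals are arbitrary, so no wave speed can dominate \<open>v \<bullet> n\<close>. At an
  interface this factor only meets differences of magnetic energies, and in a cell it can be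
  rearranged to do so; weighting velocities by square roots of densities makes the result comparable
  with the relative energies.\<close>

lemma nn_integral_lborel_translate:
  fixes f :: "'a::euclidean_space \<Rightarrow> ennreal"
  assumes [measurable]: "f \<in> borel_measurable borel"
  shows "(\<integral>\<^sup>+x. f (x + c) \<partial>lborel) = (\<integral>\<^sup>+x. f x \<partial>lborel)"
proof -
  have "(\<integral>\<^sup>+x. f x \<partial>lborel) = (\<integral>\<^sup>+x. f x \<partial>(distr lborel borel ((+) c)))"
    by (simp add: lborel_distr_plus)
  also have "\<dots> = (\<integral>\<^sup>+x. f (c + x) \<partial>lborel)"
    by (subst nn_integral_distr) auto
  finally show ?thesis by (simp add: add.commute)
qed

lemma integral_lborel_translate:
  fixes f :: "'a::euclidean_space \<Rightarrow> real"
  assumes [measurable]: "f \<in> borel_measurable borel"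
  shows "(\<integral>x. f (x + c) \<partial>lborel) = (\<integral>x. f x \<partial>lborel)"
proof -
  have "(\<integral>x. f x \<partial>lborel) = (\<integral>x. f x \<partial>(distr lborel borel ((+) c)))"
    by (simp add: lborel_distr_plus)
  also have "\<dots> = (\<integral>x. f (c + x) \<partial>lborel)"
    by (subst integral_distr) auto
  finally show ?thesis by (simp add: add.commute)
qed

lemma nn_integral_lborel_swap:
  fixes f :: "'a::euclidean_space \<Rightarrow> real \<Rightarrow> ennreal"
  assumes "(\<lambda>(x, t). f x t) \<in> borel_measurable (borel \<Otimes>\<^sub>M borel)"
  shows "(\<integral>\<^sup>+x. \<integral>\<^sup>+t. f x t \<partial>lborel \<partial>lborel) = (\<integral>\<^sup>+t. \<integral>\<^sup>+x. f x t \<partial>lborel \<partial>lborel)"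
  by (rule lborel_pair.Fubini'[symmetric]) (use assms in \<open>simp cong: measurable_cong_sets\<close>)

text \<open>The shear \<open>x \<mapsto> x + r(x) u\<close> is, on the product with an auxiliary real line, the commutator of
  two shears whose invariance is that of translations.\<close>

lemma nn_integral_shear:
  fixes f :: "'a::euclidean_space \<Rightarrow> ennreal"
  assumes [measurable]: "f \<in> borel_measurable borel" and u: "n \<bullet> u = 0"
  shows "(\<integral>\<^sup>+x. f (x + (n \<bullet> x - b) *\<^sub>R u) \<partial>lborel) = (\<integral>\<^sup>+x. f x \<partial>lborel)"
proof -
  define r where "r x = n \<bullet> x - b" for x :: 'a
  have [measurable]: "r \<in> borel_measurable borel" unfolding r_def by measurable
  have r: "r (x + t *\<^sub>R u) = r x" for x t using u by (simp add: r_def inner_add_right)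
  \<comment> \<open>\<open>k\<close> has integral one and so introduces the variable
    \<open>t\<close> for free. Shifting \<open>t\<close> by \<open>r x\<close>, then
    \<open>x\<close> by \<open>t u\<close>, then both back, adds \<open>r x u\<close> to
    \<open>x\<close>; the shifts of \<open>x\<close> do not disturb \<open>r\<close>, which is
    constant along \<open>u\<close>.\<close>
  define k :: "real \<Rightarrow> ennreal" where "k = indicator {0..1}"
  have [measurable]: "k \<in> borel_measurable borel" unfolding k_def by measurable
  have k1: "(\<integral>\<^sup>+t. k t \<partial>lborel) = 1" unfolding k_def by simp
  have "(\<integral>\<^sup>+x. f x \<partial>lborel) = (\<integral>\<^sup>+x. \<integral>\<^sup>+t. k t * f x \<partial>lborel \<partial>lborel)"
    by (simp add: nn_integral_multc k1)
  also have "\<dots> = (\<integral>\<^sup>+x. \<integral>\<^sup>+t. k (t - r x) * f x \<partial>lborel \<partial>lborel)"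
  proof (rule nn_integral_cong)
    fix x
    show "(\<integral>\<^sup>+t. k t * f x \<partial>lborel) = (\<integral>\<^sup>+t. k (t - r x) * f x \<partial>lborel)"
      using nn_integral_lborel_translate[of "\<lambda>t. k t * f x" "- r x"] by simp
  qed
  also have "\<dots> = (\<integral>\<^sup>+t. \<integral>\<^sup>+x. k (t - r x) * f x \<partial>lborel \<partial>lborel)"
    by (rule nn_integral_lborel_swap) measurable
  also have "\<dots> = (\<integral>\<^sup>+t. \<integral>\<^sup>+x. k (t - r x) * f (x + t *\<^sub>R u) \<partial>lborel \<partial>lborel)"
  proof (rule nn_integral_cong)
    fix t
    show "(\<integral>\<^sup>+x. k (t - r x) * f x \<partial>lborel) = (\<integral>\<^sup>+x. k (t - r x) * f (x + t *\<^sub>R u) \<partial>lborel)"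
      using nn_integral_lborel_translate[of "\<lambda>x. k (t - r x) * f x" "t *\<^sub>R u"] by (simp add: r)
  qed
  also have "\<dots> = (\<integral>\<^sup>+x. \<integral>\<^sup>+t. k (t - r x) * f (x + t *\<^sub>R u) \<partial>lborel \<partial>lborel)"
    by (rule nn_integral_lborel_swap[symmetric]) measurable
  also have "\<dots> = (\<integral>\<^sup>+x. \<integral>\<^sup>+t. k t * f (x + (t + r x) *\<^sub>R u) \<partial>lborel \<partial>lborel)"
  proof (rule nn_integral_cong)
    fix x
    show "(\<integral>\<^sup>+t. k (t - r x) * f (x + t *\<^sub>R u) \<partial>lborel) = (\<integral>\<^sup>+t. k t * f (x + (t + r x) *\<^sub>R u) \<partial>lborel)"
      using nn_integral_lborel_translate[of "\<lambda>t. k (t - r x) * f (x + t *\<^sub>R u)" "r x"] by simp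
  qed
  also have "\<dots> = (\<integral>\<^sup>+t. \<integral>\<^sup>+x. k t * f (x + (t + r x) *\<^sub>R u) \<partial>lborel \<partial>lborel)"
    by (rule nn_integral_lborel_swap) measurable
  also have "\<dots> = (\<integral>\<^sup>+t. \<integral>\<^sup>+x. k t * f (x + r x *\<^sub>R u) \<partial>lborel \<partial>lborel)"
  proof (rule nn_integral_cong)
    fix t
    show "(\<integral>\<^sup>+x. k t * f (x + (t + r x) *\<^sub>R u) \<partial>lborel) = (\<integral>\<^sup>+x. k t * f (x + r x *\<^sub>R u) \<partial>lborel)"
      using nn_integral_lborel_translate[of "\<lambda>x. k t * f (x + r x *\<^sub>R u)" "t *\<^sub>R u"]
      by (simp add: r scaleR_add_left add_ac)
  qed
  also have "\<dots> = (\<integral>\<^sup>+x. \<integral>\<^sup>+t. k t * f (x + r x *\<^sub>R u) \<partial>lborel \<partial>lborel)"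
    by (rule nn_integral_lborel_swap[symmetric]) measurable
  also have "\<dots> = (\<integral>\<^sup>+x. f (x + r x *\<^sub>R u) \<partial>lborel)"
    by (simp add: nn_integral_multc k1)
  finally show ?thesis by (simp add: r_def)
qed

text \<open>For \<open>f\<close> constant along \<open>n\<close>, a slab integral is the thickness
  times an integral over the hyperplane. Comparing two slabs in product form needs no division by a
  measure that may be 0 or infinite. The proof slides \<open>x\<close> along \<open>n\<close> until
  the roles of \<open>S\<close> and \<open>T\<close> are exchanged.\<close>

lemma nn_integral_slab:
  fixes f :: "'a::euclidean_space \<Rightarrow> ennreal"
  assumes [measurable]: "f \<in> borel_measurable borel" "S \<in> sets borel" "T \<in> sets borel"
    and n: "norm n = 1" and f: "\<And>x t. f (x + t *\<^sub>R n) = f x"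
  shows "(\<integral>\<^sup>+x. indicator S (n \<bullet> x - b) * f x \<partial>lborel) * emeasure lborel T =
         (\<integral>\<^sup>+x. indicator T (n \<bullet> x - b) * f x \<partial>lborel) * emeasure lborel S"
proof -
  define r where "r x = n \<bullet> x - b" for x :: 'a
  have [measurable]: "r \<in> borel_measurable borel" unfolding r_def by measurable
  have r: "r (x + t *\<^sub>R n) = r x + t" for x t
    using n by (simp add: r_def inner_add_right dot_square_norm)
  have f': "f (x - t *\<^sub>R n) = f x" for x t using f[of x "-t"] by simp
  have r': "r (x - t *\<^sub>R n) = r x - t" for x t using r[of x "-t"] by simp
  have "(\<integral>\<^sup>+x. indicator S (r x) * f x \<partial>lborel) * emeasure lborel T =
      (\<integral>\<^sup>+x. \<integral>\<^sup>+t. indicator S (r x) * f x * indicator T t \<partial>lborel \<partial>lborel)"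
    by (simp add: nn_integral_cmult nn_integral_multc)
  also have "\<dots> = (\<integral>\<^sup>+x. \<integral>\<^sup>+t. indicator S (r x) * f x * indicator T (t + r x) \<partial>lborel \<partial>lborel)"
  proof (rule nn_integral_cong)
    fix x
    show "(\<integral>\<^sup>+t. indicator S (r x) * f x * indicator T t \<partial>lborel) = 
      (\<integral>\<^sup>+t. indicator S (r x) * f x * indicator T (t + r x) \<partial>lborel)"
      using nn_integral_lborel_translate[of "\<lambda>t. indicator S (r x) * f x * indicator T t" "r x"] by simp
  qed
  also have "\<dots> = (\<integral>\<^sup>+t. \<integral>\<^sup>+x. indicator S (r x) * f x * indicator T (t + r x) \<partial>lborel \<partial>lborel)"
    by (rule nn_integral_lborel_swap) measurable
  also have "\<dots> = (\<integral>\<^sup>+t. \<integral>\<^sup>+x. indicator S (r x - t) * f x * indicator T (r x) \<partial>lborel \<partial>lborel)"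
  proof (rule nn_integral_cong)
    fix t
    show "(\<integral>\<^sup>+x. indicator S (r x) * f x * indicator T (t + r x) \<partial>lborel) =
      (\<integral>\<^sup>+x. indicator S (r x - t) * f x * indicator T (r x) \<partial>lborel)"
      using nn_integral_lborel_translate[of "\<lambda>x. indicator S (r x) * f x * indicator T (t + r x)" "- t *\<^sub>R n"]
      by (simp add: r' f')
  qed
  also have "\<dots> = (\<integral>\<^sup>+x. \<integral>\<^sup>+t. indicator S (r x - t) * f x * indicator T (r x) \<partial>lborel \<partial>lborel)"
    by (rule nn_integral_lborel_swap[symmetric]) measurable
  also have "\<dots> = (\<integral>\<^sup>+x. \<integral>\<^sup>+t. indicator S t * (indicator T (r x) * f x) \<partial>lborel \<partial>lborel)"
  proof (rule nn_integral_cong)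
    fix x
    show "(\<integral>\<^sup>+t. indicator S (r x - t) * f x * indicator T (r x) \<partial>lborel) = 
      (\<integral>\<^sup>+t. indicator S t * (indicator T (r x) * f x) \<partial>lborel)"
      using nn_integral_real_affine[of "\<lambda>t. indicator S t * (indicator T (r x) * f x)" "-1" "r x"] 
      by (simp add: ac_simps)
  qed
  also have "\<dots> = (\<integral>\<^sup>+x. indicator T (r x) * f x \<partial>lborel) * emeasure lborel S"
    by (simp add: nn_integral_cmult nn_integral_multc mult.commute)
  finally show ?thesis by (simp add: r_def)
qed

text \<open>The points that reach the hyperplane with velocity \<open>v\<close> at a time between 0
  and 1 form a slab of thickness \<open>\<bar>n \<bullet> v\<bar>\<close>. Projection along
  \<open>v\<close> differs from orthogonal projection by a shear, which preserves Lebesgue measure,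
  so only the thickness is felt.\<close>

lemma hyperplane_measure_oblique:
  fixes n v :: "'a::euclidean_space"
  assumes n: "norm n = 1" and h: "n \<bullet> v \<noteq> 0"
  shows "distr (restrict_space lborel {x. 0 < (b - n \<bullet> x) / (n \<bullet> v) \<and> (b - n \<bullet> x) / (n \<bullet> v) < 1}) borel
      (\<lambda>x. x + ((b - n \<bullet> x) / (n \<bullet> v)) *\<^sub>R v)
    = density (hyperplane_measure n b) (\<lambda>_. ennreal \<bar>n \<bullet> v\<bar>)" (is "distr (restrict_space _ ?S) _ ?p = _")
proof (rule measure_eqI)
  show "sets (distr (restrict_space lborel ?S) borel ?p) =
     sets (density (hyperplane_measure n b) (\<lambda>_. ennreal \<bar>n \<bullet> v\<bar>))"
    by (simp add: hyperplane_measure_def)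
next
  fix A assume "A \<in> sets (distr (restrict_space lborel ?S) borel ?p)"
  then have [measurable]: "A \<in> sets borel" by simp
  define \<pi> where "\<pi> x = x - (n \<bullet> x - b) *\<^sub>R n" for x
  have [measurable]: "\<pi> \<in> borel_measurable borel" unfolding \<pi>_def by measurable
  \<comment> \<open>\<open>n + u\<close> is \<open>v\<close> rescaled to unit normal component, so
    \<open>u\<close> is tangential and projecting along \<open>v\<close> is a shear along
    \<open>- u\<close> followed by the orthogonal projection \<open>\<pi>\<close>.\<close>
  define u where "u = v /\<^sub>R (n \<bullet> v) - n"
  have u: "n \<bullet> u = 0" using n h by (simp add: u_def inner_diff_right dot_square_norm)
  have p: "?p x = \<pi> (x + (n \<bullet> x - b) *\<^sub>R - u)" for x
  proof -
    have "v = (n \<bullet> v) *\<^sub>R (n + u)" using h by (simp add: u_def)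
    then have "((b - n \<bullet> x) / (n \<bullet> v)) *\<^sub>R v = (b - n \<bullet> x) *\<^sub>R (n + u)"
      by (metis h nonzero_divide_eq_eq scaleR_scaleR)
    moreover have "\<pi> (x + (n \<bullet> x - b) *\<^sub>R - u) = x + (n \<bullet> x - b) *\<^sub>R - u - (n \<bullet> x - b) *\<^sub>R n"
      using u by (simp add: \<pi>_def inner_diff_right)
    ultimately have "?p x = x + (b - n \<bullet> x) *\<^sub>R (n + u)" "\<pi> (x + (n \<bullet> x - b) *\<^sub>R - u) = x + (b - n \<bullet> x) *\<^sub>R (n + u)"
      by (simp_all add: algebra_simps)
    then show ?thesis by simp
  qed
  define S where "S = {t. 0 < - t / (n \<bullet> v) \<and> - t / (n \<bullet> v) < 1}"
  have [measurable]: "S \<in> sets borel" unfolding S_def by measurable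
  have S: "x \<in> ?S \<longleftrightarrow> n \<bullet> x - b \<in> S" for x
    unfolding S_def mem_Collect_eq minus_diff_eq by (rule refl)
  have "S = (if n \<bullet> v > 0 then {- (n \<bullet> v)<..<0} else {0<..<- (n \<bullet> v)})"
    using h by (auto simp: S_def field_simps split: if_splits)
  then have eS: "emeasure lborel S = ennreal \<bar>n \<bullet> v\<bar>" by (simp split: if_splits)
  have \<pi>n: "\<pi> (x + t *\<^sub>R n) = \<pi> x" for x t
    using n by (simp add: \<pi>_def algebra_simps inner_add_right dot_square_norm)
  have mp[measurable]: "?p \<in> borel_measurable borel" by measurable
  have mS[measurable]: "?S \<in> sets borel" by measurable
  have "emeasure (distr (restrict_space lborel ?S) borel ?p) A = emeasure lborel (?S \<inter> ?p -` A)"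
    by (subst emeasure_distr)
      (auto simp: space_restrict_space emeasure_restrict_space measurable_restrict_space1 intro!: arg_cong2[where f=emeasure])
  also have "\<dots> = (\<integral>\<^sup>+x. indicator S (n \<bullet> x - b) * indicator A (?p x) \<partial>lborel)"
  proof -
    have "?S \<inter> ?p -` A \<in> sets lborel"
      using measurable_sets[OF mp \<open>A \<in> sets borel\<close>] mS by auto
    from nn_integral_indicator[OF this] show ?thesis
      by (rule trans[OF sym]) (auto intro!: nn_integral_cong simp: indicator_def S[symmetric])
  qed
  also have "\<dots> = (\<integral>\<^sup>+x. (\<lambda>x. indicator S (n \<bullet> x - b) * indicator A (\<pi> x)) (x + (n \<bullet> x - b) *\<^sub>R - u) \<partial>lborel)"
    unfolding p using u by (simp add: inner_diff_right)
  also have "\<dots> = (\<integral>\<^sup>+x. indicator S (n \<bullet> x - b) * indicator A (\<pi> x) \<partial>lborel)"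
    by (rule nn_integral_shear) (use u in auto)
  also have "\<dots> = (\<integral>\<^sup>+x. indicator {0..1} (n \<bullet> x - b) * indicator A (\<pi> x) \<partial>lborel) * ennreal \<bar>n \<bullet> v\<bar>"
    using nn_integral_slab[of "\<lambda>x. indicator A (\<pi> x)" S "{0..1}" n b] n \<pi>n by (simp add: eS)
  also have "(\<integral>\<^sup>+x. indicator {0..1} (n \<bullet> x - b) * indicator A (\<pi> x) \<partial>lborel) = emeasure (hyperplane_measure n b) A"
  proof -
    let ?H = "{x. b \<le> n \<bullet> x \<and> n \<bullet> x \<le> b + 1}"
    have mH[measurable]: "?H \<in> sets borel" by measurable
    have *: "?H \<inter> \<pi> -` A \<in> sets lborel"
      using measurable_sets[of \<pi> borel borel A] by auto
    have "emeasure (hyperplane_measure n b) A = emeasure lborel (?H \<inter> \<pi> -` A)"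
      unfolding hyperplane_measure_def \<pi>_def
      by (subst emeasure_distr)
       (auto simp: space_restrict_space emeasure_restrict_space measurable_restrict_space1 intro!: arg_cong2[where f=emeasure])
    also have "\<dots> = (\<integral>\<^sup>+x. indicator {0..1} (n \<bullet> x - b) * indicator A (\<pi> x) \<partial>lborel)"
      using nn_integral_indicator[OF *]
      by (rule trans[OF sym]) (auto intro!: nn_integral_cong simp: indicator_def)
    finally show ?thesis by simp
  qed
  finally show "emeasure (distr (restrict_space lborel ?S) borel ?p) A =
     emeasure (density (hyperplane_measure n b) (\<lambda>_. ennreal \<bar>n \<bullet> v\<bar>)) A"
    by (subst emeasure_density_const) (simp_all add: hyperplane_measure_def mult.commute)
qed

section \<open>The divergence theorem on polytopal cells\<close>

text \<open>Intended for the set \<open>S\<close> of times at which a line is in a closed cell: at a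
  face with \<open>h e > 0\<close> the line leaves, otherwise it enters. Closedness dictates the two
  conventions at the crossing time itself. Writing the indicator as a sum of steps avoids sorting
  the crossings along the line.\<close>

lemma indicator_jumps:
  fixes S :: "real set" and \<sigma> h :: "'i \<Rightarrow> real"
  assumes E: "finite E" "inj_on \<sigma> E"
    and off: "\<And>s. s \<notin> \<sigma> ` E \<Longrightarrow> \<forall>\<^sub>F t in nhds s. t \<in> S \<longleftrightarrow> s \<in> S"
    and pos: "\<And>e. e \<in> E \<Longrightarrow> h e > 0 \<Longrightarrow> \<forall>\<^sub>F t in nhds (\<sigma> e). t \<in> S \<longleftrightarrow> t \<le> \<sigma> e"
    and neg: "\<And>e. e \<in> E \<Longrightarrow> \<not> h e > 0 \<Longrightarrow> h e < 0 \<and> (\<forall>\<^sub>F t in nhds (\<sigma> e). t \<in> S \<longleftrightarrow> t \<ge> \<sigma> e)"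
  shows "\<exists>C. \<forall>s. indicat_real S s =
    C - (\<Sum>e\<in>E. sgn (h e) * (if h e > 0 then of_bool (s > \<sigma> e) else of_bool (s \<ge> \<sigma> e)))"
proof -
  define H where "H e s = sgn (h e) * (if h e > 0 then of_bool (s > \<sigma> e) else of_bool (s \<ge> \<sigma> e))"
    for e and s :: real
  \<comment> \<open>The step functions compensate the jumps of the indicator, so \<open>J\<close> is locally constant.\<close>
  define J where "J s = indicat_real S s + (\<Sum>e\<in>E. H e s)" for s
  have H: "\<forall>\<^sub>F t in nhds s. H e t = H e s" if "s \<noteq> \<sigma> e" for e s
  proof (cases "s < \<sigma> e")
    case True
    have "\<forall>\<^sub>F t in nhds s. t < \<sigma> e" using True by (rule order_tendstoD(2)[OF filterlim_ident])
    then show ?thesis by eventually_elim (use True in \<open>auto simp: H_def\<close>)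
  next
    case False
    then have s: "s > \<sigma> e" using that by simp
    have "\<forall>\<^sub>F t in nhds s. t > \<sigma> e" using s by (rule order_tendstoD(1)[OF filterlim_ident])
    then show ?thesis by eventually_elim (use s in \<open>auto simp: H_def\<close>)
  qed
  have J: "\<forall>\<^sub>F t in nhds s. J t = J s" for s
  proof (cases "s \<in> \<sigma> ` E")
    case False
    have "\<forall>\<^sub>F t in nhds s. \<forall>e\<in>E. H e t = H e s"
      using E(1) False by (intro eventually_ball_finite) (auto intro!: H)
    with off[OF False] show ?thesis
      by eventually_elim (auto simp: J_def indicator_def intro!: sum.cong)
  next
    case True
    then obtain e where e: "e \<in> E" "s = \<sigma> e" by auto
    have "\<forall>\<^sub>F t in nhds s. \<forall>e'\<in>E - {e}. H e' t = H e' s"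
      using E e by (intro eventually_ball_finite ballI H) (auto simp: inj_on_def)
    moreover have "\<forall>\<^sub>F t in nhds s. indicat_real S t + H e t = indicat_real S s + H e s"
    proof (cases "h e > 0")
      case True
      have s: "s \<in> S" using eventually_nhds_x_imp_x[OF pos[OF e(1) True]] e(2) by simp
      from pos[OF e(1) True] show ?thesis unfolding e(2)[symmetric]
        by eventually_elim (use True e s in \<open>auto simp: H_def indicator_def\<close>)
    next
      case False
      note neg = conjunct1[OF neg[OF e(1) False]] conjunct2[OF neg[OF e(1) False]]
      have s: "s \<in> S" using eventually_nhds_x_imp_x[OF neg(2)] e(2) by simp
      from neg(2) show ?thesis unfolding e(2)[symmetric]
        by eventually_elim (use neg(1) e s in \<open>auto simp: H_def indicator_def\<close>)
    qed
    ultimately show ?thesis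
      by eventually_elim (simp add: J_def sum.remove[OF E(1) e(1)])
  qed
  have "J s = J 0" for s
  proof (rule connected_local_const[of UNIV s 0 J])
    show "\<forall>a\<in>UNIV. \<forall>\<^sub>F t in at a within UNIV. J a = J t"
    proof
      fix a
      show "\<forall>\<^sub>F t in at a within UNIV. J a = J t"
        using J[of a] unfolding eventually_at_filter by eventually_elim simp
    qed
  qed auto
  then show ?thesis
    by (intro exI[of _ "J 0"]) (simp add: J_def H_def algebra_simps)
qed

text \<open>The value \<open>H c\<close> is left open, so that both one-sided conventions are
  covered; it affects the integrand at a single point only. Since \<open>c\<close> is neither
  endpoint, \<open>H 0\<close> and \<open>H 1\<close> are determined.\<close>

lemma has_integral_Heaviside_derivative:
  fixes g g' :: "real \<Rightarrow> real"
  assumes g: "\<And>s. (g has_real_derivative g' s) (at s)" and c: "c \<noteq> 0" "c \<noteq> 1"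
    and H: "\<And>s. s < c \<Longrightarrow> H s = 0" "\<And>s. s > c \<Longrightarrow> H s = 1"
  shows "((\<lambda>s. H s * g' s) has_integral (H 1 * g 1 - H 0 * g 0 - of_bool (0 < c \<and> c < 1) * g c)) {0..1}"
proof -
  have F: "(g' has_integral (g b - g a)) {a..b}" if "a \<le> b" for a b
    by (rule fundamental_theorem_of_calculus[OF that])
      (auto intro: has_field_derivative_at_within g simp: has_real_derivative_iff_has_vector_derivative[symmetric])
  consider "c > 1" | "c < 0" | "0 < c" "c < 1" using c by linarith
  then show ?thesis
  proof cases
    case 1
    then show ?thesis using H(1) by (intro has_integral_is_0[THEN has_integral_eq_rhs]) auto
  next
    case 2
    show ?thesis
      by (rule has_integral_eq[OF _ F[of 0 1, THEN has_integral_eq_rhs]]) (use 2 H(2) in auto)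
  next
    case 3
    have z: "((\<lambda>s. H s * g' s) has_integral 0) {0..c}"
      by (rule has_integral_spike_finite[of "{c}" _ _ "\<lambda>_. 0"]) (use H(1) in auto)
    have "((\<lambda>s. H s * g' s) has_integral (g 1 - g c)) {c..1}"
      by (rule has_integral_spike_finite[of "{c}" _ _ g']) (use H(2) 3 F in auto)
    from has_integral_combine[OF _ _ z this] show ?thesis using 3 H by simp
  qed
qed

lemma has_integral_indicator_derivative:
  fixes S :: "real set" and \<sigma> h :: "'i \<Rightarrow> real" and g g' :: "real \<Rightarrow> real"
  assumes E: "finite E" "inj_on \<sigma> E"
    and off: "\<And>s. s \<notin> \<sigma> ` E \<Longrightarrow> \<forall>\<^sub>F t in nhds s. t \<in> S \<longleftrightarrow> s \<in> S"
    and pos: "\<And>e. e \<in> E \<Longrightarrow> h e > 0 \<Longrightarrow> \<forall>\<^sub>F t in nhds (\<sigma> e). t \<in> S \<longleftrightarrow> t \<le> \<sigma> e"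
    and neg: "\<And>e. e \<in> E \<Longrightarrow> \<not> h e > 0 \<Longrightarrow> h e < 0 \<and> (\<forall>\<^sub>F t in nhds (\<sigma> e). t \<in> S \<longleftrightarrow> t \<ge> \<sigma> e)"
    and g: "\<And>s. (g has_real_derivative g' s) (at s)"
    and \<sigma>: "\<And>e. e \<in> E \<Longrightarrow> \<sigma> e \<noteq> 0 \<and> \<sigma> e \<noteq> 1"
  shows "((\<lambda>s. indicator S s * g' s) has_integral
    (indicator S 1 * g 1 - indicator S 0 * g 0 +
      (\<Sum>e\<in>E. sgn (h e) * (of_bool (0 < \<sigma> e \<and> \<sigma> e < 1) * g (\<sigma> e))))) {0..1}"
proof -
  define H where "H e s = (if h e > 0 then of_bool (s > \<sigma> e) else of_bool (s \<ge> \<sigma> e) :: real)" for e s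
  obtain C where C: "\<And>s. indicat_real S s = C - (\<Sum>e\<in>E. sgn (h e) * H e s)"
    using indicator_jumps[OF E off pos neg] unfolding H_def by blast
  have H: "((\<lambda>s. H e s * g' s) has_integral
      (H e 1 * g 1 - H e 0 * g 0 - of_bool (0 < \<sigma> e \<and> \<sigma> e < 1) * g (\<sigma> e))) {0..1}" if "e \<in> E" for e
    by (rule has_integral_Heaviside_derivative[OF g]) (use \<sigma>[OF that] in \<open>auto simp: H_def\<close>)
  have F: "(g' has_integral (g 1 - g 0)) {0..1}"
    by (rule fundamental_theorem_of_calculus)
      (auto intro: has_field_derivative_at_within g simp: has_real_derivative_iff_has_vector_derivative[symmetric])
  have "((\<lambda>s. C * g' s - (\<Sum>e\<in>E. sgn (h e) * (H e s * g' s))) has_integral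
    (C * (g 1 - g 0) - (\<Sum>e\<in>E. sgn (h e) *
      (H e 1 * g 1 - H e 0 * g 0 - of_bool (0 < \<sigma> e \<and> \<sigma> e < 1) * g (\<sigma> e))))) {0..1}"
    by (intro has_integral_diff has_integral_mult_right has_integral_sum E F H) auto
  moreover have "(\<lambda>s. C * g' s - (\<Sum>e\<in>E. sgn (h e) * (H e s * g' s))) = (\<lambda>s. indicator S s * g' s)"
    by (simp add: C left_diff_distrib sum_distrib_right mult.assoc)
  moreover have "C * (g 1 - g 0) - (\<Sum>e\<in>E. sgn (h e) *
      (H e 1 * g 1 - H e 0 * g 0 - of_bool (0 < \<sigma> e \<and> \<sigma> e < 1) * g (\<sigma> e))) =
    indicator S 1 * g 1 - indicator S 0 * g 0 +
      (\<Sum>e\<in>E. sgn (h e) * (of_bool (0 < \<sigma> e \<and> \<sigma> e < 1) * g (\<sigma> e)))"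
  \<comment> \<open>The unknown constant \<open>C\<close> disappears because the endpoint terms
    reassemble to the step representation of the indicator at 1 and at 0.\<close>
  proof -
    have "(\<Sum>e\<in>E. sgn (h e) *
      (H e 1 * g 1 - H e 0 * g 0 - of_bool (0 < \<sigma> e \<and> \<sigma> e < 1) * g (\<sigma> e))) =
      (\<Sum>e\<in>E. sgn (h e) * H e 1) * g 1 - (\<Sum>e\<in>E. sgn (h e) * H e 0) * g 0 -
      (\<Sum>e\<in>E. sgn (h e) * (of_bool (0 < \<sigma> e \<and> \<sigma> e < 1) * g (\<sigma> e)))"
      unfolding sum_distrib_right sum_subtractf[symmetric]
      by (rule sum.cong[OF refl]) (simp only: right_diff_distrib mult.assoc)
    then show ?thesis unfolding C by (simp only: left_diff_distrib right_diff_distrib)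
  qed
  ultimately show ?thesis by simp
qed

section \<open>Local geometry of faces and generic lines\<close>

lemma polytopal_compact: "polytopal m A \<Longrightarrow> compact A"
  unfolding polytopal_def using polytope_imp_compact by (metis compact_Union)

text \<open>All pieces of the face span the same hyperplane, so their relative interiors lie in that
  of the face. A point outside the latter is therefore on a facet of some piece; this confines the
  relative boundary to finitely many sets of codimension two, which generic lines miss.\<close>

lemma polytopal_planar:
  fixes e :: "'a::euclidean_space set"
  assumes e: "polytopal (int DIM('a) - 1) e" and n: "norm n = 1" and b: "e \<subseteq> {x. n \<bullet> x = b}"
  shows "affine hull e = {x. n \<bullet> x = b}" and "rel_interior e \<noteq> {}"
    and "\<exists>\<G>. finite \<G> \<and> (\<forall>g\<in>\<G>. aff_dim g = int DIM('a) - 2) \<and> e - rel_interior e \<subseteq> \<Union>\<G>"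
proof -
  obtain P where P: "finite P" "P \<noteq> {}" "\<And>p. p \<in> P \<Longrightarrow> polytope p"
    "\<And>p. p \<in> P \<Longrightarrow> aff_dim p = int DIM('a) - 1" "e = \<Union>P"
    using e unfolding polytopal_def by blast
  have n0: "n \<noteq> 0" using n by auto
  have ne: "p \<noteq> {}" if "p \<in> P" for p
  proof
    assume "p = {}"
    then have "int DIM('a) = 0" using P(4)[OF that] by simp
    then show False by simp
  qed
  have aff: "affine hull p = {x. n \<bullet> x = b}" if "p \<in> P" for p
  proof (rule affine_dim_equal)
    show "affine hull p \<subseteq> {x. n \<bullet> x = b}"
      using that b P(5) by (intro hull_minimal affine_hyperplane) auto
  qed (use P(4)[OF that] ne[OF that] n0 in \<open>simp_all add: affine_hyperplane\<close>)
  show hull: "affine hull e = {x. n \<bullet> x = b}"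
  proof
    show "affine hull e \<subseteq> {x. n \<bullet> x = b}" using b by (intro hull_minimal affine_hyperplane)
    obtain p where "p \<in> P" using P(2) by auto
    with aff[OF this] P(5) show "{x. n \<bullet> x = b} \<subseteq> affine hull e"
      by (metis Union_upper hull_mono)
  qed
  have ri: "rel_interior p \<subseteq> rel_interior e" if "p \<in> P" for p
    using that P(5) aff[OF that] hull by (intro rel_interior_mono) auto
  obtain p where p: "p \<in> P" using P(2) by auto
  have "rel_interior p \<noteq> {}"
    using rel_interior_eq_empty[of p] ne[OF p] polytope_imp_convex[OF P(3)[OF p]] by simp
  with ri[OF p] show "rel_interior e \<noteq> {}" by auto
  define \<G> where "\<G> = (\<Union>p\<in>P. {F. F facet_of p})"
  have "finite \<G>" unfolding \<G>_def using P by (auto intro: finite_polytope_facets)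
  moreover have "\<forall>g\<in>\<G>. aff_dim g = int DIM('a) - 2"
    using P(4) by (auto simp: \<G>_def facet_of_def)
  moreover have "e - rel_interior e \<subseteq> \<Union>\<G>"
  proof
    fix x assume x: "x \<in> e - rel_interior e"
    then obtain p where p: "p \<in> P" "x \<in> p" using P(5) by auto
    then have "x \<in> rel_frontier p"
      using ri[OF p(1)] x by (auto simp: rel_frontier_def closure_subset[THEN subsetD])
    then have "x \<in> \<Union>{F. F facet_of p}"
      using rel_frontier_of_polyhedron polytope_imp_polyhedron P(3) p(1) by blast
    then show "x \<in> \<Union>\<G>" using p(1) by (auto simp: \<G>_def)
  qed
  ultimately show "\<exists>\<G>. finite \<G> \<and> (\<forall>g\<in>\<G>. aff_dim g = int DIM('a) - 2) \<and> e - rel_interior e \<subseteq> \<Union>\<G>"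
    by blast
qed

lemma AE_lborel_not_in_affine:
  fixes A :: "'a::euclidean_space set"
  assumes "affine A" "aff_dim A < int DIM('a)"
  shows "AE x in lborel. x \<notin> A"
proof -
  have "negligible A"
    using assms negligible_convex_interior[OF affine_imp_convex] low_dim_interior[of A] by auto
  moreover have "A \<in> sets lborel" using affine_closed[OF assms(1)] by auto
  ultimately have "A \<in> null_sets lborel" by (simp add: negligible_iff_null_sets null_sets_completion_iff)
  then show ?thesis by (rule AE_not_in)
qed

text \<open>The lines with direction \<open>v\<close> that meet \<open>A\<close> stay in the affine
  hull of \<open>A\<close> and one translated point \<open>a + v\<close>. This adds at most one
  dimension, so that codimension one and hence measure zero remain.\<close>

lemma AE_line_avoids:
  fixes A :: "'a::euclidean_space set"
  assumes "aff_dim A = int DIM('a) - 2"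
  shows "AE x in lborel. \<forall>s. x + s *\<^sub>R v \<notin> A"
proof (cases "A = {}")
  case False
  then obtain a where a: "a \<in> A" by auto
  let ?B = "affine hull (insert (a + v) A)"
  have "aff_dim ?B < int DIM('a)" using assms by (simp add: aff_dim_insert)
  then have "AE x in lborel. x \<notin> ?B" by (intro AE_lborel_not_in_affine affine_affine_hull)
  then show ?thesis
  proof eventually_elim
    case (elim x)
    have "x \<in> ?B" if "x + s *\<^sub>R v \<in> A" for s
    proof -
      have 1: "a \<in> ?B" "a + v \<in> ?B" "x + s *\<^sub>R v \<in> ?B" using a that by (auto intro: hull_inc)
      have "1 *\<^sub>R (x + s *\<^sub>R v) + (- s) *\<^sub>R (a + v) + s *\<^sub>R a \<in> ?B"
        by (rule mem_affine_3[OF affine_affine_hull]) (use 1 in auto)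
      then show ?thesis by (simp add: algebra_simps)
    qed
    with elim show ?case by blast
  qed
qed simp

text \<open>In a small ball around \<open>x\<close> the frontier is exactly the hyperplane of
  \<open>e\<close>. Each open half ball is connected and misses the frontier, so it lies wholly
  inside or wholly outside \<open>K\<close>; one test point on each side, supplied by the outward
  normal, decides which.\<close>

lemma frontier_locally_halfspace:
  fixes K :: "'a::euclidean_space set"
  assumes K: "closed K" and F: "frontier K = \<Union>F" "finite F" "\<And>e. e \<in> F \<Longrightarrow> closed e"
    and e: "e \<in> F" "is_outward_normal K e n" "affine hull e = {y. n \<bullet> y = b}"
    and x: "x \<in> rel_interior e" "\<And>e'. e' \<in> F \<Longrightarrow> e' \<noteq> e \<Longrightarrow> x \<notin> e'"
  shows "\<forall>\<^sub>F y in nhds x. y \<in> K \<longleftrightarrow> n \<bullet> y \<le> b"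
proof -
  have n: "norm n = 1" and nn: "n \<bullet> n = 1" using e(2) by (auto simp: is_outward_normal_def dot_square_norm)
  have xe: "x \<in> e" using x(1) rel_interior_subset by auto
  have xb: "n \<bullet> x = b" using xe e(3) hull_inc[of x e affine] by auto
  obtain d1 where d1: "d1 > 0" "ball x d1 \<inter> affine hull e \<subseteq> e"
    using x(1) by (auto simp: mem_rel_interior_ball)
  have "closed (\<Union>(F - {e}))" using F by (intro closed_Union) auto
  moreover have "x \<notin> \<Union>(F - {e})" using x(2) by auto
  ultimately obtain d2 where d2: "d2 > 0" "ball x d2 \<inter> \<Union>(F - {e}) = {}"
    unfolding closed_def open_contains_ball by (metis Compl_iff disjoint_eq_subset_Compl)
  obtain \<epsilon> where \<epsilon>: "\<epsilon> > 0" "\<And>t. 0 < t \<Longrightarrow> t < \<epsilon> \<Longrightarrow> x - t *\<^sub>R n \<in> interior K \<and> x + t *\<^sub>R n \<notin> K"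
    using e(2) x(1) unfolding is_outward_normal_def by blast
  define d where "d = min d1 d2"
  have d: "d > 0" "d \<le> d1" "d \<le> d2" using d1 d2 by (auto simp: d_def)
  define t where "t = min d \<epsilon> / 2"
  have t: "0 < t" "t < d" "t < \<epsilon>" using d \<epsilon> by (auto simp: t_def)
  have fr: "y \<in> frontier K \<longleftrightarrow> n \<bullet> y = b" if "y \<in> ball x d" for y
  proof
    assume "y \<in> frontier K"
    then obtain e' where "e' \<in> F" "y \<in> e'" using F(1) by auto
    moreover have "e' = e"
    proof (rule ccontr)
      assume "e' \<noteq> e"
      then have "y \<in> ball x d2 \<inter> \<Union>(F - {e})" using \<open>e' \<in> F\<close> \<open>y \<in> e'\<close> that d by auto
      with d2(2) show False by simp
    qed
    ultimately show "n \<bullet> y = b" using e(3) hull_inc[of y e affine] by auto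
  next
    assume "n \<bullet> y = b"
    then have "y \<in> e" using d1(2) e(3) that d by auto
    then show "y \<in> frontier K" using F(1) e(1) by auto
  qed
  have xt: "x - t *\<^sub>R n \<in> ball x d" "x + t *\<^sub>R n \<in> ball x d" "n \<bullet> (x - t *\<^sub>R n) < b" "n \<bullet> (x + t *\<^sub>R n) > b"
    using t(1,2) by (simp_all add: dist_norm inner_diff_right inner_add_right n nn xb)
  have lo: "ball x d \<inter> {y. n \<bullet> y < b} \<subseteq> K"
  proof (rule ccontr)
    assume "\<not> ?thesis"
    moreover have "x - t *\<^sub>R n \<in> ball x d \<inter> {y. n \<bullet> y < b} \<inter> K"
      using xt \<epsilon>(2)[OF t(1,3)] interior_subset by blast
    ultimately have "ball x d \<inter> {y. n \<bullet> y < b} \<inter> frontier K \<noteq> {}"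
      by (intro connected_Int_frontier convex_connected convex_Int convex_ball convex_halfspace_lt) blast+
    with fr show False by auto
  qed
  have hi: "ball x d \<inter> {y. n \<bullet> y > b} \<inter> K = {}"
  proof (rule ccontr)
    assume "\<not> ?thesis"
    moreover have "x + t *\<^sub>R n \<in> ball x d \<inter> {y. n \<bullet> y > b} - K"
      using xt \<epsilon>(2)[OF t(1,3)] by blast
    ultimately have "ball x d \<inter> {y. n \<bullet> y > b} \<inter> frontier K \<noteq> {}"
      by (intro connected_Int_frontier convex_connected convex_Int convex_ball convex_halfspace_gt) blast+
    with fr show False by auto
  qed
  have "y \<in> K \<longleftrightarrow> n \<bullet> y \<le> b" if "y \<in> ball x d" for y
    using lo hi fr[OF that] that K frontier_subset_eq[of K]
    by (cases "n \<bullet> y" b rule: linorder_cases) auto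
  then show ?thesis using d(1)
    by (auto simp: eventually_nhds_metric dist_commute intro!: exI[of _ d])
qed

lemma affine_hyperplane_normal_unique:
  fixes n m :: "'a::euclidean_space"
  assumes nm: "norm n = 1" "norm m = 1" and eq: "{x. n \<bullet> x = b} = {x. m \<bullet> x = c}"
  shows "m = n \<and> c = b \<or> m = - n \<and> c = - b"
proof -
  have nn: "n \<bullet> n = 1" "m \<bullet> m = 1" using nm by (auto simp: dot_square_norm)
  \<comment> \<open>The part \<open>w\<close> of \<open>m\<close> orthogonal to \<open>n\<close> is
    a direction of the common hyperplane, hence orthogonal to \<open>m\<close> as well, hence
    zero.\<close>
  define w where "w = m - (n \<bullet> m) *\<^sub>R n"
  have nw: "n \<bullet> w = 0" by (simp add: w_def inner_diff_right nn)
  have "b *\<^sub>R n \<in> {x. n \<bullet> x = b}" "b *\<^sub>R n + w \<in> {x. n \<bullet> x = b}" by (simp_all add: nn nw inner_add_right)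
  then have 1: "b * (m \<bullet> n) = c" and 2: "m \<bullet> w = 0" unfolding eq by (simp_all add: inner_add_right)
  have "w \<bullet> w = m \<bullet> w - (n \<bullet> m) * (n \<bullet> w)" by (simp add: w_def inner_diff_left)
  then have m: "m = (n \<bullet> m) *\<^sub>R n" using nw 2 by (simp add: w_def)
  have "1 = \<bar>n \<bullet> m\<bar> * norm n" using nm(2) m by (metis norm_scaleR)
  then have "n \<bullet> m = 1 \<or> n \<bullet> m = - 1" using nm by (auto simp: abs_if split: if_splits)
  then show ?thesis using m 1 by (auto simp: inner_commute)
qed

lemma outward_normal:
  fixes e :: "'a::euclidean_space set"
  assumes e: "polytopal (int DIM('a) - 1) e" and ex: "\<exists>n. is_outward_normal K e n"
  shows "is_outward_normal K e (outward_normal K e)"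
proof -
  obtain n where n: "is_outward_normal K e n" using ex by blast
  have "m = n" if m: "is_outward_normal K e m" for m
  proof -
    obtain b c where bc: "e \<subseteq> {x. n \<bullet> x = b}" "e \<subseteq> {x. m \<bullet> x = c}"
      using n m unfolding is_outward_normal_def by blast
    have nm: "norm n = 1" "norm m = 1" using n m unfolding is_outward_normal_def by auto
    have "{x. n \<bullet> x = b} = {x. m \<bullet> x = c}"
      using polytopal_planar(1)[OF e nm(1) bc(1)] polytopal_planar(1)[OF e nm(2) bc(2)] by simp
    from affine_hyperplane_normal_unique[OF nm this] have "m = n \<or> m = - n" by auto
    moreover have "m \<noteq> - n"
    proof
      assume mn: "m = - n"
      obtain x where x: "x \<in> rel_interior e" using polytopal_planar(2)[OF e nm(1) bc(1)] by auto
      obtain \<epsilon> where \<epsilon>: "\<epsilon> > 0" "\<And>t. 0 < t \<Longrightarrow> t < \<epsilon> \<Longrightarrow> x - t *\<^sub>R n \<in> interior K \<and> x + t *\<^sub>R n \<notin> K"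
        using n x unfolding is_outward_normal_def by blast
      obtain \<delta> where \<delta>: "\<delta> > 0" "\<And>t. 0 < t \<Longrightarrow> t < \<delta> \<Longrightarrow> x - t *\<^sub>R m \<in> interior K \<and> x + t *\<^sub>R m \<notin> K"
        using m x unfolding is_outward_normal_def by blast
      define t where "t = min \<epsilon> \<delta> / 2"
      have "0 < t" "t < \<epsilon>" "t < \<delta>" using \<epsilon>(1) \<delta>(1) by (auto simp: t_def)
      then show False using \<epsilon>(2)[of t] \<delta>(2)[of t] mn interior_subset by auto
    qed
    ultimately show ?thesis by simp
  qed
  then show ?thesis unfolding outward_normal_def using n by (metis theI)
qed

text \<open>\<open>\<sigma> x\<close> is the time at which the line from \<open>x\<close> with
  velocity \<open>v\<close> meets the hyperplane of \<open>e\<close>. The face integral becomes an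
  integral over starting points whose segment crosses \<open>e\<close>, the form in which it emerges
  from integration along lines.\<close>

lemma integral_face_oblique:
  fixes e :: "'a::euclidean_space set" and f :: "'a \<Rightarrow> real"
  assumes e: "polytopal (int DIM('a) - 1) e" and n: "norm n = 1" and b: "e \<subseteq> {x. n \<bullet> x = b}"
    and h: "n \<bullet> v \<noteq> 0" and f: "continuous_on UNIV f"
  defines "\<sigma> x \<equiv> (b - n \<bullet> x) / (n \<bullet> v)"
  shows "integrable lborel (\<lambda>x. of_bool (0 < \<sigma> x \<and> \<sigma> x < 1) * (indicator e (x + \<sigma> x *\<^sub>R v) * f (x + \<sigma> x *\<^sub>R v)))"
      (is "integrable lborel ?T")
    and "(\<integral>x. of_bool (0 < \<sigma> x \<and> \<sigma> x < 1) * (indicator e (x + \<sigma> x *\<^sub>R v) * f (x + \<sigma> x *\<^sub>R v)) \<partial>lborel) =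
      \<bar>n \<bullet> v\<bar> * (LINT x:e|face_measure e. f x)"
proof -
  have ce: "compact e" using polytopal_compact[OF e] .
  have [measurable]: "e \<in> sets borel" using ce by (auto intro: borel_closed compact_imp_closed)
  have [measurable]: "f \<in> borel_measurable borel" using f by (rule borel_measurable_continuous_onI)
  have [measurable]: "\<sigma> \<in> borel_measurable borel" unfolding \<sigma>_def by measurable
  have [measurable]: "(\<lambda>x. x + \<sigma> x *\<^sub>R v) \<in> borel_measurable borel" by measurable
  obtain R where R: "\<And>x. x \<in> e \<Longrightarrow> norm x \<le> R"
    using compact_imp_bounded[OF ce] unfolding bounded_iff by auto
  have "compact (f ` e)" using f ce by (meson compact_continuous_image continuous_on_subset subset_UNIV)
  then obtain B where B: "\<And>x. x \<in> e \<Longrightarrow> \<bar>f x\<bar> \<le> B" "B > 0"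
    using compact_imp_bounded[of "f ` e"] unfolding bounded_pos by auto
  have zero: "?T x = 0" if "x \<notin> cball 0 (R + norm v)" for x
  proof (rule ccontr)
    assume "?T x \<noteq> 0"
    then have s: "0 < \<sigma> x" "\<sigma> x < 1" "x + \<sigma> x *\<^sub>R v \<in> e" by (auto split: split_indicator_asm)
    have "norm x \<le> norm (x + \<sigma> x *\<^sub>R v) + norm (\<sigma> x *\<^sub>R v)"
      by (metis add.commute add_diff_cancel_left' norm_triangle_sub norm_minus_commute norm_triangle_ineq4)
    also have "\<dots> \<le> R + norm v" using R[OF s(3)] s mult_left_le_one_le[of "norm v" "\<sigma> x"] by simp
    finally show False using that by simp
  qed
  show "integrable lborel ?T"
  proof (rule integrableI_bounded_set[of "cball 0 (R + norm v)" _ _ B])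
    show "AE x in lborel. x \<in> cball 0 (R + norm v) \<longrightarrow> norm (?T x) \<le> B"
      using B by (intro AE_I2) (auto simp: indicator_def)
  qed (use zero emeasure_lborel_cball_finite in auto)
  \<comment> \<open>\<open>face_measure\<close> chooses its own unit normal and offset, possibly the
    opposite of \<open>n\<close> and \<open>b\<close>; crossing times and
    \<open>\<bar>n \<bullet> v\<bar>\<close> are the same for both choices.\<close>
  obtain m c where mc: "norm m = 1" "e \<subseteq> {x. m \<bullet> x = c}" and fm: "face_measure e = hyperplane_measure m c"
  proof -
    have "\<exists>z. case z of (n, b) \<Rightarrow> norm n = 1 \<and> e \<subseteq> {x. n \<bullet> x = b}" using n b by auto
    from someI_ex[OF this] show ?thesis using that
      unfolding face_measure_def by (auto split: prod.splits)
  qed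
  have "{x. n \<bullet> x = b} = {x. m \<bullet> x = c}"
    using polytopal_planar(1)[OF e n b] polytopal_planar(1)[OF e mc] by simp
  from affine_hyperplane_normal_unique[OF n mc(1) this]
  have \<sigma>m: "\<sigma> x = (c - m \<bullet> x) / (m \<bullet> v)" and hm: "\<bar>n \<bullet> v\<bar> = \<bar>m \<bullet> v\<bar>" and hm0: "m \<bullet> v \<noteq> 0" for x
    using h unfolding \<sigma>_def by (auto simp: field_simps)
  have mS: "{x. 0 < \<sigma> x \<and> \<sigma> x < 1} \<in> sets borel" by measurable
  have "(\<integral>x. ?T x \<partial>lborel) =
     (\<integral>x. indicator e (x + \<sigma> x *\<^sub>R v) * f (x + \<sigma> x *\<^sub>R v) \<partial>(restrict_space lborel {x. 0 < \<sigma> x \<and> \<sigma> x < 1}))"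
    using mS by (subst integral_restrict_space) (auto intro!: Bochner_Integration.integral_cong simp: indicator_def)
  also have "\<dots> = (\<integral>x. indicator e x * f x \<partial>(distr (restrict_space lborel {x. 0 < \<sigma> x \<and> \<sigma> x < 1}) borel (\<lambda>x. x + \<sigma> x *\<^sub>R v)))"
    by (subst integral_distr) (auto intro!: measurable_restrict_space1)
  also have "\<dots> = (\<integral>x. indicator e x * f x \<partial>(density (face_measure e) (\<lambda>_. ennreal \<bar>n \<bullet> v\<bar>)))"
    unfolding \<sigma>m fm hm hyperplane_measure_oblique[OF mc(1) hm0] ..
  also have "\<dots> = (\<integral>x. \<bar>n \<bullet> v\<bar> *\<^sub>R (indicator e x * f x) \<partial>(face_measure e))"
    by (rule integral_density) (auto simp: fm hyperplane_measure_def)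
  finally show "(\<integral>x. ?T x \<partial>lborel) = \<bar>n \<bullet> v\<bar> * (LINT x:e|face_measure e. f x)"
    by (simp add: set_lebesgue_integral_def)
qed

text \<open>For every fixed time \<open>s\<close>, translation turns the integral over starting
  points into the integral over \<open>K\<close>, and the times fill an interval of length
  one.\<close>

lemma integral_line_average:
  fixes K :: "'a::euclidean_space set" and f :: "'a \<Rightarrow> real"
  assumes K: "compact K" and f: "continuous_on UNIV f"
  shows "(\<integral>x. (\<integral>s. indicator {0..1} s * (indicator K (x + s *\<^sub>R v) * f (x + s *\<^sub>R v)) \<partial>lborel) \<partial>lborel) =
    (LINT x:K|lborel. f x)" (is "(\<integral>x. (\<integral>s. ?k x s \<partial>lborel) \<partial>lborel) = _")
  and "integrable lborel (\<lambda>x. \<integral>s. indicator {0..1} s * (indicator K (x + s *\<^sub>R v) * f (x + s *\<^sub>R v)) \<partial>lborel)"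
proof -
  have [measurable]: "K \<in> sets borel" using K by (auto intro: borel_closed compact_imp_closed)
  have [measurable]: "f \<in> borel_measurable borel" using f by (rule borel_measurable_continuous_onI)
  \<comment> \<open>The pairs \<open>(x, s)\<close> with \<open>x + s *\<^sub>R v\<close> in
    \<open>K\<close> form a compact set, which makes the integrand of Fubini's theorem a continuous
    function cut off to a compact set.\<close>
  define S where "S = (\<lambda>(y, s). (y - s *\<^sub>R v, s)) ` (K \<times> {0..1::real})"
  have "compact S" unfolding S_def split_def
    by (intro compact_continuous_image compact_Times K compact_Icc continuous_intros)
  moreover have "continuous_on S (\<lambda>z. f (fst z + snd z *\<^sub>R v))"
    by (intro continuous_on_compose2[OF f] continuous_intros) auto
  ultimately have "integrable lborel (\<lambda>z. indicator S z *\<^sub>R f (fst z + snd z *\<^sub>R v))"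
    by (rule borel_integrable_compact)
  moreover have "(x, s) \<in> S \<longleftrightarrow> s \<in> {0..1} \<and> x + s *\<^sub>R v \<in> K" for x s
    unfolding S_def by (force simp: image_iff)
  then have "(\<lambda>z. indicator S z *\<^sub>R f (fst z + snd z *\<^sub>R v)) = (\<lambda>(x, s). ?k x s)"
    by (auto simp: indicator_def fun_eq_iff)
  ultimately have int: "integrable (lborel \<Otimes>\<^sub>M lborel) (\<lambda>(x, s). ?k x s)" by (simp add: lborel_prod)
  show "integrable lborel (\<lambda>x. \<integral>s. ?k x s \<partial>lborel)"
    by (rule lborel_pair.integrable_fst'[OF int, simplified])
  have "(\<integral>x. (\<integral>s. ?k x s \<partial>lborel) \<partial>lborel) = (\<integral>s. (\<integral>x. ?k x s \<partial>lborel) \<partial>lborel)"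
    by (rule lborel_pair.Fubini_integral[OF int, symmetric])
  also have "\<dots> = (\<integral>s. indicator {0..1} (s::real) * (\<integral>x. indicator K x * f x \<partial>lborel) \<partial>lborel)"
  proof (rule Bochner_Integration.integral_cong[OF refl])
    fix s
    show "(\<integral>x. ?k x s \<partial>lborel) = indicator {0..1} s * (\<integral>x. indicator K x * f x \<partial>lborel)"
      using integral_lborel_translate[of "\<lambda>x. indicator K x * f x" "s *\<^sub>R v"] by simp
  qed
  also have "\<dots> = (LINT x:K|lborel. f x)" by (simp add: set_lebesgue_integral_def)
  finally show "(\<integral>x. (\<integral>s. ?k x s \<partial>lborel) \<partial>lborel) = (LINT x:K|lborel. f x)" .
qed

text \<open>The fundamental theorem of calculus is applied on the segment \<open>[x, x + v]\<close> for almost every \<open>x\<close>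
  and the result is integrated over \<open>x\<close>. The endpoint terms cancel by translation invariance, and each
  face contributes the points whose segment crosses it. Generic lines avoid the \<open>(d-2)\<close>-dimensional
  relative boundaries of the faces, hence meet the frontier transversally in one face at a time.\<close>

theorem integral_directional_derivative:
  fixes K :: "'a::euclidean_space set" and f f' :: "'a \<Rightarrow> real"
  assumes K: "compact K" and F: "face_family K F"
    and disj: "\<And>e e'. e \<in> F \<Longrightarrow> e' \<in> F \<Longrightarrow> e \<noteq> e' \<Longrightarrow> rel_interior e \<inter> rel_interior e' = {}"
    and f: "continuous_on UNIV f" and f': "continuous_on UNIV f'"
    and deriv: "\<And>x s. ((\<lambda>s. f (x + s *\<^sub>R v)) has_real_derivative f' (x + s *\<^sub>R v)) (at s)"
  shows "(LINT x:K|lborel. f' x) = (\<Sum>e\<in>F. (outward_normal K e \<bullet> v) * (LINT x:e|face_measure e. f x))"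
proof -
  have finF: "finite F" and UF: "frontier K = \<Union>F" using F by (auto simp: face_family_def)
  have pF: "polytopal (int DIM('a) - 1) e" if "e \<in> F" for e using F that by (auto simp: face_family_def)
  have cF: "closed e" if "e \<in> F" for e using polytopal_compact[OF pF[OF that]] compact_imp_closed by auto
  have clK: "closed K" using K compact_imp_closed by auto
  define n where "n = outward_normal K"
  have out: "is_outward_normal K e (n e)" if "e \<in> F" for e
    unfolding n_def using F that by (intro outward_normal) (auto simp: face_family_def)
  have n1: "norm (n e) = 1" if "e \<in> F" for e using out[OF that] by (simp add: is_outward_normal_def)
  obtain b where b: "\<And>e. e \<in> F \<Longrightarrow> e \<subseteq> {x. n e \<bullet> x = b e}"
    using out unfolding is_outward_normal_def by metis
  note planar = polytopal_planar[OF pF n1 b]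
  define h where "h e = n e \<bullet> v" for e
  define \<sigma> where "\<sigma> e x = (b e - n e \<bullet> x) / h e" for e x
  \<comment> \<open>Faces parallel to \<open>v\<close> are not crossed by generic lines, and their
    coefficient \<open>h e\<close> in the final sum is 0.\<close>
  define F' where "F' = {e \<in> F. h e \<noteq> 0}"
  define T where "T e x = of_bool (0 < \<sigma> e x \<and> \<sigma> e x < 1) *
    (indicator e (x + \<sigma> e x *\<^sub>R v) * f (x + \<sigma> e x *\<^sub>R v))" for e x
  define \<Phi> where "\<Phi> x = indicator K x * f x" for x
  define k where "k x s = indicator {0..1} s * (indicator K (x + s *\<^sub>R v) * f' (x + s *\<^sub>R v))" for x and s :: real
  have T: "integrable lborel (T e)" "(\<integral>x. T e x \<partial>lborel) = \<bar>h e\<bar> * (LINT x:e|face_measure e. f x)" if "e \<in> F'" for e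
  proof -
    have e: "e \<in> F" "n e \<bullet> v \<noteq> 0" using that by (auto simp: F'_def h_def)
    show "integrable lborel (T e)" "(\<integral>x. T e x \<partial>lborel) = \<bar>h e\<bar> * (LINT x:e|face_measure e. f x)"
      using integral_face_oblique[OF pF[OF e(1)] n1[OF e(1)] b[OF e(1)] e(2) f]
      unfolding T_def[abs_def] \<sigma>_def h_def by auto
  qed
  have \<sigma>: "n e \<bullet> (x + s *\<^sub>R v) = b e \<longleftrightarrow> s = \<sigma> e x" if "e \<in> F'" for e x s
    using that by (auto simp: F'_def \<sigma>_def h_def inner_add_right field_simps)
  \<comment> \<open>Besides the relative boundaries, \<open>x\<close> and \<open>x + v\<close> avoid
    the hyperplanes of all faces. Hence no crossing happens at time 0 or 1, and no line runs inside
    the hyperplane of a face parallel to \<open>v\<close>.\<close>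
  have "AE x in lborel. \<forall>e\<in>F. (\<forall>s. x + s *\<^sub>R v \<notin> e - rel_interior e) \<and> n e \<bullet> x \<noteq> b e \<and> n e \<bullet> (x + v) \<noteq> b e"
  proof (rule AE_finite_allI[OF finF])
    fix e assume e: "e \<in> F"
    obtain \<G> where \<G>: "finite \<G>" "\<And>g. g \<in> \<G> \<Longrightarrow> aff_dim g = int DIM('a) - 2" "e - rel_interior e \<subseteq> \<Union>\<G>"
      using planar(3)[OF e e e] by blast
    have *: "AE x in lborel. x \<notin> {x. n e \<bullet> x = c}" for c
    proof -
      have "n e \<noteq> 0" using n1[OF e] by auto
      then show ?thesis by (intro AE_lborel_not_in_affine affine_hyperplane) simp
    qed
    have "AE x in lborel. \<forall>g\<in>\<G>. \<forall>s. x + s *\<^sub>R v \<notin> g"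
      by (rule AE_finite_allI[OF \<G>(1)], rule AE_line_avoids[OF \<G>(2)])
    then show "AE x in lborel. (\<forall>s. x + s *\<^sub>R v \<notin> e - rel_interior e) \<and> n e \<bullet> x \<noteq> b e \<and> n e \<bullet> (x + v) \<noteq> b e"
      using *[of "b e"] *[of "b e - n e \<bullet> v"]
    proof eventually_elim
      case (elim x)
      then show ?case using \<G>(3) by (auto simp: inner_add_right)
    qed
  qed
  then have line: "AE x in lborel. (\<integral>s. k x s \<partial>lborel) = \<Phi> (x + v) - \<Phi> x + (\<Sum>e\<in>F'. sgn (h e) * T e x)"
  proof eventually_elim
    case (elim x)
    then have ri: "\<And>e s. e \<in> F \<Longrightarrow> x + s *\<^sub>R v \<in> e \<Longrightarrow> x + s *\<^sub>R v \<in> rel_interior e"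
      and ne: "\<And>e. e \<in> F \<Longrightarrow> n e \<bullet> x \<noteq> b e" "\<And>e. e \<in> F \<Longrightarrow> n e \<bullet> (x + v) \<noteq> b e" by auto
    have uniq: "e = e'" if "e \<in> F" "e' \<in> F" "x + s *\<^sub>R v \<in> e" "x + s *\<^sub>R v \<in> e'" for e e' s
      using ri[OF that(1,3)] ri[OF that(2,4)] disj[OF that(1,2)] by auto
    define E where "E = {e \<in> F'. x + \<sigma> e x *\<^sub>R v \<in> e}"
    define S where "S = {s. x + s *\<^sub>R v \<in> K}"
    have EF: "e \<in> F" "e \<in> F'" "h e \<noteq> 0" "x + \<sigma> e x *\<^sub>R v \<in> e" if "e \<in> E" for e using that by (auto simp: E_def F'_def)
    have finE: "finite E" "finite F'" using finF by (auto simp: E_def F'_def)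
    have lim: "filterlim (\<lambda>t. x + t *\<^sub>R v) (nhds (x + s *\<^sub>R v)) (nhds s)" for s
      by (intro tendsto_intros filterlim_ident)
    \<comment> \<open>By \<open>uniq\<close> the crossing point lies on no other face, as the
      half-space description of the cell requires.\<close>
    have loc: "\<forall>\<^sub>F t in nhds (\<sigma> e x). t \<in> S \<longleftrightarrow> n e \<bullet> (x + t *\<^sub>R v) \<le> b e" if "e \<in> E" for e
    proof -
      note e = EF[OF that]
      have "\<forall>\<^sub>F y in nhds (x + \<sigma> e x *\<^sub>R v). y \<in> K \<longleftrightarrow> n e \<bullet> y \<le> b e"
        using uniq[OF e(1) _ e(4)]
        by (intro frontier_locally_halfspace[OF clK UF finF cF e(1) out[OF e(1)] planar(1)[OF e(1) e(1) e(1)] ri[OF e(1,4)]]) auto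
      from eventually_compose_filterlim[OF this lim] show ?thesis by (simp add: S_def)
    qed
    have "((\<lambda>s. indicator S s * f' (x + s *\<^sub>R v)) has_integral
      (indicator S 1 * f (x + 1 *\<^sub>R v) - indicator S 0 * f (x + 0 *\<^sub>R v) +
        (\<Sum>e\<in>E. sgn (h e) * (of_bool (0 < \<sigma> e x \<and> \<sigma> e x < 1) * f (x + \<sigma> e x *\<^sub>R v))))) {0..1}"
    proof (rule has_integral_indicator_derivative[where h = h, OF finE(1)])
      show "inj_on (\<lambda>e. \<sigma> e x) E" using EF uniq by (intro inj_onI) metis
    next
      fix s assume s: "s \<notin> (\<lambda>e. \<sigma> e x) ` E"
      have "x + s *\<^sub>R v \<notin> frontier K"
      proof
        assume "x + s *\<^sub>R v \<in> frontier K"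
        then obtain e where e: "e \<in> F" "x + s *\<^sub>R v \<in> e" using UF by auto
        then have *: "n e \<bullet> (x + s *\<^sub>R v) = b e" using b by auto
        then have "h e \<noteq> 0" using ne(1)[OF e(1)] by (auto simp: h_def inner_add_right)
        then have "e \<in> F'" using e by (simp add: F'_def)
        with \<sigma>[OF this] * have "s = \<sigma> e x" by simp
        with \<open>e \<in> F'\<close> e s show False by (auto simp: E_def)
      qed
      then consider "x + s *\<^sub>R v \<in> interior K" | "x + s *\<^sub>R v \<in> - K"
        using clK by (auto simp: frontier_def)
      then show "\<forall>\<^sub>F t in nhds s. t \<in> S \<longleftrightarrow> s \<in> S"
      proof cases
        case 1
        have "\<forall>\<^sub>F y in nhds (x + s *\<^sub>R v). y \<in> interior K" using 1 by (intro eventually_nhds_in_open) auto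
        from eventually_compose_filterlim[OF this lim] show ?thesis
          by eventually_elim (use 1 interior_subset in \<open>auto simp: S_def\<close>)
      next
        case 2
        have "\<forall>\<^sub>F y in nhds (x + s *\<^sub>R v). y \<in> - K" using 2 clK by (intro eventually_nhds_in_open) auto
        from eventually_compose_filterlim[OF this lim] show ?thesis
          by eventually_elim (use 2 in \<open>auto simp: S_def\<close>)
      qed
    next
      fix e assume e: "e \<in> E" and h: "h e > 0"
      from loc[OF e] show "\<forall>\<^sub>F t in nhds (\<sigma> e x). t \<in> S \<longleftrightarrow> t \<le> \<sigma> e x"
        by eventually_elim (use h in \<open>auto simp: h_def[symmetric] \<sigma>_def inner_add_right field_simps\<close>)
    next
      fix e assume e: "e \<in> E" and "\<not> h e > 0"
      then have h: "h e < 0" using EF(3)[OF e] by auto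
      from loc[OF e] have "\<forall>\<^sub>F t in nhds (\<sigma> e x). t \<in> S \<longleftrightarrow> t \<ge> \<sigma> e x"
        by eventually_elim (use h in \<open>auto simp: h_def[symmetric] \<sigma>_def inner_add_right field_simps\<close>)
      with h show "h e < 0 \<and> (\<forall>\<^sub>F t in nhds (\<sigma> e x). t \<in> S \<longleftrightarrow> t \<ge> \<sigma> e x)" by simp
    next
      fix e assume e: "e \<in> E"
      show "\<sigma> e x \<noteq> 0 \<and> \<sigma> e x \<noteq> 1"
        using \<sigma>[OF EF(2)[OF e], of x 0] \<sigma>[OF EF(2)[OF e], of x 1] ne[OF EF(1)[OF e]] by auto
    qed (rule deriv)
    moreover have "(\<Sum>e\<in>E. sgn (h e) * (of_bool (0 < \<sigma> e x \<and> \<sigma> e x < 1) * f (x + \<sigma> e x *\<^sub>R v))) =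
      (\<Sum>e\<in>F'. sgn (h e) * T e x)"
      by (rule sum.mono_neutral_cong_left[OF finE(2)]) (auto simp: E_def T_def)
    ultimately have "((\<lambda>s. indicator S s * f' (x + s *\<^sub>R v)) has_integral
        (\<Phi> (x + v) - \<Phi> x + (\<Sum>e\<in>F'. sgn (h e) * T e x))) {0..1}"
      by (simp add: \<Phi>_def S_def indicator_def)
    then have "((\<lambda>s. k x s) has_integral (\<Phi> (x + v) - \<Phi> x + (\<Sum>e\<in>F'. sgn (h e) * T e x))) UNIV"
      by (subst (asm) has_integral_restrict_UNIV[symmetric], elim has_integral_eq[rotated])
        (simp add: k_def S_def indicator_def)
    moreover have "integrable lborel (k x)"
    proof -
      have "closed ((\<lambda>s. x + s *\<^sub>R v) -` K)"
        by (intro continuous_closed_vimage clK continuous_intros)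
      then have "closed S" by (simp add: S_def vimage_def)
      then have "compact ({0..1} \<inter> S)" by (intro compact_Int_closed) auto
      moreover have "continuous_on ({0..1} \<inter> S) (\<lambda>s. f' (x + s *\<^sub>R v))"
        by (intro continuous_on_compose2[OF f'] continuous_intros) auto
      ultimately have "integrable lborel (\<lambda>s. indicator ({0..1} \<inter> S) s *\<^sub>R f' (x + s *\<^sub>R v))"
        by (rule borel_integrable_compact)
      moreover have "indicator ({0..1} \<inter> S) s *\<^sub>R f' (x + s *\<^sub>R v) = k x s" for s
        by (simp add: k_def S_def indicator_def)
      ultimately show ?thesis by simp
    qed
    then have "(k x has_integral (\<integral>s. k x s \<partial>lborel)) UNIV" by (rule has_integral_integral_lborel)
    ultimately show ?case by (rule has_integral_unique[rotated])
  qed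
  have mk: "integrable lborel (\<lambda>x. \<integral>s. k x s \<partial>lborel)" "(\<integral>x. \<integral>s. k x s \<partial>lborel \<partial>lborel) = (LINT x:K|lborel. f' x)"
    using integral_line_average[OF K f'] unfolding k_def by auto
  have int\<Phi>: "integrable lborel \<Phi>"
    using borel_integrable_compact[OF K continuous_on_subset[OF f]] unfolding \<Phi>_def by simp
  have m\<Phi>: "\<Phi> \<in> borel_measurable borel" using int\<Phi> by (simp add: integrable_iff_bounded)
  have int\<Phi>v: "integrable lborel (\<lambda>x. \<Phi> (x + v))"
  proof -
    have "integrable (distr lborel borel ((+) v)) \<Phi>" using int\<Phi> by (simp add: lborel_distr_plus)
    then show ?thesis by (subst (asm) integrable_distr_eq) (auto simp: m\<Phi> add.commute)
  qed
  have "(LINT x:K|lborel. f' x) = (\<integral>x. \<Phi> (x + v) - \<Phi> x + (\<Sum>e\<in>F'. sgn (h e) * T e x) \<partial>lborel)"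
    unfolding mk(2)[symmetric]
    by (rule integral_cong_AE) (use mk(1) T(1) int\<Phi> int\<Phi>v line in \<open>auto intro!: borel_measurable_add borel_measurable_diff borel_measurable_sum borel_measurable_times simp: integrable_iff_bounded\<close>)
  also have "\<dots> = (\<Sum>e\<in>F'. sgn (h e) * (\<bar>h e\<bar> * (LINT x:e|face_measure e. f x)))"
    using T int\<Phi> int\<Phi>v integral_lborel_translate[OF m\<Phi>, of v] by (simp add: Bochner_Integration.integral_sum)
  also have "\<dots> = (\<Sum>e\<in>F'. h e * (LINT x:e|face_measure e. f x))"
    by (simp add: mult.assoc[symmetric] sgn_mult_abs)
  also have "\<dots> = (\<Sum>e\<in>F. h e * (LINT x:e|face_measure e. f x))"
    by (rule sum.mono_neutral_left) (auto simp: finF F'_def)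
  finally show ?thesis by (simp add: h_def n_def)
qed

section \<open>Geometric quasilinearization\<close>

lemmas state_components = dens_def mom_def mag_def ener_def

lemma flux_n_eq:
  "flux_n \<gamma> n U =
    (dens U * (vel U \<bullet> n),
     (vel U \<bullet> n) *\<^sub>R mom U - (mag U \<bullet> n) *\<^sub>R mag U + ptot \<gamma> U *\<^sub>R n,
     (vel U \<bullet> n) *\<^sub>R mag U - (mag U \<bullet> n) *\<^sub>R vel U,
     (vel U \<bullet> n) * (ener U + ptot \<gamma> U) - (mag U \<bullet> n) * (vel U \<bullet> mag U))"
proof -
  have *: "x \<bullet> n = x $ 1 * n $ 1 + x $ 2 * n $ 2 + x $ 3 * n $ 3" for x
    by (simp add: inner_vec_def sum_3)
  have n: "n = (\<Sum>i\<in>UNIV. n $ i *\<^sub>R axis i 1)" by (simp add: vec_eq_iff axis_def if_distrib cong: if_cong)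
  define u m B E p w where "u = vel U" and "m = mom U" and "B = mag U" and "E = ener U"
    and "p = ptot \<gamma> U" and "w = vel U \<bullet> mag U"
  have 1: "(\<Sum>i\<in>UNIV. n $ i * (dens U * u $ i)) = dens U * (u \<bullet> n)"
    unfolding * sum_3 by (simp add: algebra_simps)
  have 2: "(\<Sum>i\<in>UNIV. n $ i *\<^sub>R (u $ i *\<^sub>R m - B $ i *\<^sub>R B + p *\<^sub>R axis i 1)) = (u \<bullet> n) *\<^sub>R m - (B \<bullet> n) *\<^sub>R B + p *\<^sub>R n"
    by (subst (4) n) (simp add: * sum_3 algebra_simps)
  have 3: "(\<Sum>i\<in>UNIV. n $ i *\<^sub>R (u $ i *\<^sub>R B - B $ i *\<^sub>R u)) = (u \<bullet> n) *\<^sub>R B - (B \<bullet> n) *\<^sub>R u"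
    unfolding * sum_3 by (simp add: algebra_simps)
  have 4: "(\<Sum>i\<in>UNIV. n $ i * (u $ i * (E + p) - B $ i * w)) = (u \<bullet> n) * (E + p) - (B \<bullet> n) * w"
    unfolding * sum_3 by (simp add: algebra_simps)
  show ?thesis
    unfolding flux_n_def flux_def prod_eq_iff fst_sum snd_sum
    using 1 2 3 4 by (simp add: u_def m_def B_def E_def p_def w_def)
qed

text \<open>For \<open>v = vel W\<close> and \<open>B = mag W\<close> this is the gradient of the
  internal energy at \<open>W\<close>, the reason why it returns in the gradients of pressure and
  entropy. In the positivity proof \<open>v\<close> and \<open>B\<close> are free
  parameters.\<close>

definition gql_normal :: "real^3 \<Rightarrow> real^3 \<Rightarrow> state" where
  "gql_normal v B = ((norm v)\<^sup>2 / 2, - v, - B, 1)"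

text \<open>Kept apart from the magnetic energy because the flux transports it with the velocity of
  the state, whereas the magnetic part is transported with the free velocity
  \<open>v\<close>.\<close>

definition thermo_kinetic :: "real \<Rightarrow> real^3 \<Rightarrow> state \<Rightarrow> real" where
  "thermo_kinetic \<gamma> v U = press \<gamma> U / (\<gamma> - 1) + dens U * (norm (vel U - v))\<^sup>2 / 2"

definition relative_energy :: "real \<Rightarrow> real^3 \<Rightarrow> real^3 \<Rightarrow> state \<Rightarrow> real" where
  "relative_energy \<gamma> v B U = thermo_kinetic \<gamma> v U + (norm (mag U - B))\<^sup>2 / 2"

lemma admissible_dens: "U \<in> admissible \<Longrightarrow> dens U > 0"
  by (simp add: admissible_def)

lemma admissible_press: "U \<in> admissible \<Longrightarrow> \<gamma> > 1 \<Longrightarrow> press \<gamma> U > 0"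
  by (simp add: admissible_def press_def)

lemma mom_eq: "dens U > 0 \<Longrightarrow> mom U = dens U *\<^sub>R vel U"
  by (simp add: vel_def)

lemma ener_eq:
  assumes "\<gamma> > 1" "dens U > 0"
  shows "ener U = press \<gamma> U / (\<gamma> - 1) + dens U * (vel U \<bullet> vel U) / 2 + (mag U \<bullet> mag U) / 2"
  using assms by (simp add: press_def vel_def power2_norm_eq_inner field_simps)

lemma gql_normal_inner:
  assumes "\<gamma> > 1" "dens U > 0"
  shows "gql_normal v B \<bullet> U = relative_energy \<gamma> v B U - (norm B)\<^sup>2 / 2"
proof -
  have "gql_normal v B \<bullet> U = (v \<bullet> v) / 2 * dens U - v \<bullet> mom U - B \<bullet> mag U + ener U"
    by (simp add: gql_normal_def state_components inner_prod_def power2_norm_eq_inner)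
  moreover define q where "q = press \<gamma> U / (\<gamma> - 1)"
  ultimately show ?thesis
    unfolding mom_eq[OF assms(2)] ener_eq[OF assms] relative_energy_def thermo_kinetic_def q_def[symmetric]
    by (simp add: power2_norm_eq_inner inner_simps inner_commute field_simps)
qed

lemma thermo_kinetic_pos: "U \<in> admissible \<Longrightarrow> \<gamma> > 1 \<Longrightarrow> thermo_kinetic \<gamma> v U > 0"
  using admissible_dens[of U] admissible_press[of U \<gamma>] unfolding thermo_kinetic_def
  by (intro add_pos_nonneg divide_pos_pos) auto

lemma relative_energy_pos: "U \<in> admissible \<Longrightarrow> \<gamma> > 1 \<Longrightarrow> relative_energy \<gamma> v B U > 0"
  using thermo_kinetic_pos[of U \<gamma> v] unfolding relative_energy_def by (simp add: add_pos_nonneg)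

text \<open>Geometric quasilinearization (Wu and Shu): the nonlinear constraint becomes a family of
  inequalities that are linear in the state.\<close>

lemma admissible_gqlI:
  fixes \<gamma> :: real
  assumes \<gamma>: "\<gamma> > 1" and \<rho>: "dens U > 0"
    and pos: "\<And>v B. gql_normal v B \<bullet> U + (norm B)\<^sup>2 / 2 > 0"
  shows "U \<in> admissible"
proof -
  have "press \<gamma> U / (\<gamma> - 1) > 0"
    using pos[of "vel U" "mag U"] unfolding gql_normal_inner[OF \<gamma> \<rho>] relative_energy_def thermo_kinetic_def
    by simp
  then show ?thesis using \<rho> \<gamma> by (simp add: admissible_def press_def)
qed

text \<open>The work of pressure and magnetic stress, that is, what the flux functional contains
  besides transport. It is linear in \<open>vel U - v\<close>, which opens the way to
  Cauchy-Schwarz.\<close>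

definition coupling :: "real \<Rightarrow> real^3 \<Rightarrow> real^3 \<Rightarrow> real^3 \<Rightarrow> state \<Rightarrow> real" where
  "coupling \<gamma> v B n U = press \<gamma> U * ((vel U - v) \<bullet> n) + (mag U \<bullet> (mag U - B)) * ((vel U - v) \<bullet> n)
     - (mag U \<bullet> n) * ((vel U - v) \<bullet> (mag U - B))"

text \<open>The last two terms show what must cancel. The one with \<open>(norm B)\<^sup>2\<close>
  depends on the normal alone and drops out of interface differences and of sums over closed
  surfaces. The one with \<open>v \<bullet> B\<close> is removed by the source term at an interface
  and by the discrete divergence condition in a cell.\<close>

lemma gql_normal_flux:
  assumes "\<gamma> > 1" "dens U > 0"
  shows "gql_normal v B \<bullet> flux_n \<gamma> n U = (vel U \<bullet> n) * thermo_kinetic \<gamma> v U + coupling \<gamma> v B n U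
    + (v \<bullet> n) * ((norm (mag U - B))\<^sup>2 / 2 - (norm B)\<^sup>2 / 2) + (mag U \<bullet> n) * (v \<bullet> B)"
proof -
  define q where "q = press \<gamma> U / (\<gamma> - 1)"
  have "gql_normal v B \<bullet> flux_n \<gamma> n U = (v \<bullet> v) / 2 * (dens U * (vel U \<bullet> n))
      - v \<bullet> ((vel U \<bullet> n) *\<^sub>R mom U - (mag U \<bullet> n) *\<^sub>R mag U + ptot \<gamma> U *\<^sub>R n)
      - B \<bullet> ((vel U \<bullet> n) *\<^sub>R mag U - (mag U \<bullet> n) *\<^sub>R vel U)
      + ((vel U \<bullet> n) * (ener U + ptot \<gamma> U) - (mag U \<bullet> n) * (vel U \<bullet> mag U))"
    by (simp add: gql_normal_def flux_n_eq inner_prod_def power2_norm_eq_inner)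
  also have "\<dots> = (vel U \<bullet> n) * thermo_kinetic \<gamma> v U + coupling \<gamma> v B n U
    + (v \<bullet> n) * ((norm (mag U - B))\<^sup>2 / 2 - (norm B)\<^sup>2 / 2) + (mag U \<bullet> n) * (v \<bullet> B)"
    unfolding mom_eq[OF assms(2)] ener_eq[OF assms] coupling_def thermo_kinetic_def ptot_def q_def[symmetric]
    by (simp add: power2_norm_eq_inner inner_simps inner_commute) (simp add: field_simps)
  finally show ?thesis .
qed

lemma gql_normal_source: "gql_normal v B \<bullet> source U = (vel U - v) \<bullet> (mag U - B) - v \<bullet> B"
  by (simp add: gql_normal_def source_def inner_prod_def inner_simps inner_commute)

text \<open>\<open>L\<close> is the larger root of \<open>L\<^sup>2 - (c + b) L + c d = 0\<close> with \<open>c = \<C>\<^sub>s\<^sup>2\<close>, \<open>b = \<bar>B\<bar>\<^sup>2/\<rho>\<close> and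
  \<open>d = (n \<bullet> B)\<^sup>2/\<rho>\<close>.\<close>

lemma split_speed_square:
  assumes U: "U \<in> admissible" and \<gamma>: "\<gamma> > 1" and n: "norm n = 1"
  defines "L \<equiv> (split_speed \<gamma> U n)\<^sup>2"
  defines "X \<equiv> L - Cs2 \<gamma> U" and "Y \<equiv> L - (norm (mag U))\<^sup>2 / dens U"
  shows "split_speed \<gamma> U n \<ge> 0" "X \<ge> 0" "Y \<ge> 0" "X * Y = Cs2 \<gamma> U * ((norm (mag U))\<^sup>2 - (n \<bullet> mag U)\<^sup>2) / dens U"
proof -
  define c d b where "c = Cs2 \<gamma> U" and "d = (n \<bullet> mag U)\<^sup>2 / dens U" and "b = (norm (mag U))\<^sup>2 / dens U"
  have \<rho>: "dens U > 0" using U by (rule admissible_dens)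
  have c: "c \<ge> 0" using \<rho> admissible_press[OF U \<gamma>] \<gamma> by (simp add: c_def Cs2_def)
  have "\<bar>n \<bullet> mag U\<bar> \<le> norm (mag U)" using Cauchy_Schwarz_ineq2[of n "mag U"] n by simp
  then have "(n \<bullet> mag U)\<^sup>2 \<le> (norm (mag U))\<^sup>2" by (metis abs_le_square_iff abs_norm_cancel)
  then have db: "d \<le> b" "0 \<le> d" using \<rho> by (auto simp: d_def b_def divide_right_mono)
  define R where "R = sqrt ((c + b)\<^sup>2 - 4 * (c * d))"
  have "c * d \<le> c * b" using db c by (simp add: mult_left_mono)
  moreover have "(c + b)\<^sup>2 - 4 * (c * b) = (c - b)\<^sup>2" by (simp add: power2_eq_square algebra_simps)
  ultimately have disc: "(c + b)\<^sup>2 - 4 * (c * d) \<ge> (c - b)\<^sup>2" by simp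
  have R2: "R\<^sup>2 = (c + b)\<^sup>2 - 4 * (c * d)"
    unfolding R_def by (rule real_sqrt_pow2) (use disc zero_le_power2[of "c - b"] in linarith)
  have R: "R \<ge> \<bar>c - b\<bar>"
    unfolding R_def by (rule real_le_rsqrt) (use disc in simp)
  have CR: "split_speed \<gamma> U n = 1 / sqrt 2 * sqrt (c + b + R)"
    by (simp add: split_speed_def R_def c_def d_def b_def)
  have R0: "c + b + R \<ge> 0" using c db R by linarith
  then show "split_speed \<gamma> U n \<ge> 0" by (simp add: CR)
  have L: "L = (c + b + R) / 2" using R0 by (simp add: CR L_def power_mult_distrib power_divide)
  show "X \<ge> 0" "Y \<ge> 0" using R unfolding X_def Y_def L c_def[symmetric] b_def[symmetric] by (simp_all add: field_simps)
  have "X * Y = (R\<^sup>2 - (c - b)\<^sup>2) / 4"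
    unfolding X_def Y_def L c_def[symmetric] b_def[symmetric] by (simp add: power2_eq_square field_simps)
  also have "\<dots> = c * (b - d)" unfolding R2 by (simp add: power2_eq_square field_simps)
  finally show "X * Y = Cs2 \<gamma> U * ((norm (mag U))\<^sup>2 - (n \<bullet> mag U)\<^sup>2) / dens U"
    by (simp add: c_def b_def d_def diff_divide_distrib right_diff_distrib)
qed

text \<open>The coupling is \<open>w \<bullet> y\<close> with \<open>y\<close> independent of
  \<open>w\<close>, so it suffices that \<open>(norm y)\<^sup>2\<close> is at most
  \<open>\<rho> * C\<^sup>2 * (\<theta> + b \<bullet> b)\<close>. With \<open>b\<close> split along
  \<open>n\<close>, this bounds a quadratic form in the square roots of \<open>\<theta>\<close> and
  \<open>z\<close>; its largest eigenvalue is \<open>\<rho>\<close> times the larger root in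
  \<open>split_speed_square\<close>, which is where the formula for the splitting speed comes
  from.\<close>

lemma coupling_bound:
  assumes U: "U \<in> admissible" and \<gamma>: "\<gamma> > 1" and n: "norm n = 1"
  shows "\<bar>coupling \<gamma> v B n U\<bar> \<le> split_speed \<gamma> U n * relative_energy \<gamma> v B U"
proof -
  define \<rho> p C c where "\<rho> = dens U" and "p = press \<gamma> U" and "C = split_speed \<gamma> U n" and "c = Cs2 \<gamma> U"
  define w M b where "w = vel U - v" and "M = mag U" and "b = M - B"
  have \<rho>: "\<rho> > 0" and p: "p > 0" using U \<gamma> by (auto simp: \<rho>_def p_def admissible_dens admissible_press)
  have C: "C \<ge> 0" using split_speed_square(1)[OF U \<gamma> n] by (simp add: C_def)
  have nn: "n \<bullet> n = 1" using n by (simp add: dot_square_norm)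
  define y where "y = (p + M \<bullet> b) *\<^sub>R n - (M \<bullet> n) *\<^sub>R b"
  define \<beta> bp Mp m where "\<beta> = M \<bullet> n" and "bp = b - (b \<bullet> n) *\<^sub>R n" and "Mp = M - (M \<bullet> n) *\<^sub>R n" and "m = Mp \<bullet> bp"
  define z where "z = bp \<bullet> bp"
  have T: "coupling \<gamma> v B n U = w \<bullet> y"
    unfolding coupling_def y_def w_def[symmetric] M_def[symmetric] b_def[symmetric] p_def[symmetric]
    by (simp add: inner_diff_right inner_commute algebra_simps)
  have yy: "y \<bullet> y = (p + m)\<^sup>2 + \<beta>\<^sup>2 * z"
    by (simp add: y_def m_def \<beta>_def z_def bp_def Mp_def inner_simps inner_commute nn power2_eq_square algebra_simps)
  have MpMp: "Mp \<bullet> Mp = M \<bullet> M - \<beta>\<^sup>2"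
    by (simp add: Mp_def \<beta>_def inner_simps inner_commute nn power2_eq_square algebra_simps)
  have zb: "z \<le> b \<bullet> b"
    by (simp add: z_def bp_def inner_simps inner_commute nn power2_eq_square algebra_simps)
  have z0: "z \<ge> 0" by (simp add: z_def)
  have m2: "m\<^sup>2 \<le> (M \<bullet> M - \<beta>\<^sup>2) * z"
    using Cauchy_Schwarz_ineq[of Mp bp] by (simp add: m_def MpMp z_def)
  \<comment> \<open>Twice the internal energy. The factor in \<open>Cs2\<close> is such that
    \<open>p\<^sup>2 = \<rho> * c * \<theta>\<close>, so the pressure enters the quadratic form
    through \<open>c\<close>.\<close>
  define \<theta> where "\<theta> = 2 * p / (\<gamma> - 1)"
  have \<theta>: "\<theta> > 0" using p \<gamma> by (simp add: \<theta>_def)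
  have p2: "p\<^sup>2 = \<rho> * c * \<theta>" using \<gamma> \<rho> by (simp add: c_def Cs2_def \<theta>_def \<rho>_def p_def power2_eq_square)
  define X Y where "X = C\<^sup>2 - c" and "Y = C\<^sup>2 - (M \<bullet> M) / \<rho>"
  have XY: "X \<ge> 0" "Y \<ge> 0" "X * Y = c * (M \<bullet> M - \<beta>\<^sup>2) / \<rho>"
    using split_speed_square(2-4)[OF U \<gamma> n]
    by (simp_all add: X_def Y_def C_def c_def M_def \<rho>_def \<beta>_def power2_norm_eq_inner inner_commute)
  \<comment> \<open>The off-diagonal term: its square is controlled by the product
    \<open>X * Y\<close>, and the inequality of arithmetic and geometric means turns this into the
    sum.\<close>
  have "2 * (p * m) \<le> \<rho> * (X * \<theta> + Y * z)"
  proof (rule power2_le_imp_le)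
    have "(2 * (p * m))\<^sup>2 = 4 * (p\<^sup>2 * m\<^sup>2)" by (simp add: power_mult_distrib)
    also have "\<dots> \<le> 4 * (p\<^sup>2 * ((M \<bullet> M - \<beta>\<^sup>2) * z))" using m2 by (intro mult_left_mono) auto
    also have "\<dots> = 4 * \<rho>\<^sup>2 * ((X * Y) * (\<theta> * z))"
      unfolding p2 XY(3) using \<rho> by (simp add: power2_eq_square)
    also have "\<dots> \<le> (\<rho> * (X * \<theta> + Y * z))\<^sup>2"
    proof -
      have "4 * ((X * \<theta>) * (Y * z)) \<le> (X * \<theta> + Y * z)\<^sup>2"
        using zero_le_power2[of "X * \<theta> - Y * z"] by (simp add: power2_eq_square algebra_simps)
      then have "\<rho>\<^sup>2 * (4 * ((X * \<theta>) * (Y * z))) \<le> \<rho>\<^sup>2 * (X * \<theta> + Y * z)\<^sup>2"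
        by (intro mult_left_mono) auto
      then show ?thesis by (simp add: power_mult_distrib mult_ac)
    qed
    finally show "(2 * (p * m))\<^sup>2 \<le> (\<rho> * (X * \<theta> + Y * z))\<^sup>2" .
    show "0 \<le> \<rho> * (X * \<theta> + Y * z)" using \<rho> XY \<theta> z0 by simp
  qed
  then have "(p + m)\<^sup>2 + \<beta>\<^sup>2 * z \<le> \<rho> * c * \<theta> + m\<^sup>2 + \<rho> * (X * \<theta> + Y * z) + \<beta>\<^sup>2 * z"
    unfolding p2[symmetric] by (simp add: power2_eq_square algebra_simps)
  also have "\<dots> \<le> \<rho> * c * \<theta> + (M \<bullet> M - \<beta>\<^sup>2) * z + \<rho> * (X * \<theta> + Y * z) + \<beta>\<^sup>2 * z" using m2 by simp
  also have "\<dots> = \<rho> * C\<^sup>2 * (\<theta> + z)" using \<rho> by (simp add: X_def Y_def field_simps)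
  also have "\<dots> \<le> \<rho> * C\<^sup>2 * (\<theta> + b \<bullet> b)" using zb \<rho> by (intro mult_left_mono) auto
  finally have y2: "(norm y)\<^sup>2 \<le> \<rho> * C\<^sup>2 * (\<theta> + b \<bullet> b)" using yy by (simp add: power2_norm_eq_inner)
  have "norm y \<le> sqrt \<rho> * C * sqrt (\<theta> + b \<bullet> b)"
    using real_le_rsqrt[OF y2] C by (simp add: real_sqrt_mult)
  then have "\<bar>w \<bullet> y\<bar> \<le> norm w * (sqrt \<rho> * C * sqrt (\<theta> + b \<bullet> b))"
    using Cauchy_Schwarz_ineq2[of w y] by (meson mult_left_mono norm_ge_zero order_trans)
  also have "\<dots> = C * ((sqrt \<rho> * norm w) * sqrt (\<theta> + b \<bullet> b))" by simp
  also have "\<dots> \<le> C * (((sqrt \<rho> * norm w)\<^sup>2 + (sqrt (\<theta> + b \<bullet> b))\<^sup>2) / 2)"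
    using zero_le_power2[of "sqrt \<rho> * norm w - sqrt (\<theta> + b \<bullet> b)"]
    by (intro mult_left_mono C) (simp add: power2_eq_square algebra_simps)
  also have "\<dots> = C * relative_energy \<gamma> v B U"
  proof -
    have "\<theta> / 2 = press \<gamma> U / (\<gamma> - 1)" using \<gamma> by (simp add: \<theta>_def p_def field_simps)
    then have "relative_energy \<gamma> v B U = (\<rho> * (norm w)\<^sup>2 + (\<theta> + b \<bullet> b)) / 2"
      by (simp add: relative_energy_def thermo_kinetic_def w_def b_def M_def \<rho>_def power2_norm_eq_inner)
    moreover have "(sqrt \<rho> * norm w)\<^sup>2 = \<rho> * (norm w)\<^sup>2" "(sqrt (\<theta> + b \<bullet> b))\<^sup>2 = \<theta> + b \<bullet> b"
      using \<rho> \<theta> by (simp_all add: power_mult_distrib add_nonneg_nonneg)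
    ultimately show ?thesis by simp
  qed
  finally show ?thesis by (simp add: T C_def)
qed

section \<open>Roe averages, interface estimates and the cell estimate\<close>

lemma roe_vel_commute: "roe_vel U V = roe_vel V U"
  by (simp add: roe_vel_def add.commute)

lemma mag_jump_commute: "mag_jump U V = mag_jump V U"
  by (simp add: mag_jump_def add.commute norm_minus_commute)

lemma mag_jump_nonneg: "U \<in> admissible \<Longrightarrow> V \<in> admissible \<Longrightarrow> mag_jump U V \<ge> 0"
  using admissible_dens[of U] admissible_dens[of V] by (simp add: mag_jump_def)

text \<open>With square-root weights the numerator of \<open>roe_vel U V - v\<close> consists of
  square roots of kinetic energies, while its denominator combines with the difference of the fields
  to \<open>mag_jump\<close>. The bound \<open>N\<close> is 1 for a normal at an interface and 2 for
  a difference of two normals of a cell.\<close>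

lemma roe_vel_bound:
  assumes U: "U \<in> admissible" and V: "V \<in> admissible" and \<gamma>: "\<gamma> > 1" and \<xi>: "norm \<xi> \<le> N"
  shows "\<bar>((roe_vel U V - v) \<bullet> \<xi>) * ((norm (mag U - B))\<^sup>2 / 2 - (norm (mag V - B))\<^sup>2 / 2)\<bar>
    \<le> N * mag_jump U V * (relative_energy \<gamma> v B U + relative_energy \<gamma> v B V)"
proof -
  define s t where "s = sqrt (dens U)" and "t = sqrt (dens V)"
  have st: "s > 0" "t > 0" "dens U = s\<^sup>2" "dens V = t\<^sup>2"
    using U V by (auto simp: s_def t_def admissible_dens less_imp_le)
  define w w' b b' where "w = vel U - v" and "w' = vel V - v" and "b = mag U - B" and "b' = mag V - B"
  define x y z u where "x = s * norm w" and "y = t * norm w'" and "z = norm b" and "u = norm b'"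
  have nn: "x \<ge> 0" "y \<ge> 0" "z \<ge> 0" "u \<ge> 0" using st by (auto simp: x_def y_def z_def u_def)
  have N: "N \<ge> 0" using \<xi> norm_ge_zero order_trans by blast
  have "(s + t) *\<^sub>R (roe_vel U V - v) = s *\<^sub>R w + t *\<^sub>R w'"
    using st(1,2) unfolding roe_vel_def s_def[symmetric] t_def[symmetric]
    by (simp add: w_def w'_def scaleR_right_diff_distrib scaleR_left_distrib)
  then have r: "roe_vel U V - v = (1 / (s + t)) *\<^sub>R (s *\<^sub>R w + t *\<^sub>R w')"
    using st(1,2) by (metis add_pos_pos divide_inverse inverse_1 less_irrefl mult_1 scaleR_one scaleR_scaleR left_inverse)
  have "norm (s *\<^sub>R w + t *\<^sub>R w') \<le> x + y"
    using norm_triangle_ineq[of "s *\<^sub>R w" "t *\<^sub>R w'"] st by (simp add: x_def y_def)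
  then have "norm (roe_vel U V - v) \<le> (x + y) / (s + t)"
    unfolding r using st(1,2) by (simp add: divide_right_mono)
  then have 1: "\<bar>(roe_vel U V - v) \<bullet> \<xi>\<bar> \<le> (x + y) / (s + t) * N"
    using \<xi> by (intro order_trans[OF Cauchy_Schwarz_ineq2] mult_mono) (use nn st in auto)
  have "(norm b)\<^sup>2 - (norm b')\<^sup>2 = (b - b') \<bullet> (b + b')"
    by (simp add: power2_norm_eq_inner inner_simps inner_commute)
  then have "\<bar>(norm b)\<^sup>2 - (norm b')\<^sup>2\<bar> \<le> norm (mag U - mag V) * (z + u)"
    using Cauchy_Schwarz_ineq2[of "b - b'" "b + b'"] norm_triangle_ineq[of b b']
    unfolding z_def u_def by (simp add: b_def b'_def) (meson mult_left_mono norm_ge_zero order_trans)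
  then have 2: "\<bar>(norm b)\<^sup>2 / 2 - (norm b')\<^sup>2 / 2\<bar> \<le> norm (mag U - mag V) * (z + u) / 2" by (simp add: abs_if field_simps split: if_splits)
  have "\<bar>((roe_vel U V - v) \<bullet> \<xi>) * ((norm b)\<^sup>2 / 2 - (norm b')\<^sup>2 / 2)\<bar> \<le>
      ((x + y) / (s + t) * N) * (norm (mag U - mag V) * (z + u) / 2)"
    unfolding abs_mult using 1 2 by (intro mult_mono) (use nn st N in auto)
  also have "\<dots> = N * mag_jump U V * ((x + y) * (z + u) / 2)"
    by (simp add: mag_jump_def s_def t_def)
  also have "\<dots> \<le> N * mag_jump U V * (relative_energy \<gamma> v B U + relative_energy \<gamma> v B V)"
  proof (intro mult_left_mono mult_nonneg_nonneg N mag_jump_nonneg U V)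
    have "(x + y) * (z + u) / 2 \<le> (x\<^sup>2 + y\<^sup>2 + z\<^sup>2 + u\<^sup>2) / 2"
      using zero_le_power2[of "x + y - z - u"] zero_le_power2[of "x - y"] zero_le_power2[of "z - u"]
      by (simp add: power2_eq_square algebra_simps)
    also have "\<dots> \<le> relative_energy \<gamma> v B U + relative_energy \<gamma> v B V"
      using admissible_press[OF U \<gamma>] admissible_press[OF V \<gamma>] \<gamma> st(3,4)
      by (simp add: relative_energy_def thermo_kinetic_def x_def y_def z_def u_def power_mult_distrib
        w_def w'_def b_def b'_def add_divide_distrib)
    finally show "(x + y) * (z + u) / 2 \<le> relative_energy \<gamma> v B U + relative_energy \<gamma> v B V" .
  qed
  finally show ?thesis by (simp add: b_def b'_def)
qed

lemma fast_bound_nonneg: "U \<in> admissible \<Longrightarrow> V \<in> admissible \<Longrightarrow> \<gamma> > 1 \<Longrightarrow> fast_bound \<gamma> U V \<ge> 0"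
  using admissible_press[of U \<gamma>] admissible_dens[of U] by (simp add: fast_bound_def le_max_iff_disj)

lemma am0_le:
  assumes "U \<in> admissible" "V \<in> admissible" "\<gamma> > 1"
  shows "am0 \<gamma> U V n \<le> vel U \<bullet> n - split_speed \<gamma> U n - mag_jump U V - \<bar>delta_B U V n\<bar> / sqrt (dens U)"
    and "am0 \<gamma> U V n \<le> roe_vel U V \<bullet> n - split_speed \<gamma> U n - mag_jump U V - \<bar>delta_B U V n\<bar> / sqrt (dens U)"
  using fast_bound_nonneg[OF assms] by (auto simp: am0_def alpha_l_def min_def)

lemma ap0_ge:
  assumes "U \<in> admissible" "V \<in> admissible" "\<gamma> > 1"
  shows "ap0 \<gamma> U V n \<ge> vel V \<bullet> n + split_speed \<gamma> V n + mag_jump U V"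
    and "ap0 \<gamma> U V n \<ge> roe_vel U V \<bullet> n + split_speed \<gamma> V n + mag_jump U V"
proof -
  have "\<bar>delta_B U V n\<bar> / sqrt (dens V) \<ge> 0" using admissible_dens[OF assms(2)] by simp
  then show "ap0 \<gamma> U V n \<ge> vel V \<bullet> n + split_speed \<gamma> V n + mag_jump U V"
    "ap0 \<gamma> U V n \<ge> roe_vel U V \<bullet> n + split_speed \<gamma> V n + mag_jump U V"
    using fast_bound_nonneg[OF assms] unfolding ap0_def alpha_r_def mag_jump_commute[of V] roe_vel_commute[of V]
    by linarith+
qed

text \<open>The term \<open>v \<bullet> n\<close>, which is not controlled by the energies, is split as \<open>r - (r - v \<bullet> n)\<close> with the Roe
  average \<open>r\<close>: the first part is absorbed by the speeds, the second by the magnetic jump.\<close>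

lemma two_state_gql:
  assumes U: "U \<in> admissible" and V: "V \<in> admissible" and \<gamma>: "\<gamma> > 1" and n: "norm n = 1"
    and am: "am \<le> am0 \<gamma> U V n" and ap: "ap \<ge> ap0 \<gamma> U V n"
  shows "0 \<le> ap * relative_energy \<gamma> v B V - am * relative_energy \<gamma> v B U
    + gql_normal v B \<bullet> flux_n \<gamma> n U - gql_normal v B \<bullet> flux_n \<gamma> n V
    - delta_B U V n * (gql_normal v B \<bullet> source U)"
proof -
  note dU = admissible_dens[OF U] and dV = admissible_dens[OF V]
  define k k' where "k = thermo_kinetic \<gamma> v U" and "k' = thermo_kinetic \<gamma> v V"
  define q q' where "q = (norm (mag U - B))\<^sup>2 / 2" and "q' = (norm (mag V - B))\<^sup>2 / 2"
  define C C' where "C = split_speed \<gamma> U n" and "C' = split_speed \<gamma> V n"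
  define j r \<delta> where "j = mag_jump U V" and "r = roe_vel U V \<bullet> n" and "\<delta> = \<bar>delta_B U V n\<bar> / sqrt (dens U)"
  have e: "relative_energy \<gamma> v B U = k + q" "relative_energy \<gamma> v B V = k' + q'"
    by (simp_all add: relative_energy_def k_def k'_def q_def q'_def)
  have nn: "k \<ge> 0" "k' \<ge> 0" "q \<ge> 0" "q' \<ge> 0"
    using thermo_kinetic_pos[OF U \<gamma>] thermo_kinetic_pos[OF V \<gamma>] by (auto simp: k_def k'_def q_def q'_def less_imp_le)
  \<comment> \<open>Both entries of the maximum in \<open>alpha_r\<close> are needed: the velocity
    of the state for the thermal and kinetic energy, the Roe velocity for the magnetic
    energy.\<close>
  have a1: "(vel V \<bullet> n + C' + j) * k' \<le> ap * k'" "(r + C' + j) * q' \<le> ap * q'"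
    using ap ap0_ge[OF U V \<gamma>, of n] nn by (auto simp: C'_def j_def r_def intro!: mult_right_mono)
  have a2: "am * k \<le> (vel U \<bullet> n - C - j - \<delta>) * k" "am * q \<le> (r - C - j - \<delta>) * q"
    using am am0_le[OF U V \<gamma>, of n] nn by (auto simp: C_def j_def r_def \<delta>_def intro!: mult_right_mono)
  have c: "\<bar>coupling \<gamma> v B n U\<bar> \<le> C * (k + q)" "\<bar>coupling \<gamma> v B n V\<bar> \<le> C' * (k' + q')"
    using coupling_bound[OF U \<gamma> n, of v B] coupling_bound[OF V \<gamma> n, of v B] unfolding C_def C'_def e by auto
  have jb: "\<bar>(r - v \<bullet> n) * (q - q')\<bar> \<le> j * ((k + q) + (k' + q'))"
    using roe_vel_bound[OF U V \<gamma>, of n 1 v B] n by (simp add: e j_def r_def q_def q'_def inner_diff_left)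
  \<comment> \<open>Of the source term, the part with \<open>v \<bullet> B\<close> cancels in
    \<open>f\<close>; the remaining quadratic part is paid for by the jump term in
    \<open>am0\<close>, one factor being a square root of kinetic energy.\<close>
  have d: "delta_B U V n * ((vel U - v) \<bullet> (mag U - B)) \<le> \<delta> * (k + q)"
  proof -
    define x y where "x = sqrt (dens U) * norm (vel U - v)" and "y = norm (mag U - B)"
    have "delta_B U V n * ((vel U - v) \<bullet> (mag U - B)) \<le> \<bar>delta_B U V n\<bar> * (norm (vel U - v) * norm (mag U - B))"
      by (rule order_trans[OF abs_ge_self]) (simp add: abs_mult mult_left_mono Cauchy_Schwarz_ineq2)
    also have "\<dots> = \<delta> * (x * y)" using dU by (simp add: \<delta>_def x_def y_def)
    also have "\<dots> \<le> \<delta> * (x\<^sup>2 / 2 + y\<^sup>2 / 2)"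
      using zero_le_power2[of "x - y"] dU by (intro mult_left_mono) (auto simp: \<delta>_def power2_eq_square algebra_simps)
    also have "\<dots> \<le> \<delta> * (k + q)"
      using dU admissible_press[OF U \<gamma>] \<gamma>
      by (intro mult_left_mono) (auto simp: \<delta>_def k_def q_def thermo_kinetic_def x_def y_def power_mult_distrib)
    finally show ?thesis .
  qed
  have f: "gql_normal v B \<bullet> flux_n \<gamma> n U - gql_normal v B \<bullet> flux_n \<gamma> n V
    - delta_B U V n * (gql_normal v B \<bullet> source U) =
    (vel U \<bullet> n) * k - (vel V \<bullet> n) * k' + coupling \<gamma> v B n U - coupling \<gamma> v B n V + (v \<bullet> n) * (q - q')
    - delta_B U V n * ((vel U - v) \<bullet> (mag U - B))"
    unfolding gql_normal_flux[OF \<gamma> dU] gql_normal_flux[OF \<gamma> dV] gql_normal_source k_def k'_def q_def q'_def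
      delta_B_def mag_n_def by (simp add: algebra_simps)
  have "0 \<le> ((vel V \<bullet> n + C' + j) * k' + (r + C' + j) * q') - ((vel U \<bullet> n - C - j - \<delta>) * k + (r - C - j - \<delta>) * q)
    + ((vel U \<bullet> n) * k - (vel V \<bullet> n) * k' + coupling \<gamma> v B n U - coupling \<gamma> v B n V + (v \<bullet> n) * (q - q')
    - delta_B U V n * ((vel U - v) \<bullet> (mag U - B)))"
  proof -
    have "((vel V \<bullet> n + C' + j) * k' + (r + C' + j) * q') - ((vel U \<bullet> n - C - j - \<delta>) * k + (r - C - j - \<delta>) * q)
      + ((vel U \<bullet> n) * k - (vel V \<bullet> n) * k' + coupling \<gamma> v B n U - coupling \<gamma> v B n V + (v \<bullet> n) * (q - q')
      - delta_B U V n * ((vel U - v) \<bullet> (mag U - B))) =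
      (C * (k + q) + coupling \<gamma> v B n U) + (C' * (k' + q') - coupling \<gamma> v B n V)
      + (j * ((k + q) + (k' + q')) - (r - v \<bullet> n) * (q - q'))
      + (\<delta> * (k + q) - delta_B U V n * ((vel U - v) \<bullet> (mag U - B)))"
      by (simp add: algebra_simps)
    then show ?thesis using c jb d unfolding abs_le_iff by linarith
  qed
  then show ?thesis unfolding e using f a1 a2 by (simp add: distrib_left)
qed

text \<open>The HLL flux is \<open>F(U) + am (U\<^sup>* - U)\<close> with the intermediate state \<open>U\<^sup>*\<close>, whose functional is
  nonnegative by the two-state inequality.\<close>

lemma HLL_gql_bound:
  assumes U: "U \<in> admissible" and V: "V \<in> admissible" and \<gamma>: "\<gamma> > 1" and n: "norm n = 1"
    and am: "am \<le> am0 \<gamma> U V n" "am < 0" and ap: "ap \<ge> ap0 \<gamma> U V n" "0 < ap"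
  shows "gql_normal v B \<bullet> (hll_flux \<gamma> am ap U V n - (am / (ap - am) * delta_B U V n) *\<^sub>R source U)
    \<le> gql_normal v B \<bullet> flux_n \<gamma> n U - am * relative_energy \<gamma> v B U"
proof -
  define C where "C = ap - am"
  have C: "C > 0" using am ap by (simp add: C_def)
  define F F' S e e' \<delta> where "F = gql_normal v B \<bullet> flux_n \<gamma> n U" and "F' = gql_normal v B \<bullet> flux_n \<gamma> n V"
    and "S = gql_normal v B \<bullet> source U" and "e = relative_energy \<gamma> v B U" and "e' = relative_energy \<gamma> v B V"
    and "\<delta> = delta_B U V n"
  have two: "0 \<le> ap * e' - am * e + F - F' - \<delta> * S"
    using two_state_gql[OF U V \<gamma> n am(1) ap(1), of v B] by (simp add: F_def F'_def S_def e_def e'_def \<delta>_def)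
  have UV: "gql_normal v B \<bullet> (V - U) = e' - e"
    unfolding inner_diff_right gql_normal_inner[OF \<gamma> admissible_dens[OF U]] gql_normal_inner[OF \<gamma> admissible_dens[OF V]]
    by (simp add: e_def e'_def)
  have "gql_normal v B \<bullet> (hll_flux \<gamma> am ap U V n - (am / C * \<delta>) *\<^sub>R source U) =
    (ap * F - am * F' + ap * am * (e' - e) - am * \<delta> * S) / C"
    unfolding hll_flux_def C_def[symmetric]
    by (simp only: inner_diff_right inner_add_right inner_scaleR_right UV[unfolded inner_diff_right])
      (simp add: F_def F'_def S_def diff_divide_distrib)
  also have "\<dots> \<le> F - am * e"
  proof -
    have "(F - am * e) * C - (ap * F - am * F' + ap * am * (e' - e) - am * \<delta> * S) =
      - am * (ap * e' - am * e + F - F' - \<delta> * S)" by (simp add: C_def algebra_simps)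
    also have "\<dots> \<ge> 0" using am(2) two by (intro mult_nonneg_nonneg) auto
    finally show ?thesis using C by (simp add: pos_divide_le_eq)
  qed
  finally show ?thesis by (simp add: C_def \<delta>_def F_def e_def)
qed

text \<open>The source has no density component, so this is the scalar HLL estimate, which only
  needs the speeds to enclose both normal velocities.\<close>

lemma HLL_dens_bound:
  assumes U: "U \<in> admissible" and V: "V \<in> admissible" and \<gamma>: "\<gamma> > 1" and n: "norm n = 1"
    and am: "am \<le> am0 \<gamma> U V n" "am < 0" and ap: "ap \<ge> ap0 \<gamma> U V n" "0 < ap"
  shows "dens (hll_flux \<gamma> am ap U V n - (am / (ap - am) * delta_B U V n) *\<^sub>R source U)
    \<le> dens U * (vel U \<bullet> n - am)"
proof -
  define C where "C = ap - am"
  have C: "C > 0" using am ap by (simp add: C_def)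
  define \<rho> \<rho>' u u' where "\<rho> = dens U" and "\<rho>' = dens V" and "u = vel U \<bullet> n" and "u' = vel V \<bullet> n"
  have \<rho>: "\<rho> > 0" "\<rho>' > 0" using U V by (auto simp: \<rho>_def \<rho>'_def admissible_dens)
  have d: "\<bar>delta_B U V n\<bar> / sqrt (dens U) \<ge> 0" using \<rho> by (simp add: \<rho>_def)
  have "am \<le> u" "u' \<le> ap"
    using am(1) ap(1) am0_le(1)[OF U V \<gamma>, of n] ap0_ge(1)[OF U V \<gamma>, of n] split_speed_square(1)[OF U \<gamma> n]
      split_speed_square(1)[OF V \<gamma> n] mag_jump_nonneg[OF U V] d unfolding u_def u'_def by linarith+
  then have two: "0 \<le> \<rho> * (u - am) + \<rho>' * (ap - u')" using \<rho> by simp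
  have "dens (hll_flux \<gamma> am ap U V n - (am / (ap - am) * delta_B U V n) *\<^sub>R source U) =
     (ap * (\<rho> * u) - am * (\<rho>' * u') + ap * am * (\<rho>' - \<rho>)) / C"
    by (simp add: dens_def hll_flux_def source_def flux_n_eq C_def \<rho>_def \<rho>'_def u_def u'_def)
  also have "\<dots> \<le> \<rho> * (u - am)"
  proof -
    have "\<rho> * (u - am) * C - (ap * (\<rho> * u) - am * (\<rho>' * u') + ap * am * (\<rho>' - \<rho>)) =
      - am * (\<rho> * (u - am) + \<rho>' * (ap - u'))" by (simp add: C_def algebra_simps)
    also have "\<dots> \<ge> 0" using am(2) two by (intro mult_nonneg_nonneg) auto
    finally show ?thesis using C by (simp add: pos_divide_le_eq)
  qed
  finally show ?thesis by (simp add: \<rho>_def u_def)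
qed

text \<open>Since the weighted normals sum to zero, the uncontrolled sum of \<open>v \<bullet> n\<^sub>i\<close> terms can be symmetrized
  into pair differences, to which the Roe splitting applies.\<close>

lemma cell_gql_bound:
  fixes c :: "'i \<Rightarrow> real" and n :: "'i \<Rightarrow> real^3" and U :: "'i \<Rightarrow> state"
  assumes I: "finite I" and c: "\<And>i. i \<in> I \<Longrightarrow> c i > 0" and n: "\<And>i. i \<in> I \<Longrightarrow> norm (n i) = 1"
    and U: "\<And>i. i \<in> I \<Longrightarrow> U i \<in> admissible" and \<gamma>: "\<gamma> > 1"
    and closed_surface: "(\<Sum>i\<in>I. c i *\<^sub>R n i) = 0" and divergence: "(\<Sum>i\<in>I. c i * (mag (U i) \<bullet> n i)) = 0"
  defines "P \<equiv> (\<Sum>i\<in>I. c i)"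
  defines "a i \<equiv> max (vel (U i) \<bullet> n i) (1 / P * (\<Sum>k\<in>I. c k * ((n i - n k) \<bullet> roe_vel (U i) (U k))))
      + split_speed \<gamma> (U i) (n i) + 2 / P * (\<Sum>k\<in>I. c k * mag_jump (U i) (U k))"
  shows "(\<Sum>i\<in>I. c i * (gql_normal v B \<bullet> flux_n \<gamma> (n i) (U i))) \<le> (\<Sum>i\<in>I. c i * (a i * relative_energy \<gamma> v B (U i)))"
proof (cases "I = {}")
  case False
  have P: "P > 0" unfolding P_def using I False c by (intro sum_pos) auto
  define e where "e i = relative_energy \<gamma> v B (U i)" for i
  define k where "k i = thermo_kinetic \<gamma> v (U i)" for i
  define q where "q i = (norm (mag (U i) - B))\<^sup>2 / 2" for i
  define r where "r i j = (n i - n j) \<bullet> roe_vel (U i) (U j)" for i j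
  define J where "J i j = mag_jump (U i) (U j)" for i j
  have e: "e i = k i + q i" for i by (simp add: e_def k_def q_def relative_energy_def)
  have knn: "k i \<ge> 0" if "i \<in> I" for i using thermo_kinetic_pos[OF U[OF that] \<gamma>] by (simp add: k_def less_imp_le)
  have qnn: "q i \<ge> 0" for i by (simp add: q_def)
  have rsym: "r j i = - r i j" for i j by (simp add: r_def roe_vel_commute[of "U j"] inner_diff_left)
  have Jsym: "J j i = J i j" for i j by (simp add: J_def mag_jump_commute)
  have cn: "(\<Sum>i\<in>I. c i * (v \<bullet> n i)) = 0"
    using arg_cong[OF closed_surface, of "\<lambda>x. v \<bullet> x"] by (simp add: inner_sum_right)
  have sym: "(\<Sum>i\<in>I. \<Sum>j\<in>I. g i j + g j i) = 2 * (\<Sum>i\<in>I. \<Sum>j\<in>I. g i j)" for g :: "'i \<Rightarrow> 'i \<Rightarrow> real"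
    using sum.swap[of g I I] by (simp add: sum.distrib)
  define R where "R i = 1 / P * (\<Sum>j\<in>I. c j * r i j)" for i
  define H where "H i = 2 / P * (\<Sum>j\<in>I. c j * J i j)" for i
  \<comment> \<open>Both sides times \<open>2 * P\<close> are double sums over pairs of nodes. On
    the left, \<open>0\<close> supplies the missing mixed terms, so only differences of normals and
    of magnetic energies remain. The factor 2 in \<open>H\<close> bounds the norm of a difference of
    two unit normals.\<close>
  have key: "(\<Sum>i\<in>I. c i * ((v \<bullet> n i) * q i)) \<le> (\<Sum>i\<in>I. c i * (R i * q i)) + (\<Sum>i\<in>I. c i * (H i * e i))"
  proof -
    have 0: "(\<Sum>i\<in>I. \<Sum>j\<in>I. c i * c j * ((v \<bullet> n i) * q j)) = 0"
    proof -
      have "(\<Sum>i\<in>I. \<Sum>j\<in>I. c i * c j * ((v \<bullet> n i) * q j)) = (\<Sum>i\<in>I. c i * (v \<bullet> n i)) * (\<Sum>j\<in>I. c j * q j)"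
        unfolding sum_product by (intro sum.cong refl) simp
      then show ?thesis using cn by simp
    qed
    have A: "2 * P * (\<Sum>i\<in>I. c i * ((v \<bullet> n i) * q i)) =
      (\<Sum>i\<in>I. \<Sum>j\<in>I. c i * c j * (v \<bullet> (n i - n j) * (q i - q j)))"
    proof -
      have "P * (\<Sum>i\<in>I. c i * ((v \<bullet> n i) * q i)) = (\<Sum>i\<in>I. \<Sum>j\<in>I. c i * c j * ((v \<bullet> n i) * q i))"
        unfolding P_def sum_product by (subst sum.swap) (intro sum.cong refl, simp)
      also have "\<dots> = (\<Sum>i\<in>I. \<Sum>j\<in>I. c i * c j * ((v \<bullet> n i) * q i) - c i * c j * ((v \<bullet> n i) * q j))"
        using 0 by (simp add: sum_subtractf)
      finally have "2 * P * (\<Sum>i\<in>I. c i * ((v \<bullet> n i) * q i)) = 2 * \<dots>" by simp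
      also have "\<dots> = (\<Sum>i\<in>I. \<Sum>j\<in>I. c i * c j * (v \<bullet> (n i - n j) * (q i - q j)))"
        unfolding sym[symmetric] by (intro sum.cong refl) (simp add: inner_diff_right algebra_simps)
      finally show ?thesis .
    qed
    have Rq: "2 * P * (\<Sum>i\<in>I. c i * (R i * q i)) = (\<Sum>i\<in>I. \<Sum>j\<in>I. c i * c j * (r i j * (q i - q j)))"
    proof -
      have "P * (\<Sum>i\<in>I. c i * (R i * q i)) = (\<Sum>i\<in>I. \<Sum>j\<in>I. c i * c j * (r i j * q i))"
        using P by (simp add: R_def sum_distrib_left sum_distrib_right mult_ac)
      then have "2 * P * (\<Sum>i\<in>I. c i * (R i * q i)) = 2 * \<dots>" by simp
      also have "\<dots> = (\<Sum>i\<in>I. \<Sum>j\<in>I. c i * c j * (r i j * (q i - q j)))"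
        unfolding sym[symmetric]
        by (intro sum.cong refl) (subst rsym, simp add: algebra_simps)
      finally show ?thesis .
    qed
    have He: "2 * P * (\<Sum>i\<in>I. c i * (H i * e i)) = (\<Sum>i\<in>I. \<Sum>j\<in>I. c i * c j * (2 * J i j * (e i + e j)))"
    proof -
      have "P * (\<Sum>i\<in>I. c i * (H i * e i)) = (\<Sum>i\<in>I. \<Sum>j\<in>I. c i * c j * (2 * J i j * e i))"
        using P by (simp add: H_def sum_distrib_left sum_distrib_right mult_ac)
      then have "2 * P * (\<Sum>i\<in>I. c i * (H i * e i)) = 2 * \<dots>" by simp
      also have "\<dots> = (\<Sum>i\<in>I. \<Sum>j\<in>I. c i * c j * (2 * J i j * (e i + e j)))"
        unfolding sym[symmetric]
        by (intro sum.cong refl) (subst (2) Jsym, simp add: algebra_simps)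
      finally show ?thesis .
    qed
    have "(\<Sum>i\<in>I. \<Sum>j\<in>I. c i * c j * (v \<bullet> (n i - n j) * (q i - q j))) \<le>
      (\<Sum>i\<in>I. \<Sum>j\<in>I. c i * c j * (r i j * (q i - q j) + 2 * J i j * (e i + e j)))"
    proof (intro sum_mono mult_left_mono)
      fix i j assume ij: "i \<in> I" "j \<in> I"
      have "norm (n i - n j) \<le> 2" using norm_triangle_ineq4[of "n i" "n j"] n ij by simp
      from roe_vel_bound[OF U[OF ij(1)] U[OF ij(2)] \<gamma> this, of v B]
      have "\<bar>(r i j - v \<bullet> (n i - n j)) * (q i - q j)\<bar> \<le> 2 * J i j * (e i + e j)"
        by (simp add: r_def q_def J_def e_def inner_diff_left inner_diff_right inner_commute)
      then show "v \<bullet> (n i - n j) * (q i - q j) \<le> r i j * (q i - q j) + 2 * J i j * (e i + e j)"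
        unfolding left_diff_distrib abs_le_iff by linarith
      show "0 \<le> c i * c j" using c ij by (simp add: less_imp_le)
    qed
    then have "2 * P * (\<Sum>i\<in>I. c i * ((v \<bullet> n i) * q i)) \<le>
       2 * P * ((\<Sum>i\<in>I. c i * (R i * q i)) + (\<Sum>i\<in>I. c i * (H i * e i)))"
      unfolding distrib_left[of "2 * P"] A Rq He by (simp add: distrib_left sum.distrib)
    then show ?thesis using P by simp
  qed
  have "(\<Sum>i\<in>I. c i * (gql_normal v B \<bullet> flux_n \<gamma> (n i) (U i))) =
    (\<Sum>i\<in>I. c i * ((vel (U i) \<bullet> n i) * k i + coupling \<gamma> v B (n i) (U i)))
    + (\<Sum>i\<in>I. c i * ((v \<bullet> n i) * q i)) - (norm B)\<^sup>2 / 2 * (\<Sum>i\<in>I. c i * (v \<bullet> n i))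
    + (v \<bullet> B) * (\<Sum>i\<in>I. c i * (mag (U i) \<bullet> n i))"
    unfolding sum_distrib_left sum.distrib[symmetric] sum_subtractf[symmetric]
  proof (intro sum.cong refl)
    fix i assume "i \<in> I"
    show "c i * (gql_normal v B \<bullet> flux_n \<gamma> (n i) (U i)) =
      c i * ((vel (U i) \<bullet> n i) * k i + coupling \<gamma> v B (n i) (U i)) + c i * ((v \<bullet> n i) * q i)
      - (norm B)\<^sup>2 / 2 * (c i * (v \<bullet> n i)) + (v \<bullet> B) * (c i * (mag (U i) \<bullet> n i))"
      unfolding gql_normal_flux[OF \<gamma> admissible_dens[OF U[OF \<open>i \<in> I\<close>]]]
      by (simp add: k_def q_def algebra_simps)
  qed
  also have "\<dots> \<le> (\<Sum>i\<in>I. c i * ((vel (U i) \<bullet> n i) * k i + coupling \<gamma> v B (n i) (U i)))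
    + ((\<Sum>i\<in>I. c i * (R i * q i)) + (\<Sum>i\<in>I. c i * (H i * e i)))"
    using key unfolding cn divergence by simp
  also have "\<dots> = (\<Sum>i\<in>I. c i * ((vel (U i) \<bullet> n i) * k i + coupling \<gamma> v B (n i) (U i) + R i * q i + H i * e i))"
    by (simp add: sum.distrib distrib_left)
  also have "\<dots> \<le> (\<Sum>i\<in>I. c i * (a i * e i))"
  proof (intro sum_mono mult_left_mono)
    fix i assume i: "i \<in> I"
    have ai: "a i = max (vel (U i) \<bullet> n i) (R i) + split_speed \<gamma> (U i) (n i) + H i"
      by (simp add: a_def R_def H_def r_def J_def)
    have "(vel (U i) \<bullet> n i) * k i \<le> max (vel (U i) \<bullet> n i) (R i) * k i"
      "R i * q i \<le> max (vel (U i) \<bullet> n i) (R i) * q i"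
      using knn[OF i] qnn[of i] by (auto intro!: mult_right_mono)
    moreover have "coupling \<gamma> v B (n i) (U i) \<le> split_speed \<gamma> (U i) (n i) * (k i + q i)"
      using coupling_bound[OF U[OF i] \<gamma> n[OF i], of v B] e[of i] by (simp add: e_def abs_le_iff)
    ultimately show "(vel (U i) \<bullet> n i) * k i + coupling \<gamma> v B (n i) (U i) + R i * q i + H i * e i \<le> a i * e i"
      unfolding ai e by (simp add: algebra_simps)
    show "0 \<le> c i" using c[OF i] by simp
  qed
  finally show ?thesis by (simp add: e_def)
qed simp

text \<open>Shared by the density, with \<open>\<kappa> = 0\<close>, and by the relative energies,
  with \<open>\<kappa> = (norm B)\<^sup>2 / 2\<close>; since the weights sum to one, the constant
  can be distributed over the nodes. That sum also shows that not both node sets are empty, and the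
  strict step condition gives strict positivity if only face nodes occur.\<close>

lemma positive_update:
  fixes \<l> :: state and c a m \<omega> :: "'i \<Rightarrow> real" and G U :: "'i \<Rightarrow> state" and \<omega>' :: "'j \<Rightarrow> real" and U' :: "'j \<Rightarrow> state"
  assumes fin: "finite I" "finite A" and \<omega>: "\<And>i. i \<in> I \<Longrightarrow> \<omega> i > 0" "\<And>i. i \<in> A \<Longrightarrow> \<omega>' i > 0"
    and one: "(\<Sum>i\<in>A. \<omega>' i) + (\<Sum>i\<in>I. \<omega> i) = 1"
    and pos: "\<And>i. i \<in> I \<Longrightarrow> \<l> \<bullet> U i + \<kappa> > 0" "\<And>i. i \<in> A \<Longrightarrow> \<l> \<bullet> U' i + \<kappa> > 0"
    and flux: "(\<Sum>i\<in>I. c i * (\<l> \<bullet> G i)) \<le> (\<Sum>i\<in>I. c i * ((a i - m i) * (\<l> \<bullet> U i + \<kappa>)))"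
    and cfl: "\<And>i. i \<in> I \<Longrightarrow> t * (c i * (a i - m i)) < \<omega> i" and t: "t \<ge> 0"
  shows "\<l> \<bullet> ((\<Sum>i\<in>A. \<omega>' i *\<^sub>R U' i) + (\<Sum>i\<in>I. \<omega> i *\<^sub>R U i) - t *\<^sub>R (\<Sum>i\<in>I. c i *\<^sub>R G i)) + \<kappa> > 0"
proof -
  have "\<kappa> = (\<Sum>i\<in>A. \<omega>' i * \<kappa>) + (\<Sum>i\<in>I. \<omega> i * \<kappa>)"
    using one by (simp add: sum_distrib_right[symmetric] distrib_right[symmetric])
  then have "\<l> \<bullet> ((\<Sum>i\<in>A. \<omega>' i *\<^sub>R U' i) + (\<Sum>i\<in>I. \<omega> i *\<^sub>R U i) - t *\<^sub>R (\<Sum>i\<in>I. c i *\<^sub>R G i)) + \<kappa> =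
    (\<Sum>i\<in>A. \<omega>' i * (\<l> \<bullet> U' i + \<kappa>)) + (\<Sum>i\<in>I. \<omega> i * (\<l> \<bullet> U i + \<kappa>)) - t * (\<Sum>i\<in>I. c i * (\<l> \<bullet> G i))"
    by (simp add: inner_diff_right inner_add_right inner_sum_right distrib_left sum.distrib)
  also have "\<dots> \<ge> (\<Sum>i\<in>A. \<omega>' i * (\<l> \<bullet> U' i + \<kappa>)) + (\<Sum>i\<in>I. \<omega> i * (\<l> \<bullet> U i + \<kappa>))
      - t * (\<Sum>i\<in>I. c i * ((a i - m i) * (\<l> \<bullet> U i + \<kappa>)))" (is "_ \<ge> ?R")
    using mult_left_mono[OF flux t] by simp
  also have "?R = (\<Sum>i\<in>A. \<omega>' i * (\<l> \<bullet> U' i + \<kappa>)) + (\<Sum>i\<in>I. (\<omega> i - t * (c i * (a i - m i))) * (\<l> \<bullet> U i + \<kappa>))"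
    by (simp add: sum_distrib_left sum_subtractf[symmetric] left_diff_distrib mult.assoc)
  finally have le: "\<dots> \<le> \<l> \<bullet> ((\<Sum>i\<in>A. \<omega>' i *\<^sub>R U' i) + (\<Sum>i\<in>I. \<omega> i *\<^sub>R U i) - t *\<^sub>R (\<Sum>i\<in>I. c i *\<^sub>R G i)) + \<kappa>" .
  have nn: "(\<Sum>i\<in>A. \<omega>' i * (\<l> \<bullet> U' i + \<kappa>)) \<ge> 0" "(\<Sum>i\<in>I. (\<omega> i - t * (c i * (a i - m i))) * (\<l> \<bullet> U i + \<kappa>)) \<ge> 0"
    using \<omega> pos cfl by (auto intro!: sum_nonneg mult_nonneg_nonneg simp: less_imp_le)
  consider "A \<noteq> {}" | "I \<noteq> {}" using one by fastforce
  then show ?thesis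
  proof cases
    case 1
    then have "(\<Sum>i\<in>A. \<omega>' i * (\<l> \<bullet> U' i + \<kappa>)) > 0" using fin \<omega> pos by (intro sum_pos mult_pos_pos) auto
    then show ?thesis using le nn by linarith
  next
    case 2
    then have "(\<Sum>i\<in>I. (\<omega> i - t * (c i * (a i - m i))) * (\<l> \<bullet> U i + \<kappa>)) > 0"
      using fin cfl pos by (intro sum_pos mult_pos_pos) auto
    then show ?thesis using le nn by linarith
  qed
qed

section \<open>Convexity of the entropies\<close>

lemma press_has_derivative:
  assumes "dens U > 0"
  shows "(press \<gamma> has_derivative (\<lambda>h. (\<gamma> - 1) * (gql_normal (vel U) (mag U) \<bullet> h))) (at U)"
proof -
  have g: "gql_normal v B = ((v \<bullet> v) / 2, - v, - B, 1)" for v B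
    by (simp add: gql_normal_def power2_norm_eq_inner)
  have "((\<lambda>U. (\<gamma> - 1) * (snd (snd (snd U)) - fst (snd U) \<bullet> fst (snd U) / (2 * fst U) - fst (snd (snd U)) \<bullet> fst (snd (snd U)) / 2))
     has_derivative (\<lambda>h. (\<gamma> - 1) * (gql_normal (vel U) (mag U) \<bullet> h))) (at U)"
    using assms
    by (auto intro!: derivative_eq_intros simp: fun_eq_iff dens_def vel_def g mom_def mag_def inner_prod_def
      inner_commute field_simps)
  then show ?thesis
    by (simp add: press_def[abs_def] state_components power2_norm_eq_inner)
qed

lemma dens_has_derivative: "(dens has_derivative dens) (at U)"
  unfolding dens_def[abs_def] by (auto intro!: derivative_eq_intros)

definition entropy_gradient :: "real \<Rightarrow> (real \<Rightarrow> real) \<Rightarrow> state \<Rightarrow> state" where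
  "entropy_gradient \<gamma> f W =
    (\<gamma> * deriv f (spec_entropy \<gamma> W) - f (spec_entropy \<gamma> W), 0, 0, 0)
    - ((\<gamma> - 1) * dens W * deriv f (spec_entropy \<gamma> W) / press \<gamma> W) *\<^sub>R gql_normal (vel W) (mag W)"

lemma eta_GDERIV:
  assumes W: "W \<in> admissible" and \<gamma>: "\<gamma> > 1" and f: "\<And>x. f differentiable at x"
  shows "GDERIV (eta \<gamma> f) W :> entropy_gradient \<gamma> f W"
proof -
  have \<rho>: "dens W > 0" and p: "press \<gamma> W > 0" using W \<gamma> by (auto simp: admissible_dens admissible_press)
  define s g where "s = spec_entropy \<gamma> W" and "g = gql_normal (vel W) (mag W)"
  have df: "DERIV f s :> deriv f s" using f DERIV_deriv_iff_real_differentiable by blast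
  have "(spec_entropy \<gamma> has_derivative (\<lambda>h. ((\<gamma> - 1) * (g \<bullet> h)) / press \<gamma> W - \<gamma> * (dens h / dens W))) (at W)"
    unfolding spec_entropy_def[abs_def] g_def using \<rho> p
    by (auto intro!: derivative_eq_intros press_has_derivative dens_has_derivative simp: field_simps)
  from DERIV_compose_FDERIV[OF df[unfolded s_def] this]
  have "((\<lambda>U. - dens U * f (spec_entropy \<gamma> U)) has_derivative
    (\<lambda>h. - dens W * ((((\<gamma> - 1) * (g \<bullet> h)) / press \<gamma> W - \<gamma> * (dens h / dens W)) * deriv f s) + (- dens h) * f s)) (at W)"
    unfolding s_def by (intro has_derivative_mult has_derivative_minus dens_has_derivative)
  moreover have "(\<lambda>h. - dens W * ((((\<gamma> - 1) * (g \<bullet> h)) / press \<gamma> W - \<gamma> * (dens h / dens W)) * deriv f s) + (- dens h) * f s)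
     = (\<lambda>h. h \<bullet> entropy_gradient \<gamma> f W)"
  proof
    fix h
    have *: "h \<bullet> entropy_gradient \<gamma> f W = (\<gamma> * deriv f s - f s) * dens h
      - ((\<gamma> - 1) * dens W * deriv f s / press \<gamma> W) * (g \<bullet> h)"
    proof -
      have "h \<bullet> (c, 0, 0, 0) = c * dens h" for c by (simp add: inner_prod_def dens_def)
      then show ?thesis
        unfolding entropy_gradient_def inner_diff_right inner_scaleR_right s_def g_def by (simp add: inner_commute)
    qed
    show "- dens W * ((((\<gamma> - 1) * (g \<bullet> h)) / press \<gamma> W - \<gamma> * (dens h / dens W)) * deriv f s) + (- dens h) * f s
      = h \<bullet> entropy_gradient \<gamma> f W" unfolding * using \<rho> p by (simp add: field_simps)
  qed
  ultimately show ?thesis by (simp add: gderiv_def eta_def[abs_def])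
qed

lemma entropy_vars_eq:
  assumes "W \<in> admissible" "\<gamma> > 1" "entropy_generator \<gamma> f"
  shows "entropy_vars \<gamma> f W = entropy_gradient \<gamma> f W"
proof -
  have G: "GDERIV (eta \<gamma> f) W :> entropy_gradient \<gamma> f W"
    using assms by (intro eta_GDERIV) (auto simp: entropy_generator_def C2_real_def)
  have "D = entropy_gradient \<gamma> f W" if "GDERIV (eta \<gamma> f) W :> D" for D
    using has_derivative_unique[OF that[unfolded gderiv_def] G[unfolded gderiv_def]]
    by (metis (no_types) vector_eq_ldot)
  with G show ?thesis unfolding entropy_vars_def by (intro the_equality)
qed

section \<open>Strict positivity of the relative entropy\<close>

lemma exp_gt_add_one: "t \<noteq> 0 \<Longrightarrow> exp t > 1 + (t::real)"
proof (cases "1 + t / 2 \<ge> 0")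
  case True
  assume t: "t \<noteq> 0"
  have "t * t > 0" using t not_real_square_gt_zero by blast
  then have "1 + t < (1 + t / 2)\<^sup>2" by (simp add: power2_eq_square algebra_simps)
  also have "\<dots> \<le> (exp (t / 2))\<^sup>2" using True by (intro power_mono) auto
  finally show ?thesis by (simp add: exp_double[symmetric])
next
  case False
  then have "1 + t < 0" by simp
  then show ?thesis using exp_gt_zero[of t] by linarith
qed

text \<open>The generator condition says that \<open>f\<close> is strictly concave as a function of
  \<open>exp (s / \<gamma>)\<close>: up to the factor \<open>\<gamma>\<close>, its derivative in
  that variable is \<open>\<phi>\<close>, which decreases. The claim is the strict tangent
  inequality at \<open>exp (a / \<gamma>)\<close>.\<close>

lemma entropy_generator_excess:
  assumes f: "entropy_generator \<gamma> f" and \<gamma>: "\<gamma> > 1" and x: "x \<noteq> 0"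
  shows "f a - f (a + x) + \<gamma> * deriv f a * (exp (x / \<gamma>) - 1) > 0"
proof -
  have d1: "DERIV f s :> deriv f s" for s
    using f DERIV_deriv_iff_real_differentiable by (auto simp: entropy_generator_def C2_real_def)
  have d2: "DERIV (deriv f) s :> deriv (deriv f) s" for s
    using f DERIV_deriv_iff_real_differentiable by (auto simp: entropy_generator_def C2_real_def)
  define \<phi> where "\<phi> s = deriv f s * exp (- s / \<gamma>)" for s
  have \<phi>': "\<exists>y. DERIV \<phi> s :> y \<and> y < 0" for s
  proof -
    have "DERIV \<phi> s :> deriv (deriv f) s * exp (- s / \<gamma>) + exp (- s / \<gamma>) * (- 1 / \<gamma>) * deriv f s"
      unfolding \<phi>_def[abs_def] using \<gamma> by (auto intro!: derivative_eq_intros d2)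
    moreover have "deriv (deriv f) s * exp (- s / \<gamma>) + exp (- s / \<gamma>) * (- 1 / \<gamma>) * deriv f s
      = - (exp (- s / \<gamma>) * (deriv f s - \<gamma> * deriv (deriv f) s)) / \<gamma>" using \<gamma> by (simp add: field_simps)
    moreover have "\<dots> < 0" using f \<gamma> by (auto simp: entropy_generator_def intro!: divide_neg_pos)
    ultimately show ?thesis by auto
  qed
  have anti: "\<phi> t < \<phi> s" if "s < t" for s t
    by (rule DERIV_neg_imp_decreasing[OF that]) (use \<phi>' in auto)
  define k where "k x = f a - f (a + x) + \<gamma> * deriv f a * (exp (x / \<gamma>) - 1)" for x
  define k' where "k' x = exp ((a + x) / \<gamma>) * (\<phi> a - \<phi> (a + x))" for x
  have k: "DERIV k t :> k' t" for t
  proof -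
    have "DERIV k t :> - (deriv f (a + t) * 1) + \<gamma> * deriv f a * (exp (t / \<gamma>) * (1 / \<gamma>))"
      unfolding k_def[abs_def] using \<gamma> by (auto intro!: derivative_eq_intros DERIV_chain2[OF d1])
    moreover have "- (deriv f (a + t) * 1) + \<gamma> * deriv f a * (exp (t / \<gamma>) * (1 / \<gamma>)) = k' t"
    proof -
      have "exp ((a + t) / \<gamma>) * exp (- a / \<gamma>) = exp (t / \<gamma>)" "exp ((a + t) / \<gamma>) * exp (- (a + t) / \<gamma>) = 1"
        by (simp_all add: exp_add[symmetric] add_divide_distrib diff_divide_distrib)
      then have "k' t = deriv f a * exp (t / \<gamma>) - deriv f (a + t)"
        by (simp only: k'_def \<phi>_def right_diff_distrib mult.left_commute[of "exp _"] mult_1_right)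
      then show ?thesis using \<gamma> by simp
    qed
    ultimately show ?thesis by simp
  qed
  have k0: "k 0 = 0" by (simp add: k_def)
  have "k x > 0"
  proof (cases "x > 0")
    case True
    from MVT2[OF this k] obtain z where z: "z > 0" "k x - k 0 = (x - 0) * k' z" by auto
    have "k' z > 0" using anti[of a "a + z"] z by (simp add: k'_def)
    then show ?thesis using z True k0 by simp
  next
    case False
    then have "x < 0" using x by simp
    from MVT2[OF this k] obtain z where z: "z < 0" "k 0 - k x = (0 - x) * k' z" by auto
    have "k' z < 0" using anti[of "a + z" a] z by (simp add: k'_def mult_pos_neg)
    then show ?thesis using z \<open>x < 0\<close> k0 mult_neg_neg[of x "k' z"] by simp
  qed
  then show ?thesis by (simp add: k_def)
qed

text \<open>In specific entropy, density and pressure, the thermodynamic part separates from the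
  kinetic and magnetic squares, so each can be shown nonnegative by itself.\<close>

lemma rel_entropy_eq:
  assumes U: "U \<in> admissible" and W: "W \<in> admissible" and \<gamma>: "\<gamma> > 1" and f: "entropy_generator \<gamma> f"
  defines "s \<equiv> spec_entropy \<gamma> U" and "a \<equiv> spec_entropy \<gamma> W"
  shows "rel_entropy \<gamma> f U W = dens U * (f a - f s) - \<gamma> * deriv f a * (dens U - dens W)
    + dens W * deriv f a * (press \<gamma> U / press \<gamma> W - 1)
    + (\<gamma> - 1) * dens W * deriv f a / press \<gamma> W *
      (dens U * (norm (vel U - vel W))\<^sup>2 / 2 + (norm (mag U - mag W))\<^sup>2 / 2)"
proof -
  note dU = admissible_dens[OF U] and dW = admissible_dens[OF W]
  have p: "press \<gamma> W > 0" using admissible_press[OF W \<gamma>] .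
  define g where "g = gql_normal (vel W) (mag W)"
  define q where "q = dens U * (norm (vel U - vel W))\<^sup>2 / 2 + (norm (mag U - mag W))\<^sup>2 / 2"
  have "g \<bullet> (U - W) = (press \<gamma> U - press \<gamma> W) / (\<gamma> - 1) + q"
    unfolding inner_diff_right g_def gql_normal_inner[OF \<gamma> dU] gql_normal_inner[OF \<gamma> dW]
    by (simp add: relative_energy_def thermo_kinetic_def q_def diff_divide_distrib)
  then have "entropy_vars \<gamma> f W \<bullet> (U - W) = (\<gamma> * deriv f a - f a) * (dens U - dens W)
     - (\<gamma> - 1) * dens W * deriv f a / press \<gamma> W * ((press \<gamma> U - press \<gamma> W) / (\<gamma> - 1) + q)"
    unfolding entropy_vars_eq[OF W \<gamma> f] entropy_gradient_def inner_diff_left inner_scaleR_left a_def g_def[symmetric]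
    by (simp add: inner_prod_def dens_def)
  then have "rel_entropy \<gamma> f U W = - dens U * f s + dens W * f a - (\<gamma> * deriv f a - f a) * (dens U - dens W)
     + (\<gamma> - 1) * dens W * deriv f a / press \<gamma> W * ((press \<gamma> U - press \<gamma> W) / (\<gamma> - 1)) 
     + (\<gamma> - 1) * dens W * deriv f a / press \<gamma> W * q"
    unfolding rel_entropy_def by (simp add: eta_def s_def a_def distrib_left)
  also have "(\<gamma> - 1) * dens W * deriv f a / press \<gamma> W * ((press \<gamma> U - press \<gamma> W) / (\<gamma> - 1)) =
    dens W * deriv f a * (press \<gamma> U / press \<gamma> W - 1)" using \<gamma> p by (simp add: field_simps)
  finally show ?thesis by (simp add: q_def algebra_simps)
qed

lemma admissible_eqI:
  assumes "U \<in> admissible" "W \<in> admissible" "\<gamma> > 1"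
    and "dens U = dens W" "vel U = vel W" "mag U = mag W" "press \<gamma> U = press \<gamma> W"
  shows "U = W"
proof -
  have "mom U = mom W" "ener U = ener W"
    using assms mom_eq[of U] mom_eq[of W] ener_eq[of \<gamma> U] ener_eq[of \<gamma> W] by (auto simp: admissible_dens)
  with assms(4,6) show ?thesis by (simp add: state_components prod_eq_iff)
qed

text \<open>The thermodynamic part is the excess \<open>k\<close> of the generator, which vanishes only for equal specific
  entropies, plus a positive multiple of a weighted AM-GM defect \<open>l\<close>.\<close>

lemma rel_entropy_pos:
  assumes U: "U \<in> admissible" and W: "W \<in> admissible" and \<gamma>: "\<gamma> > 1" and f: "entropy_generator \<gamma> f"
    and ne: "U \<noteq> W"
  shows "rel_entropy \<gamma> f U W > 0"
proof -
  note dU = admissible_dens[OF U] and dW = admissible_dens[OF W]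
  have p: "press \<gamma> U > 0" "press \<gamma> W > 0" using admissible_press U W \<gamma> by auto
  define s a where "s = spec_entropy \<gamma> U" and "a = spec_entropy \<gamma> W"
  define x y where "x = s - a" and "y = ln (dens U) - ln (dens W)"
  \<comment> \<open>\<open>\<gamma> * z\<close> is the logarithm of the pressure ratio;
    \<open>x\<close> and \<open>z\<close> both vanish exactly if density and pressure agree.\<close>
  define z where "z = x / \<gamma> + y"
  define F where "F = deriv f a"
  have F: "F > 0" using f by (simp add: F_def entropy_generator_def)
  have s: "s = a + x" by (simp add: x_def)
  have dy: "dens W = dens U * exp (- y)" using dU dW by (simp add: y_def exp_diff)
  have pr: "press \<gamma> U / press \<gamma> W = exp (x + \<gamma> * y)"
  proof -
    have "x + \<gamma> * y = ln (press \<gamma> U) - ln (press \<gamma> W)"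
      by (simp add: x_def y_def s_def a_def spec_entropy_def algebra_simps)
    then show ?thesis using p by (simp add: exp_diff)
  qed
  define q where "q = dens U * (norm (vel U - vel W))\<^sup>2 / 2 + (norm (mag U - mag W))\<^sup>2 / 2"
  define k where "k = f a - f s + \<gamma> * F * (exp (x / \<gamma>) - 1)"
  \<comment> \<open>Weighted means of \<open>exp (- z)\<close> and
    \<open>exp ((\<gamma> - 1) * z)\<close> with weights \<open>(\<gamma> - 1) / \<gamma>\<close>
    and \<open>1 / \<gamma>\<close>: the geometric mean is 1, and \<open>l\<close> is
    \<open>\<gamma>\<close> times the arithmetic mean minus 1.\<close>
  define l where "l = (\<gamma> - 1) * exp (- z) + exp ((\<gamma> - 1) * z) - \<gamma>"
  have e1: "exp (- y) = exp (x / \<gamma>) * exp (- z)" by (simp add: z_def exp_add[symmetric])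
  have e2: "exp (- y) * exp (x + \<gamma> * y) = exp (x / \<gamma>) * exp ((\<gamma> - 1) * z)"
    using \<gamma> by (simp add: z_def exp_add[symmetric] field_simps)
  have "dens U * (f a - f s) - \<gamma> * F * (dens U - dens W) + dens W * F * (press \<gamma> U / press \<gamma> W - 1) =
    dens U * ((f a - f s) - \<gamma> * F + (\<gamma> - 1) * F * exp (- y) + F * (exp (- y) * exp (x + \<gamma> * y)))"
    unfolding pr unfolding dy by (simp add: algebra_simps)
  also have "\<dots> = dens U * (k + F * exp (x / \<gamma>) * l)"
    unfolding e2 unfolding e1 k_def l_def by (simp add: algebra_simps)
  finally have H: "rel_entropy \<gamma> f U W = dens U * (k + F * exp (x / \<gamma>) * l) + (\<gamma> - 1) * dens W * F / press \<gamma> W * q"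
    unfolding rel_entropy_eq[OF U W \<gamma> f] s_def[symmetric] a_def[symmetric] F_def[symmetric] q_def[symmetric] by simp
  have k: "k > 0" if "x \<noteq> 0"
    using entropy_generator_excess[OF f \<gamma> that, of a] by (simp add: k_def s F_def)
  have k0: "k \<ge> 0" using k by (cases "x = 0") (auto simp: k_def s)
  have l: "l > 0" if "z \<noteq> 0"
  proof -
    have "(\<gamma> - 1) * exp (- z) > (\<gamma> - 1) * (1 + - z)" using exp_gt_add_one[of "- z"] that \<gamma> by simp
    moreover have "exp ((\<gamma> - 1) * z) > 1 + (\<gamma> - 1) * z" using exp_gt_add_one[of "(\<gamma> - 1) * z"] that \<gamma> by simp
    moreover have "(\<gamma> - 1) * (1 + - z) + (1 + (\<gamma> - 1) * z) = \<gamma>" by (simp add: algebra_simps)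
    ultimately show ?thesis unfolding l_def by linarith
  qed
  have l0: "l \<ge> 0" using l by (cases "z = 0") (auto simp: l_def)
  have q0: "q \<ge> 0" using dU by (simp add: q_def)
  have c: "(\<gamma> - 1) * dens W * F / press \<gamma> W > 0" using \<gamma> dW F p by simp
  have T0: "k + F * exp (x / \<gamma>) * l \<ge> 0" using k0 l0 F by simp
  consider "x \<noteq> 0 \<or> z \<noteq> 0" | "x = 0" "z = 0" by blast
  then show ?thesis
  proof cases
    case 1
    then have "k + F * exp (x / \<gamma>) * l > 0"
      using k l k0 l0 F by (auto intro: add_pos_nonneg add_nonneg_pos)
    from mult_pos_pos[OF dU this] show ?thesis unfolding H using mult_nonneg_nonneg[OF less_imp_le[OF c] q0]
      by linarith
  next
    case 2
    then have "y = 0" by (simp add: z_def)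
    with dy pr 2 p have "dens U = dens W" "press \<gamma> U = press \<gamma> W" by auto
    then have "vel U \<noteq> vel W \<or> mag U \<noteq> mag W" using admissible_eqI[OF U W \<gamma>] ne by auto
    then have "q > 0" using dU by (auto simp: q_def intro: add_pos_nonneg add_nonneg_pos)
    from mult_pos_pos[OF c this] show ?thesis unfolding H
      using mult_nonneg_nonneg[OF less_imp_le[OF dU] T0] by linarith
  qed
qed

section \<open>Quadrature identities on the mesh\<close>

text \<open>What \<open>integral_directional_derivative\<close> asks of its integrand. Closure under
  sums and products brings in polynomials without an explicit formula for their derivatives.\<close>

definition directionally_smooth :: "'a::real_normed_vector \<Rightarrow> ('a \<Rightarrow> real) \<Rightarrow> bool" where
  "directionally_smooth v p \<longleftrightarrow> continuous_on UNIV p \<and> (\<exists>p'. continuous_on UNIV p' \<and>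
     (\<forall>x s. ((\<lambda>s. p (x + s *\<^sub>R v)) has_real_derivative p' (x + s *\<^sub>R v)) (at s)))"

lemma directionally_smooth_const: "directionally_smooth v (\<lambda>_. c)"
  unfolding directionally_smooth_def by (intro conjI exI[of _ "\<lambda>_. 0"] continuous_intros) auto

lemma directionally_smooth_component: "directionally_smooth v (\<lambda>x. x $ i)" for v :: "real^'d"
  unfolding directionally_smooth_def
  by (intro conjI exI[of _ "\<lambda>_. v $ i"] continuous_intros) (auto intro!: derivative_eq_intros)

lemma directionally_smooth_mult:
  assumes "directionally_smooth v p" "directionally_smooth v q"
  shows "directionally_smooth v (\<lambda>x. p x * q x)"
proof -
  obtain p' q' where p: "continuous_on UNIV p" "continuous_on UNIV p'"
      "\<And>x s. ((\<lambda>s. p (x + s *\<^sub>R v)) has_real_derivative p' (x + s *\<^sub>R v)) (at s)"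
    and q: "continuous_on UNIV q" "continuous_on UNIV q'"
      "\<And>x s. ((\<lambda>s. q (x + s *\<^sub>R v)) has_real_derivative q' (x + s *\<^sub>R v)) (at s)"
    using assms unfolding directionally_smooth_def by blast
  show ?thesis unfolding directionally_smooth_def
    by (intro conjI exI[of _ "\<lambda>x. p' x * q x + q' x * p x"] continuous_intros p q allI DERIV_mult)
qed

lemma directionally_smooth_add:
  assumes "directionally_smooth v p" "directionally_smooth v q"
  shows "directionally_smooth v (\<lambda>x. p x + q x)"
proof -
  obtain p' q' where p: "continuous_on UNIV p" "continuous_on UNIV p'"
      "\<And>x s. ((\<lambda>s. p (x + s *\<^sub>R v)) has_real_derivative p' (x + s *\<^sub>R v)) (at s)"
    and q: "continuous_on UNIV q" "continuous_on UNIV q'"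
      "\<And>x s. ((\<lambda>s. q (x + s *\<^sub>R v)) has_real_derivative q' (x + s *\<^sub>R v)) (at s)"
    using assms unfolding directionally_smooth_def by blast
  show ?thesis unfolding directionally_smooth_def
    by (intro conjI exI[of _ "\<lambda>x. p' x + q' x"] continuous_intros p q allI DERIV_add)
qed

lemma directionally_smooth_sum: "(\<And>i. i \<in> A \<Longrightarrow> directionally_smooth v (p i)) \<Longrightarrow> directionally_smooth v (\<lambda>x. \<Sum>i\<in>A. p i x)"
  by (induction A rule: infinite_finite_induct) (auto intro: directionally_smooth_const directionally_smooth_add)

lemma directionally_smooth_prod: "(\<And>i. i \<in> A \<Longrightarrow> directionally_smooth v (p i)) \<Longrightarrow> directionally_smooth v (\<lambda>x. \<Prod>i\<in>A. p i x)"
  by (induction A rule: infinite_finite_induct) (auto intro: directionally_smooth_const directionally_smooth_mult)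

lemma directionally_smooth_power: "directionally_smooth v p \<Longrightarrow> directionally_smooth v (\<lambda>x. p x ^ n)"
  by (induction n) (auto intro: directionally_smooth_const directionally_smooth_mult)

lemma poly_le_directionally_smooth:
  fixes p :: "real^'d::finite \<Rightarrow> real"
  assumes "p \<in> poly_le k"
  shows "directionally_smooth v p"
proof -
  obtain c where "p = (\<lambda>x. \<Sum>\<alpha>\<in>{\<alpha> :: 'd \<Rightarrow> nat. (\<Sum>i\<in>UNIV. \<alpha> i) \<le> k}. c \<alpha> * (\<Prod>i\<in>UNIV. (x $ i) ^ \<alpha> i))"
    using assms unfolding poly_le_def by blast
  then show ?thesis
    by (auto intro!: directionally_smooth_sum directionally_smooth_mult directionally_smooth_const
        directionally_smooth_prod directionally_smooth_power directionally_smooth_component)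
qed

lemma poly_le_continuous: "p \<in> poly_le k \<Longrightarrow> continuous_on UNIV p"
  using poly_le_directionally_smooth[of p k 0] by (simp add: directionally_smooth_def)

text \<open>Finiteness of the exponent set matters: a sum over an infinite set would be 0. Exactness
  for constants yields positive face areas and cell volumes and the vanishing sum of
  normals.\<close>

lemma poly_le_one: "(\<lambda>_. 1) \<in> (poly_le k :: (real^'d::finite \<Rightarrow> real) set)"
proof -
  let ?A = "{\<alpha> :: 'd \<Rightarrow> nat. (\<Sum>i\<in>UNIV. \<alpha> i) \<le> k}"
  have "?A \<subseteq> PiE UNIV (\<lambda>_. {..k})"
  proof
    fix \<alpha> assume "\<alpha> \<in> ?A"
    then have "\<alpha> i \<le> k" for i using member_le_sum[of i UNIV \<alpha>] by auto
    then show "\<alpha> \<in> PiE UNIV (\<lambda>_. {..k})" by auto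
  qed
  then have fin: "finite ?A" by (rule finite_subset) (intro finite_PiE; simp)
  have "1 = (\<Sum>\<alpha>\<in>?A. (if \<alpha> = (\<lambda>_. 0) then 1 else 0) * (\<Prod>i\<in>UNIV. (x $ i) ^ \<alpha> i))" for x :: "real^'d"
  proof -
    have "(\<Sum>\<alpha>\<in>?A. (if \<alpha> = (\<lambda>_. 0) then 1 else 0) * (\<Prod>i\<in>UNIV. (x $ i) ^ \<alpha> i)) =
      (\<Sum>\<alpha>\<in>?A. if \<alpha> = (\<lambda>_. 0) then 1 else 0)" by (intro sum.cong) auto
    then show ?thesis using fin by simp
  qed
  then show ?thesis unfolding poly_le_def by (intro CollectI exI allI)
qed

lemma embed3_inner: "embed3 \<iota> x \<bullet> y = (\<Sum>i\<in>UNIV. x $ i * y $ \<iota> i)"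
  by (simp add: embed3_def inner_sum_left inner_axis')

lemma norm_embed3:
  assumes "inj \<iota>"
  shows "norm (embed3 \<iota> x) = norm x"
proof -
  have "embed3 \<iota> x $ \<iota> i = x $ i" for i
    using assms by (simp add: embed3_def axis_def inj_eq if_distrib cong: if_cong)
  then have "embed3 \<iota> x \<bullet> embed3 \<iota> x = x \<bullet> x" by (subst embed3_inner) (simp add: inner_vec_def)
  then show ?thesis by (simp add: norm_eq_sqrt_inner)
qed

lemma embed3_sum: "(\<Sum>i\<in>I. c i *\<^sub>R embed3 \<iota> (x i)) = embed3 \<iota> (\<Sum>i\<in>I. c i *\<^sub>R x i)"
proof (rule vector_eq_ldot[THEN iffD1, rule_format])
  fix y
  show "y \<bullet> (\<Sum>i\<in>I. c i *\<^sub>R embed3 \<iota> (x i)) = y \<bullet> embed3 \<iota> (\<Sum>i\<in>I. c i *\<^sub>R x i)"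
    by (subst (1 2) inner_commute, simp add: inner_sum_left embed3_inner sum_distrib_left sum_distrib_right)
      (subst sum.swap, simp add: mult.assoc)
qed

section \<open>Consequences of quadrature exactness in a cell\<close>

lemma finite_bidx:
  fixes D :: "'d::finite mhd_data"
  assumes "conforming_mesh (cells D) (faces D)" "K \<in> cells D"
  shows "finite (bidx D K)"
  using assms by (auto simp: bidx_def conforming_mesh_def face_family_def)

text \<open>With zero area, division by zero would make the average of the constant 1 equal to 0,
  whereas the quadrature weights sum to 1.\<close>

lemma face_area_pos:
  fixes D :: "'d::finite mhd_data"
  assumes "face_quadratures D" "K \<in> cells D" "e \<in> faces D K"
  shows "face_area e > 0"
proof -
  have "face_average e (\<lambda>_. 1) = 1"
    using assms poly_le_one[of "pdeg D"] unfolding face_quadratures_def by fastforce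
  then have "face_area e \<noteq> 0" by (auto simp: face_average_def)
  then show ?thesis by (simp add: face_area_def less_le)
qed

lemma cK_pos:
  fixes D :: "'d::finite mhd_data"
  assumes "face_quadratures D" "K \<in> cells D" "\<nu> \<in> bidx D K"
  shows "cK D \<nu> > 0"
  using assms face_area_pos[OF assms(1,2)] by (auto simp: bidx_def cK_def face_quadratures_def)

lemma cell_volume_pos:
  fixes D :: "'d::finite mhd_data"
  assumes "cell_quadratures D" "K \<in> cells D"
  shows "cell_volume K > 0"
proof -
  have "cell_average K (\<lambda>_. 1 :: real) = 1"
    using assms poly_le_one[of "pdeg D"] unfolding cell_quadratures_def by fastforce
  then have "cell_volume K \<noteq> 0" by (auto simp: cell_average_def)
  then show ?thesis by (simp add: cell_volume_def less_le)
qed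

lemma integral_face_quadrature:
  fixes D :: "'d::finite mhd_data"
  assumes "face_quadratures D" "K \<in> cells D" "e \<in> faces D K" "p \<in> poly_le (pdeg D)"
  shows "(LINT x:e|face_measure e. p x) = (\<Sum>q\<in>{1..num_fnodes D e}. cK D (e, q) * p (fnode D (e, q)))"
proof -
  have "face_average e p = (\<Sum>q\<in>{1..num_fnodes D e}. fweight D (e, q) * p (fnode D (e, q)))"
    using assms unfolding face_quadratures_def by blast
  moreover have "(LINT x:e|face_measure e. p x) = face_area e * face_average e p"
    using face_area_pos[OF assms(1-3)] by (simp add: face_average_def)
  ultimately show ?thesis by (simp add: sum_distrib_left cK_def mult.assoc)
qed

lemma mesh_cell:
  fixes D :: "'d::finite mhd_data"
  assumes "conforming_mesh (cells D) (faces D)" "K \<in> cells D"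
  shows "compact K" "face_family K (faces D K)"
    "\<And>e e'. e \<in> faces D K \<Longrightarrow> e' \<in> faces D K \<Longrightarrow> e \<noteq> e' \<Longrightarrow> rel_interior e \<inter> rel_interior e' = {}"
proof -
  note mesh = assms(1)[unfolded conforming_mesh_def]
  show "compact K" using mesh assms(2) by (intro polytopal_compact[of "int DIM(real^'d)"]) simp
  show "face_family K (faces D K)" using mesh assms(2) by simp
  show "rel_interior e \<inter> rel_interior e' = {}"
    if "e \<in> faces D K" "e' \<in> faces D K" "e \<noteq> e'" for e e'
    using conjunct2[OF conjunct2[OF conjunct2[OF mesh]]] assms(2) that by simp
qed

text \<open>The normal is constant on a planar face, so multiplying \<open>p\<close> by its
  component along \<open>v\<close> does not raise the degree and the face quadrature stays
  exact.\<close>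

lemma discrete_divergence_theorem:
  fixes D :: "'d::finite mhd_data" and p p' :: "real^'d \<Rightarrow> real"
  assumes mesh: "conforming_mesh (cells D) (faces D)" and quad: "face_quadratures D" and K: "K \<in> cells D"
    and p: "p \<in> poly_le (pdeg D)" and p': "continuous_on UNIV p'"
    and deriv: "\<And>x s. ((\<lambda>s. p (x + s *\<^sub>R v)) has_real_derivative p' (x + s *\<^sub>R v)) (at s)"
  shows "(LINT x:K|lborel. p' x) = (\<Sum>\<nu>\<in>bidx D K. cK D \<nu> * ((outward_normal K (fst \<nu>) \<bullet> v) * p (fnode D \<nu>)))"
proof -
  note m = mesh_cell[OF mesh K]
  have "(LINT x:K|lborel. p' x) = (\<Sum>e\<in>faces D K. (outward_normal K e \<bullet> v) * (LINT x:e|face_measure e. p x))"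
    by (rule integral_directional_derivative[OF m poly_le_continuous[OF p] p' deriv])
  also have "\<dots> = (\<Sum>e\<in>faces D K. \<Sum>q\<in>{1..num_fnodes D e}. cK D (e, q) * ((outward_normal K e \<bullet> v) * p (fnode D (e, q))))"
    by (intro sum.cong refl) (simp add: integral_face_quadrature[OF quad K _ p] sum_distrib_left mult.left_commute)
  also have "\<dots> = (\<Sum>\<nu>\<in>bidx D K. cK D \<nu> * ((outward_normal K (fst \<nu>) \<bullet> v) * p (fnode D \<nu>)))"
    unfolding bidx_def using m(2) by (subst sum.Sigma) (auto simp: face_family_def split_def)
  finally show ?thesis .
qed

lemma outward_normal_face:
  fixes D :: "'d::finite mhd_data"
  assumes "conforming_mesh (cells D) (faces D)" "K \<in> cells D" "e \<in> faces D K"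
  shows "norm (outward_normal K e) = 1"
  using mesh_cell(2)[OF assms(1,2)] assms(3) outward_normal[of e K]
  by (auto simp: face_family_def is_outward_normal_def)

lemma norm_normal3:
  fixes D :: "'d::finite mhd_data"
  assumes "conforming_mesh (cells D) (faces D)" "coordinate_labels (coord D)" "K \<in> cells D" "\<nu> \<in> bidx D K"
  shows "norm (normal3 D K \<nu>) = 1"
  using assms outward_normal_face[OF assms(1,3)]
  by (auto simp: normal3_def norm_embed3 coordinate_labels_def bidx_def)

lemma sum_normals:
  fixes D :: "'d::finite mhd_data"
  assumes "conforming_mesh (cells D) (faces D)" "face_quadratures D" "K \<in> cells D"
  shows "(\<Sum>\<nu>\<in>bidx D K. cK D \<nu> *\<^sub>R normal3 D K \<nu>) = 0"
proof -
  have "(\<Sum>\<nu>\<in>bidx D K. cK D \<nu> *\<^sub>R outward_normal K (fst \<nu>)) \<bullet> v = 0" for v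
    \<comment> \<open>The constant 1 has zero derivative in every direction
      \<open>v\<close>.\<close>
    using discrete_divergence_theorem[OF assms poly_le_one, of "\<lambda>_. 0" v]
    by (simp add: inner_sum_left set_lebesgue_integral_def)
  then have "(\<Sum>\<nu>\<in>bidx D K. cK D \<nu> *\<^sub>R outward_normal K (fst \<nu>)) = 0"
    by (metis inner_eq_zero_iff)
  then show ?thesis unfolding normal3_def embed3_sum by (simp add: embed3_def)
qed

lemma sol_component:
  fixes D :: "'d::finite mhd_data"
  assumes "ldf_polynomials D" "K \<in> cells D"
  shows "(\<lambda>x. mag (sol D K x) $ j) \<in> poly_le (pdeg D)"
proof -
  have "mag U $ j = U \<bullet> (0, 0, axis j 1, 0)" for U
    by (simp add: mag_def inner_prod_def inner_axis)
  moreover have "(0, 0, axis j 1, 0) \<in> (Basis :: state set)"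
    by (auto simp: Basis_prod_def axis_in_Basis_iff)
  ultimately show ?thesis using assms by (simp add: ldf_polynomials_def)
qed

text \<open>The divergence theorem is used for the \<open>i\<close>-th field component in the
  \<open>i\<close>-th coordinate direction; the volume terms then add up to the integral of the
  divergence, which vanishes pointwise in the cell.\<close>

lemma discrete_divergence_free:
  fixes D :: "'d::finite mhd_data"
  assumes mesh: "conforming_mesh (cells D) (faces D)" and quad: "face_quadratures D" and K: "K \<in> cells D"
    and ldf: "ldf_polynomials D"
  shows "(\<Sum>\<nu>\<in>bidx D K. cK D \<nu> * (mag (face_trace D K \<nu>) \<bullet> normal3 D K \<nu>)) = 0"
proof -
  define B where "B i x = mag (sol D K x) $ coord D i" for i x
  have B: "B i \<in> poly_le (pdeg D)" for i
    unfolding B_def by (rule sol_component[OF ldf K])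
  have "\<exists>p'. continuous_on UNIV p' \<and>
     (\<forall>x s. ((\<lambda>s. B i (x + s *\<^sub>R axis i 1)) has_real_derivative p' (x + s *\<^sub>R axis i 1)) (at s))" for i
    using poly_le_directionally_smooth[OF B, of "axis i 1" i] unfolding directionally_smooth_def by blast
  then obtain B' where B': "\<And>i. continuous_on UNIV (B' i)"
    "\<And>i x s. ((\<lambda>s. B i (x + s *\<^sub>R axis i 1)) has_real_derivative B' i (x + s *\<^sub>R axis i 1)) (at s)" by metis
  have div: "(\<Sum>i\<in>UNIV. B' i x) = 0" if "x \<in> K" for x
  proof -
    have "B' i x = deriv (\<lambda>t. mag (sol D K (x + t *\<^sub>R axis i 1)) $ coord D i) 0" for i
      using DERIV_imp_deriv[OF B'(2)[of i x 0]] by (simp add: B_def)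
    then show ?thesis using ldf K that by (simp add: ldf_polynomials_def divergence_B_def)
  qed
  have cK: "compact K" using mesh_cell(1)[OF mesh K] .
  have "(\<Sum>\<nu>\<in>bidx D K. cK D \<nu> * (mag (face_trace D K \<nu>) \<bullet> normal3 D K \<nu>)) =
    (\<Sum>i\<in>UNIV. \<Sum>\<nu>\<in>bidx D K. cK D \<nu> * ((outward_normal K (fst \<nu>) \<bullet> axis i 1) * B i (fnode D \<nu>)))"
    by (subst sum.swap) (auto intro!: sum.cong simp: normal3_def embed3_inner inner_commute[of "mag _"] sum_distrib_left
      inner_axis face_trace_def B_def)
  also have "\<dots> = (\<Sum>i\<in>UNIV. LINT x:K|lborel. B' i x)"
    using discrete_divergence_theorem[OF mesh quad K B B'] by simp
  also have "\<dots> = (\<integral>x. (\<Sum>i\<in>UNIV. indicator K x *\<^sub>R B' i x) \<partial>lborel)"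
    unfolding set_lebesgue_integral_def
    by (intro Bochner_Integration.integral_sum[symmetric] borel_integrable_compact[OF cK] continuous_on_subset[OF B'(1)]) auto
  also have "\<dots> = (\<integral>x. 0 \<partial>(lborel :: (real^'d) measure))"
    by (intro Bochner_Integration.integral_cong) (auto simp: indicator_def div)
  finally show ?thesis by simp
qed

lemma cell_average_quadrature:
  fixes D :: "'d::finite mhd_data"
  assumes mesh: "conforming_mesh (cells D) (faces D)" and quad: "cell_quadratures D" and K: "K \<in> cells D"
    and ldf: "ldf_polynomials D"
  shows "cell_average K (sol D K) = (\<Sum>\<alpha>\<in>iidx D K. iweight D K \<alpha> *\<^sub>R int_state D K \<alpha>)
    + (\<Sum>\<nu>\<in>bidx D K. bweight D K \<nu> *\<^sub>R face_trace D K \<nu>)"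
proof (rule euclidean_eqI)
  fix b :: state assume b: "b \<in> Basis"
  have poly: "(\<lambda>x. sol D K x \<bullet> b) \<in> poly_le (pdeg D)" if "b \<in> Basis" for b
    using ldf K that by (simp add: ldf_polynomials_def)
  have "continuous_on UNIV (\<lambda>x. \<Sum>b\<in>Basis. (sol D K x \<bullet> b) *\<^sub>R b)"
    by (intro continuous_intros poly_le_continuous[OF poly])
  then have "continuous_on UNIV (sol D K)" by (simp add: euclidean_representation)
  then have "integrable lborel (\<lambda>x. indicator K x *\<^sub>R sol D K x)"
    by (intro borel_integrable_compact[OF mesh_cell(1)[OF mesh K]]) (rule continuous_on_subset, auto)
  then have "cell_average K (sol D K) \<bullet> b = cell_average K (\<lambda>x. sol D K x \<bullet> b)"
    by (simp add: cell_average_def set_lebesgue_integral_def integral_inner_left[symmetric])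
  also have "\<dots> = (\<Sum>\<alpha>\<in>iidx D K. iweight D K \<alpha> * (sol D K (inode D K \<alpha>) \<bullet> b)) +
        (\<Sum>\<nu>\<in>bidx D K. bweight D K \<nu> * (sol D K (fnode D \<nu>) \<bullet> b))"
    using quad K poly[OF b] by (simp add: cell_quadratures_def)
  finally show "cell_average K (sol D K) \<bullet> b = ((\<Sum>\<alpha>\<in>iidx D K. iweight D K \<alpha> *\<^sub>R int_state D K \<alpha>)
    + (\<Sum>\<nu>\<in>bidx D K. bweight D K \<nu> *\<^sub>R face_trace D K \<nu>)) \<bullet> b"
    by (simp add: inner_add_left inner_sum_left int_state_def face_trace_def)
qed

section \<open>Entropy stability\<close>

text \<open>At a fixed state, linearity in the normal makes the weighted sum of potentials over a
  cell boundary vanish.\<close>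

lemma entropy_potential_linear:
  "\<exists>z. \<forall>n. entropy_potential \<gamma> f n W = z \<bullet> n"
proof (intro exI allI)
  fix n
  show "entropy_potential \<gamma> f n W =
    ((\<chi> i. entropy_vars \<gamma> f W \<bullet> flux \<gamma> i W) - eta \<gamma> f W *\<^sub>R vel W) \<bullet> n"
    by (simp add: entropy_potential_def entropy_flux_def flux_n_def inner_sum_right inner_diff_left
      inner_vec_def mult_ac right_diff_distrib sum_subtractf sum_distrib_left)
qed

text \<open>Here \<open>x\<close> is a single quotient below the supremum \<open>z\<close>. An
  infinite supremum makes the time-step bound 0, which forces \<open>t = 0\<close>; positivity of
  \<open>x\<close> excludes division by zero.\<close>

lemma ennreal_le_divide_mult_D:
  fixes t a c x :: real
  assumes le: "ennreal t \<le> ennreal a / (ennreal c * z)" and x: "ennreal x \<le> z"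
    and pos: "t \<ge> 0" "a \<ge> 0" "c > 0" "x > 0"
  shows "t * c * x \<le> a"
proof (cases z)
  case (real w)
  then have w: "x \<le> w" using x pos by (simp add: ennreal_le_iff)
  then have "ennreal t \<le> ennreal (a / (c * w))"
    using le real pos by (simp add: ennreal_mult[symmetric] divide_ennreal)
  then have "t \<le> a / (c * w)" using pos w by (simp add: ennreal_le_iff)
  then have "t * c * w \<le> a" using pos w by (simp add: pos_le_divide_eq mult.assoc)
  moreover have "t * c * x \<le> t * c * w" using w pos by (intro mult_left_mono) auto
  ultimately show ?thesis by simp
next
  case top
  then have "t = 0" using le pos by (simp add: ennreal_mult_top)
  then show ?thesis using pos by simp
qed

section \<open>Admissibility of the update and the entropy balance of a cell\<close>

lemma cell_update_admissible:
  fixes D :: "'d::finite mhd_data"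
  assumes lab: "coordinate_labels (coord D)" and \<gamma>: "gam D > 1" and \<sigma>: "0 < sig D" "sig D < 1"
    and mesh: "conforming_mesh (cells D) (faces D)" and fq: "face_quadratures D" and cq: "cell_quadratures D"
    and ldf: "ldf_polynomials D" and adm: "states_admissible D" and ws: "wave_speeds D" and sb: "speed_bounds D"
    and K: "K \<in> cells D" and \<tau>: "0 < \<tau>" "\<tau> \<le> tau0 D K"
  shows "forward_state D \<tau> K \<in> admissible"
proof -
  define I where "I = bidx D K"
  define n U c where "n = normal3 D K" and "U = face_trace D K" and "c = cK D"
  define V am ap where "V = ext_trace D K" and "am = amin D K" and "ap = aplus D K"
  define t where "t = \<tau> / cell_volume K"
  have vol: "cell_volume K > 0" by (rule cell_volume_pos[OF cq K])
  have t: "t > 0" using vol \<tau> by (simp add: t_def)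
  have fin: "finite I" "finite (iidx D K)" by (simp_all add: I_def finite_bidx[OF mesh K] iidx_def)
  have c: "c i > 0" if "i \<in> I" for i using cK_pos[OF fq K] that by (simp add: c_def I_def)
  have n: "norm (n i) = 1" if "i \<in> I" for i using norm_normal3[OF mesh lab K] that by (simp add: n_def I_def)
  have U: "U i \<in> admissible" "V i \<in> admissible" if "i \<in> I" for i
    using adm K that by (auto simp: states_admissible_def U_def V_def I_def)
  have A: "int_state D K \<alpha> \<in> admissible" if "\<alpha> \<in> iidx D K" for \<alpha>
    using adm K that by (auto simp: states_admissible_def)
  have \<omega>: "bweight D K i > 0" if "i \<in> I" for i using cq K that by (auto simp: cell_quadratures_def I_def)
  have \<omega>': "iweight D K i > 0" if "i \<in> iidx D K" for i using cq K that by (auto simp: cell_quadratures_def)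
  have one: "(\<Sum>i\<in>iidx D K. iweight D K i) + (\<Sum>i\<in>I. bweight D K i) = 1"
    using cq K by (auto simp: cell_quadratures_def I_def)
  have am: "am i \<le> am0 (gam D) (U i) (V i) (n i)" "am i < 0"
    and ap: "ap i \<ge> ap0 (gam D) (U i) (V i) (n i)" "0 < ap i" if "i \<in> I" for i
    using ws sb K that by (auto simp: wave_speeds_def speed_bounds_def am_def ap_def U_def V_def n_def I_def)
  have G: "GK D K i = hll_flux (gam D) (am i) (ap i) (U i) (V i) (n i)
      - (am i / (ap i - am i) * delta_B (U i) (V i) (n i)) *\<^sub>R source (U i)" for i
    by (simp add: GK_def Fhat_def am_def ap_def U_def V_def n_def)
  define a where "a = alpha_PP D K"
  \<comment> \<open>The sign of \<open>a i - am i\<close> is not assumed: a positive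
    \<open>\<tau>\<close> below \<open>tau0\<close> forces the minimum, hence every quotient, to be
    positive. The factor \<open>sig D < 1\<close> makes the condition strict.\<close>
  have cfl: "t * (c i * (a i - am i)) < bweight D K i" if i: "i \<in> I" for i
  proof -
    define m where "m = (MIN \<nu>\<in>I. bweight D K \<nu> / (c \<nu> * (a \<nu> - am \<nu>)))"
    have \<tau>m: "\<tau> \<le> sig D * cell_volume K * m"
      using \<tau>(2) by (simp add: tau0_def m_def I_def c_def a_def am_def)
    then have m: "m > 0" using \<tau>(1) \<sigma>(1) vol by (metis mult_pos_pos order_less_le_trans zero_less_mult_pos)
    have mi: "m \<le> bweight D K i / (c i * (a i - am i))" unfolding m_def using fin i by (intro Min_le) auto
    then have "bweight D K i / (c i * (a i - am i)) > 0" using m by linarith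
    then have ca: "c i * (a i - am i) > 0" using \<omega>[OF i] by (auto simp: zero_less_divide_iff)
    have "t \<le> sig D * m" using \<tau>m vol by (simp add: t_def pos_divide_le_eq mult_ac)
    then have "t * (c i * (a i - am i)) \<le> sig D * m * (c i * (a i - am i))" using ca by (intro mult_right_mono) auto
    also have "\<dots> \<le> sig D * bweight D K i"
      using mi ca \<sigma> by (simp add: pos_le_divide_eq mult.assoc)
    also have "\<dots> < bweight D K i" using \<sigma> \<omega>[OF i] by simp
    finally show ?thesis .
  qed
  have update: "forward_state D \<tau> K = (\<Sum>i\<in>iidx D K. iweight D K i *\<^sub>R int_state D K i)
      + (\<Sum>i\<in>I. bweight D K i *\<^sub>R U i) - t *\<^sub>R (\<Sum>i\<in>I. c i *\<^sub>R GK D K i)"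
    unfolding forward_state_def cell_average_quadrature[OF mesh cq K ldf]
    by (simp add: t_def I_def U_def c_def)
  show ?thesis
  proof (rule admissible_gqlI[OF \<gamma>])
    \<comment> \<open>The density is itself a linear functional; \<open>+ 0\<close> matches the
      constant \<open>\<kappa>\<close> of \<open>positive_update\<close>.\<close>
    have "(1, 0, 0, 0) \<bullet> forward_state D \<tau> K + 0 > 0"
      unfolding update
    proof (rule positive_update[where a = a and m = am])
      show "(\<Sum>i\<in>I. c i * ((1, 0, 0, 0) \<bullet> GK D K i)) \<le> (\<Sum>i\<in>I. c i * ((a i - am i) * ((1, 0, 0, 0) \<bullet> U i + 0)))"
      proof (intro sum_mono mult_left_mono)
        fix i assume i: "i \<in> I"
        have "(1, 0, 0, 0) \<bullet> GK D K i = dens (GK D K i)" by (simp add: inner_prod_def dens_def)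
        also have "\<dots> \<le> dens (U i) * (vel (U i) \<bullet> n i - am i)"
          unfolding G by (rule HLL_dens_bound[OF U[OF i] \<gamma> n[OF i] am[OF i] ap[OF i]])
        also have "\<dots> \<le> dens (U i) * (a i - am i)"
        proof (intro mult_left_mono diff_right_mono)
          have "0 \<le> 2 / perimeter D K * (\<Sum>\<mu>\<in>bidx D K. cK D \<mu> * mag_jump (face_trace D K i) (face_trace D K \<mu>))"
            using c U i by (intro mult_nonneg_nonneg divide_nonneg_nonneg sum_nonneg mag_jump_nonneg)
              (auto simp: perimeter_def c_def[symmetric] I_def[symmetric] U_def[symmetric] less_imp_le intro!: sum_nonneg)
          moreover have "0 \<le> split_speed (gam D) (U i) (n i)"
            by (rule split_speed_square(1)[OF U(1)[OF i] \<gamma> n[OF i]])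
          ultimately show "vel (U i) \<bullet> n i \<le> a i"
            by (simp add: a_def alpha_PP_def U_def n_def)
        qed (use admissible_dens[OF U(1)[OF i]] in auto)
        finally show "(1, 0, 0, 0) \<bullet> GK D K i \<le> (a i - am i) * ((1, 0, 0, 0) \<bullet> U i + 0)"
          by (simp add: inner_prod_def dens_def mult.commute)
      qed (use c in \<open>auto simp: less_imp_le\<close>)
    next
      show "0 < (1, 0, 0, 0) \<bullet> U i + 0" if "i \<in> I" for i
        using admissible_dens[OF U(1)[OF that]] by (simp add: inner_prod_def dens_def)
      show "0 < (1, 0, 0, 0) \<bullet> int_state D K i + 0" if "i \<in> iidx D K" for i
        using admissible_dens[OF A[OF that]] by (simp add: inner_prod_def dens_def)
    qed (use fin \<omega> \<omega>' one cfl t in auto)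
    then show "dens (forward_state D \<tau> K) > 0" by (simp add: inner_prod_def dens_def)
  next
    fix v B
    have e: "gql_normal v B \<bullet> W + (norm B)\<^sup>2 / 2 = relative_energy (gam D) v B W" if "W \<in> admissible" for W
      using gql_normal_inner[OF \<gamma> admissible_dens[OF that]] by simp
    show "gql_normal v B \<bullet> forward_state D \<tau> K + (norm B)\<^sup>2 / 2 > 0"
      unfolding update
    proof (rule positive_update[where a = a and m = am])
      \<comment> \<open>The interface estimate replaces each \<open>GK\<close> by the flux of the
        interior trace and an energy term, which removes the exterior states; the remaining sum of
        interior fluxes is handled by \<open>cell_gql_bound\<close>.\<close>
      have "(\<Sum>i\<in>I. c i * (gql_normal v B \<bullet> GK D K i)) \<le>
        (\<Sum>i\<in>I. c i * (gql_normal v B \<bullet> flux_n (gam D) (n i) (U i) - am i * relative_energy (gam D) v B (U i)))"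
      proof (intro sum_mono mult_left_mono)
        fix i assume i: "i \<in> I"
        show "gql_normal v B \<bullet> GK D K i \<le>
            gql_normal v B \<bullet> flux_n (gam D) (n i) (U i) - am i * relative_energy (gam D) v B (U i)"
          unfolding G by (rule HLL_gql_bound[OF U[OF i] \<gamma> n[OF i] am[OF i] ap[OF i]])
      qed (use c in \<open>auto simp: less_imp_le\<close>)
      also have "\<dots> \<le> (\<Sum>i\<in>I. c i * (a i * relative_energy (gam D) v B (U i)))
          - (\<Sum>i\<in>I. c i * (am i * relative_energy (gam D) v B (U i)))"
      proof -
        have "(\<Sum>i\<in>I. c i * (gql_normal v B \<bullet> flux_n (gam D) (n i) (U i))) \<le>
          (\<Sum>i\<in>I. c i * (a i * relative_energy (gam D) v B (U i)))"
          using cell_gql_bound[OF fin(1) c n U(1) \<gamma>, where v = v and B = B]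
            sum_normals[OF mesh fq K] discrete_divergence_free[OF mesh fq K ldf]
          by (simp add: a_def alpha_PP_def[abs_def] perimeter_def I_def c_def n_def U_def)
        then show ?thesis by (simp add: right_diff_distrib sum_subtractf)
      qed
      also have "\<dots> = (\<Sum>i\<in>I. c i * ((a i - am i) * (gql_normal v B \<bullet> U i + (norm B)\<^sup>2 / 2)))"
        unfolding sum_subtractf[symmetric] by (intro sum.cong refl) (simp add: e U algebra_simps)
      finally show "(\<Sum>i\<in>I. c i * (gql_normal v B \<bullet> GK D K i)) \<le>
        (\<Sum>i\<in>I. c i * ((a i - am i) * (gql_normal v B \<bullet> U i + (norm B)\<^sup>2 / 2)))" .
    next
      show "0 < gql_normal v B \<bullet> U i + (norm B)\<^sup>2 / 2" if "i \<in> I" for i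
        using relative_energy_pos[OF U(1)[OF that] \<gamma>] by (simp add: e[OF U(1)[OF that]])
      show "0 < gql_normal v B \<bullet> int_state D K i + (norm B)\<^sup>2 / 2" if "i \<in> iidx D K" for i
        using relative_energy_pos[OF A[OF that] \<gamma>] by (simp add: e[OF A[OF that]])
    qed (use fin \<omega> \<omega>' one cfl t in auto)
  qed
qed

text \<open>The quotient at the update itself is one of those in the supremum, and multiplying by
  the positive relative entropy gives the claim. Where \<open>P_rel\<close> is nonpositive, the term
  only helps.\<close>

lemma face_entropy_bound:
  fixes D :: "'d::finite mhd_data"
  assumes \<gamma>: "gam D > 1" and f: "entropy_generator (gam D) (ent D r)" and r: "r \<in> {1..num_ent D}"
    and W: "W = forward_state D \<tau> K" "W \<in> admissible" and U: "face_trace D K \<nu> \<in> admissible"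
    and \<tau>: "0 < \<tau>" "\<tau> \<le> tau0 D K"
    and c: "cK D \<nu> > 0" and vol: "cell_volume K > 0" and \<omega>: "bweight D K \<nu> > 0"
    and rel: "ennreal \<tau> \<le> ennreal (cell_volume K * bweight D K \<nu>) / (ennreal (cK D \<nu>) * c_rel D K \<nu>)"
    and d: "d_rel D K \<nu> r > 0 \<or>
      (GK D K \<nu>, qhat D K \<nu> r) =
        (flux_n (gam D) (normal3 D K \<nu>) (face_trace D K \<nu>),
         entropy_flux (gam D) (ent D r) (normal3 D K \<nu>) (face_trace D K \<nu>))"
  shows "\<tau> / cell_volume K * (cK D \<nu> * P_rel D K \<nu> r W)
    \<le> bweight D K \<nu> * rel_entropy (gam D) (ent D r) (face_trace D K \<nu>) W"
proof (cases "W = face_trace D K \<nu>")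
  \<comment> \<open>Here \<open>W\<close> is excluded from the supremum, and \<open>P = - d\<close> has to be controlled by hypothesis.\<close>
  case True
  have "P_rel D K \<nu> r W = - d_rel D K \<nu> r"
    unfolding True by (simp add: P_rel_def d_rel_def)
  moreover have "d_rel D K \<nu> r \<ge> 0" using d by (auto simp: d_rel_def entropy_potential_def)
  moreover have "rel_entropy (gam D) (ent D r) (face_trace D K \<nu>) W = 0"
    unfolding True by (simp add: rel_entropy_def)
  ultimately show ?thesis using \<tau> c vol by simp
next
  case False
  define P H where "P = P_rel D K \<nu> r W" and "H = rel_entropy (gam D) (ent D r) (face_trace D K \<nu>) W"
  have H: "H > 0" using rel_entropy_pos[OF U W(2) \<gamma> f] False by (simp add: H_def)
  show ?thesis
  proof (cases "P > 0")
    case True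
    have "W \<in> path_states D K" using W \<tau> by (auto simp: path_states_def)
    then have "ennreal (P / H) \<le> c_rel_r D K \<nu> r"
      unfolding c_rel_r_def using False True by (intro SUP_upper2[of W]) (auto simp: P_def H_def)
    also have "\<dots> \<le> c_rel D K \<nu>" unfolding c_rel_def by (rule SUP_upper[OF r])
    finally have "\<tau> * cK D \<nu> * (P / H) \<le> cell_volume K * bweight D K \<nu>"
      using rel True H c vol \<omega> \<tau> by (intro ennreal_le_divide_mult_D) auto
    then show ?thesis using H vol by (simp add: P_def[symmetric] H_def[symmetric] field_simps)
  next
    case False
    then have "\<tau> / cell_volume K * (cK D \<nu> * P) \<le> 0"
      using \<tau> c vol by (intro mult_nonneg_nonpos) auto
    also have "0 \<le> bweight D K \<nu> * H" using H \<omega> by simp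
    finally show ?thesis by (simp add: P_def H_def)
  qed
qed

lemma entropy_budget_decomposition:
  fixes D :: "'d::finite mhd_data"
  assumes mesh: "conforming_mesh (cells D) (faces D)" and fq: "face_quadratures D" and cq: "cell_quadratures D"
    and ldf: "ldf_polynomials D" and K: "K \<in> cells D" and W: "W = forward_state D \<tau> K"
  shows "entropy_budget D \<tau> K r = eta (gam D) (ent D r) W
    + (\<Sum>\<alpha>\<in>iidx D K. iweight D K \<alpha> * rel_entropy (gam D) (ent D r) (int_state D K \<alpha>) W)
    + (\<Sum>\<nu>\<in>bidx D K. bweight D K \<nu> * rel_entropy (gam D) (ent D r) (face_trace D K \<nu>) W
        - \<tau> / cell_volume K * (cK D \<nu> * P_rel D K \<nu> r W))"
proof -
  define I A where "I = bidx D K" and "A = iidx D K"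
  define \<omega> \<omega>' c U U' where "\<omega> = bweight D K" and "\<omega>' = iweight D K" and "c = cK D"
    and "U = face_trace D K" and "U' = int_state D K"
  define e H V where "e = eta (gam D) (ent D r)" and "H = (\<lambda>U. rel_entropy (gam D) (ent D r) U W)"
    and "V = entropy_vars (gam D) (ent D r) W"
  define n G q P where "n = normal3 D K" and "G = GK D K" and "q = (\<lambda>\<nu>. qhat D K \<nu> r)"
    and "P = (\<lambda>\<nu>. P_rel D K \<nu> r W)"
  define t where "t = \<tau> / cell_volume K"
  \<comment> \<open>An identity rather than a convexity inequality: the relative entropies are kept
    in full, since they have to pay for the boundary terms.\<close>
  have eH: "e X = e W - V \<bullet> W + V \<bullet> X + H X" for X
    by (simp add: e_def V_def H_def rel_entropy_def inner_diff_right)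
  have one: "(\<Sum>i\<in>A. \<omega>' i) + (\<Sum>i\<in>I. \<omega> i) = 1"
    using cq K by (auto simp: cell_quadratures_def I_def A_def \<omega>_def \<omega>'_def)
  have update: "(\<Sum>i\<in>A. \<omega>' i *\<^sub>R U' i) + (\<Sum>i\<in>I. \<omega> i *\<^sub>R U i) = W + t *\<^sub>R (\<Sum>i\<in>I. c i *\<^sub>R G i)"
    using cell_average_quadrature[OF mesh cq K ldf]
    by (simp add: W forward_state_def t_def I_def A_def U_def U'_def c_def \<omega>_def \<omega>'_def G_def)
  have "(\<Sum>i\<in>A. \<omega>' i * e (U' i)) + (\<Sum>i\<in>I. \<omega> i * e (U i)) =
    ((\<Sum>i\<in>A. \<omega>' i) + (\<Sum>i\<in>I. \<omega> i)) * (e W - V \<bullet> W)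
    + V \<bullet> ((\<Sum>i\<in>A. \<omega>' i *\<^sub>R U' i) + (\<Sum>i\<in>I. \<omega> i *\<^sub>R U i))
    + (\<Sum>i\<in>A. \<omega>' i * H (U' i)) + (\<Sum>i\<in>I. \<omega> i * H (U i))"
    by (subst (1 2) eH) (simp add: distrib_left distrib_right sum.distrib sum_distrib_right inner_add_right inner_sum_right)
  also have "\<dots> = e W + t * (\<Sum>i\<in>I. c i * (V \<bullet> G i)) + (\<Sum>i\<in>A. \<omega>' i * H (U' i)) + (\<Sum>i\<in>I. \<omega> i * H (U i))"
    unfolding one update by (simp add: inner_add_right inner_sum_right)
  finally have B: "entropy_budget D \<tau> K r = e W + (\<Sum>i\<in>A. \<omega>' i * H (U' i)) + (\<Sum>i\<in>I. \<omega> i * H (U i))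
      + t * (\<Sum>i\<in>I. c i * (V \<bullet> G i - q i))"
    by (simp add: entropy_budget_def e_def A_def I_def U_def U'_def \<omega>_def \<omega>'_def c_def q_def t_def
      right_diff_distrib sum_subtractf)
  obtain z where z: "\<And>n. entropy_potential (gam D) (ent D r) n W = z \<bullet> n"
    using entropy_potential_linear by blast
  define \<phi> where "\<phi> = source_potential (gam D) (ent D r) W"
  have nz: "(\<Sum>i\<in>I. c i * (x \<bullet> n i)) = 0" for x
    using arg_cong[OF sum_normals[OF mesh fq K], of "\<lambda>y. x \<bullet> y"] by (simp add: inner_sum_right c_def n_def I_def)
  have bz: "(\<Sum>i\<in>I. c i * (mag (U i) \<bullet> n i)) = 0"
    using discrete_divergence_free[OF mesh fq K ldf] by (simp add: c_def n_def I_def U_def)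
  \<comment> \<open>The three sums besides \<open>P\<close> vanish: those with \<open>z\<close> and
    \<open>mag W\<close> because \<open>W\<close> is the same at all nodes and the weighted normals
    cancel, the one with \<open>mag (U i)\<close> by the discrete divergence condition.\<close>
  have "(\<Sum>i\<in>I. c i * (V \<bullet> G i - q i)) =
    (\<Sum>i\<in>I. - (c i * P i) + c i * (z \<bullet> n i) + \<phi> * (c i * (mag W \<bullet> n i)) - \<phi> * (c i * (mag (U i) \<bullet> n i)))"
    by (intro sum.cong refl)
      (simp add: P_def P_rel_def z V_def G_def q_def n_def \<phi>_def mag_n_def U_def algebra_simps)
  also have "\<dots> = - (\<Sum>i\<in>I. c i * P i)"
    by (simp add: sum.distrib sum_subtractf sum_negf sum_distrib_left[symmetric] nz bz)
  finally show ?thesis unfolding B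
    by (simp add: e_def A_def I_def U_def U'_def \<omega>_def \<omega>'_def c_def P_def H_def t_def sum_subtractf sum_distrib_left)
qed

theorem theorem3p11:
  fixes D :: "'d::finite mhd_data" and \<tau> :: real
  assumes "CARD('d) \<in> {2, 3}" and "coordinate_labels (coord D)"
    and "gam D > 1" and "0 < sig D" and "sig D < 1"
    and "\<forall>r\<in>{1..num_ent D}. entropy_generator (gam D) (ent D r)"
    and "conforming_mesh (cells D) (faces D)"
    and "face_quadratures D" and "cell_quadratures D"
    and "ldf_polynomials D"
    and "states_admissible D"
    and "wave_speeds D" and "speed_bounds D"
    and "\<forall>K\<in>cells D. \<forall>\<nu>\<in>bidx D K. \<forall>r\<in>{1..num_ent D}.
      d_rel D K \<nu> r > 0 \<or>
      (GK D K \<nu>, qhat D K \<nu> r) =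
        (flux_n (gam D) (normal3 D K \<nu>) (face_trace D K \<nu>),
         entropy_flux (gam D) (ent D r) (normal3 D K \<nu>) (face_trace D K \<nu>))"
    and "0 < \<tau>" and "ennreal \<tau> \<le> tau_rel D"
  shows "\<forall>K\<in>cells D. forward_state D \<tau> K \<in> admissible \<and>
    (\<forall>r\<in>{1..num_ent D}.
      eta (gam D) (ent D r) (forward_state D \<tau> K) \<le> entropy_budget D \<tau> K r)"
proof (intro ballI conjI)
  fix K assume K: "K \<in> cells D"
  have le: "tau_rel D \<le> min (ennreal (tau0 D K))
     (INF \<nu>\<in>bidx D K. ennreal (cell_volume K * bweight D K \<nu>) / (ennreal (cK D \<nu>) * c_rel D K \<nu>))"
    unfolding tau_rel_def by (rule INF_lower[OF K])
  then have "ennreal \<tau> \<le> ennreal (tau0 D K)" using order_trans[OF assms(16) le] by simp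
  \<comment> \<open>\<open>ennreal\<close> sends a negative \<open>tau0\<close> to 0; this cannot be
    the case here because \<open>\<tau>\<close> is positive.\<close>
  then have \<tau>: "\<tau> \<le> tau0 D K" using \<open>0 < \<tau>\<close> by (simp add: ennreal_le_iff2)
  have rel: "ennreal \<tau> \<le> ennreal (cell_volume K * bweight D K \<nu>) / (ennreal (cK D \<nu>) * c_rel D K \<nu>)"
    if "\<nu> \<in> bidx D K" for \<nu>
  proof -
    have "ennreal \<tau> \<le> (INF \<nu>\<in>bidx D K. ennreal (cell_volume K * bweight D K \<nu>) / (ennreal (cK D \<nu>) * c_rel D K \<nu>))"
      using order_trans[OF assms(16) le] by simp
    also have "\<dots> \<le> ennreal (cell_volume K * bweight D K \<nu>) / (ennreal (cK D \<nu>) * c_rel D K \<nu>)"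
      by (rule INF_lower[OF that])
    finally show ?thesis .
  qed
  show W: "forward_state D \<tau> K \<in> admissible"
    by (rule cell_update_admissible) (use assms K \<tau> in auto)
  fix r assume r: "r \<in> {1..num_ent D}"
  then have f: "entropy_generator (gam D) (ent D r)" using assms(6) by blast
  have nonneg: "rel_entropy (gam D) (ent D r) X (forward_state D \<tau> K) \<ge> 0" if "X \<in> admissible" for X
    using rel_entropy_pos[OF that W \<open>gam D > 1\<close> f]
    by (cases "X = forward_state D \<tau> K") (auto simp: rel_entropy_def)
  have "0 \<le> (\<Sum>\<alpha>\<in>iidx D K. iweight D K \<alpha> * rel_entropy (gam D) (ent D r) (int_state D K \<alpha>) (forward_state D \<tau> K))"
    using assms(9,11) K
    by (intro sum_nonneg mult_nonneg_nonneg nonneg) (auto simp: cell_quadratures_def states_admissible_def less_imp_le)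
  moreover have "0 \<le> (\<Sum>\<nu>\<in>bidx D K. bweight D K \<nu> * rel_entropy (gam D) (ent D r) (face_trace D K \<nu>) (forward_state D \<tau> K)
        - \<tau> / cell_volume K * (cK D \<nu> * P_rel D K \<nu> r (forward_state D \<tau> K)))"
  proof (intro sum_nonneg)
    fix \<nu> assume \<nu>: "\<nu> \<in> bidx D K"
    have "\<tau> / cell_volume K * (cK D \<nu> * P_rel D K \<nu> r (forward_state D \<tau> K))
      \<le> bweight D K \<nu> * rel_entropy (gam D) (ent D r) (face_trace D K \<nu>) (forward_state D \<tau> K)"
    proof (rule face_entropy_bound[OF \<open>gam D > 1\<close> f r refl W _ \<open>0 < \<tau>\<close> \<tau>
          cK_pos[OF assms(8) K \<nu>] cell_volume_pos[OF assms(9) K] _ rel[OF \<nu>]])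
      show "face_trace D K \<nu> \<in> admissible" "0 < bweight D K \<nu>"
        using assms(9,11) K \<nu> by (auto simp: cell_quadratures_def states_admissible_def)
    qed (use assms(14) K \<nu> r in blast)
    then show "0 \<le> bweight D K \<nu> * rel_entropy (gam D) (ent D r) (face_trace D K \<nu>) (forward_state D \<tau> K)
        - \<tau> / cell_volume K * (cK D \<nu> * P_rel D K \<nu> r (forward_state D \<tau> K))" by simp
  qed
  ultimately show "eta (gam D) (ent D r) (forward_state D \<tau> K) \<le> entropy_budget D \<tau> K r"
    unfolding entropy_budget_decomposition[OF assms(7-10) K refl] by linarith
qed

end
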